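(* Let $G,H$ be nontrivial finitely generated groups, and assume that $H$ has polynomial growth. Then for every $p\in[1,2]$, $$\alpha_p^*(G\wr H)\ \ge\ \min\left\{\frac1p,\ \alpha_p^*(G)\right\}.$$ In particular, if in addition the growth rate of $H$ is at least quadratic, then for every $p\in[1,2]$, $$\alpha_p^*(\mathbb Z\wr H)=\alpha_p^*(C_2\wr H)=\frac1p .$$
   Context: For a group $G$ generated by a finite symmetric set $S$, $d_G$ denotes the left-invariant word metric induced by $S$. $L_p$ denotes $L_p([0,1])$. The $L_p$ compression exponent $\alpha_p^*(G)$ is the supremum of those $\alpha\ge 0$ for which there exist a Lipschitz function $f:(G,d_G)\to L_p$ and a constant $c>0$ with $\|f(x)-f(y)\|_p\ge c\,d_G(x,y)^\alpha$ for all $x,y\in G$; it does not depend on the choice of finite symmetric generating set. (For a finite group this supremum is $+\infty$.) The (restricted) wreath product $G\wr H$ is the group of all pairs $(f,x)$ where $x\in H$ and $f:H\to G$ has finite support (i.e. $f(z)=e_G$ for all but finitely many $z\in H$), with product $(f,x)(g,y)=\left(z\mapsto f(z)g(x^{-1}z),\,xy\right)$. It is finitely generated when $G$ and $H$ are. $C_2$ is the cyclic group of order $2$. $H$ has polynomial growth if the cardinality of the ball of radius $r$ around $e_H$ in $(H,d_H)$ is at most $Cr^d$ for some $C,d<\infty$ and all $r\ge1$; its growth rate is at least quadratic if this cardinality is at least $cr^2$ for some $c>0$ and all $r\ge 1$. *)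

theory Defs
  imports "HOL-Algebra.Algebra" "HOL-Analysis.Analysis"
begin

section \<open>Generating sets and word metrics\<close>

definition finitely_generated_group :: "('a, 'm) monoid_scheme \<Rightarrow> bool" where
  "finitely_generated_group G \<longleftrightarrow>
     group G \<and> (\<exists>S. finite S \<and> S \<subseteq> carrier G \<and> generate G S = carrier G)"

definition sym_gen_set :: "('a, 'm) monoid_scheme \<Rightarrow> 'a set \<Rightarrow> bool" where
  "sym_gen_set G S \<longleftrightarrow>
     finite S \<and> S \<subseteq> carrier G \<and> (\<forall>s\<in>S. inv\<^bsub>G\<^esub> s \<in> S) \<and> generate G S = carrier G"

definition word_prod :: "('a, 'm) monoid_scheme \<Rightarrow> 'a list \<Rightarrow> 'a" where
  "word_prod G ws = foldr (\<lambda>s x. s \<otimes>\<^bsub>G\<^esub> x) ws \<one>\<^bsub>G\<^esub>"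

definition word_length :: "('a, 'm) monoid_scheme \<Rightarrow> 'a set \<Rightarrow> 'a \<Rightarrow> nat" where
  "word_length G S x = (LEAST n. \<exists>ws. set ws \<subseteq> S \<and> length ws = n \<and> word_prod G ws = x)"

definition word_dist :: "('a, 'm) monoid_scheme \<Rightarrow> 'a set \<Rightarrow> 'a \<Rightarrow> 'a \<Rightarrow> nat" where
  "word_dist G S x y = word_length G S (inv\<^bsub>G\<^esub> x \<otimes>\<^bsub>G\<^esub> y)"

definition word_ball :: "('a, 'm) monoid_scheme \<Rightarrow> 'a set \<Rightarrow> real \<Rightarrow> 'a set" where
  "word_ball G S r = {x \<in> carrier G. real (word_dist G S \<one>\<^bsub>G\<^esub> x) \<le> r}"


section \<open>Growth\<close>

text \<open>
  These two properties, like the compression exponent below, do not depend on the choice of the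
  generating set; see \<open>polynomial_growth_iff\<close>, \<open>quadratic_growth_iff\<close> and
  \<open>Lp_compression_eq\<close>.
\<close>

definition polynomial_growth :: "('a, 'm) monoid_scheme \<Rightarrow> bool" where
  "polynomial_growth G \<longleftrightarrow>
     (\<exists>S. sym_gen_set G S \<and>
       (\<exists>C d :: real. \<forall>r\<ge>1. real (card (word_ball G S r)) \<le> C * r powr d))"

definition at_least_quadratic_growth :: "('a, 'm) monoid_scheme \<Rightarrow> bool" where
  "at_least_quadratic_growth G \<longleftrightarrow>
     (\<exists>S. sym_gen_set G S \<and>
       (\<exists>c>0. \<forall>r\<ge>1. real (card (word_ball G S r)) \<ge> c * r\<^sup>2))"


section \<open>The compression exponent in \<open>L\<^sub>p([0,1])\<close>\<close>

text \<open>
  Elements of \<open>L\<^sub>p([0,1])\<close> are represented by functions rather than by classes modulo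
  almost-everywhere equality. For maps into \<open>L\<^sub>p\<close> of which only the distances
  between values matter this makes no difference.
\<close>

definition Lp_space :: "real \<Rightarrow> (real \<Rightarrow> real) set" where
  "Lp_space p = {h. h \<in> borel_measurable (lebesgue_on {0..1}) \<and>
                    integrable (lebesgue_on {0..1}) (\<lambda>t. \<bar>h t\<bar> powr p)}"

definition Lp_norm :: "real \<Rightarrow> (real \<Rightarrow> real) \<Rightarrow> real" where
  "Lp_norm p h = (\<integral>t. \<bar>h t\<bar> powr p \<partial>lebesgue_on {0..1}) powr (1 / p)"

definition Lp_dist :: "real \<Rightarrow> (real \<Rightarrow> real) \<Rightarrow> (real \<Rightarrow> real) \<Rightarrow> real" where
  "Lp_dist p g h = Lp_norm p (\<lambda>t. g t - h t)"

text \<open>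
  Since \<open>0 powr \<alpha> = 0\<close> also for \<open>\<alpha> = 0\<close>, the lower bound is
  vacuous for \<open>x = y\<close>.
\<close>

definition Lp_compression_bound ::
    "real \<Rightarrow> ('a, 'm) monoid_scheme \<Rightarrow> 'a set \<Rightarrow> real \<Rightarrow> bool" where
  "Lp_compression_bound p G S \<alpha> \<longleftrightarrow>
     (\<exists>f. f \<in> carrier G \<rightarrow> Lp_space p \<and>
       (\<exists>L. \<forall>x\<in>carrier G. \<forall>y\<in>carrier G.
          Lp_dist p (f x) (f y) \<le> L * real (word_dist G S x y)) \<and>
       (\<exists>c>0. \<forall>x\<in>carrier G. \<forall>y\<in>carrier G.
          Lp_dist p (f x) (f y) \<ge> c * real (word_dist G S x y) powr \<alpha>))"

definition Lp_compression :: "real \<Rightarrow> ('a, 'm) monoid_scheme \<Rightarrow> ereal" where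
  "Lp_compression p G =
     Sup {ereal \<alpha> | \<alpha> S. sym_gen_set G S \<and> 0 \<le> \<alpha> \<and> Lp_compression_bound p G S \<alpha>}"


section \<open>Wreath products\<close>

text \<open>Functions on the group \<open>H\<close> are extensional, i.e. \<open>undefined\<close> off its carrier.\<close>

definition wreath_product ::
    "('a, 'm) monoid_scheme \<Rightarrow> ('b, 'n) monoid_scheme \<Rightarrow> (('b \<Rightarrow> 'a) \<times> 'b) monoid" where
  "wreath_product G H =
     \<lparr>carrier = {f \<in> carrier H \<rightarrow>\<^sub>E carrier G. finite {z \<in> carrier H. f z \<noteq> \<one>\<^bsub>G\<^esub>}} \<times> carrier H,
      monoid.mult = (\<lambda>(f, x) (g, y).
        (\<lambda>z\<in>carrier H. f z \<otimes>\<^bsub>G\<^esub> g (inv\<^bsub>H\<^esub> x \<otimes>\<^bsub>H\<^esub> z), x \<otimes>\<^bsub>H\<^esub> y)),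
      one = (\<lambda>z\<in>carrier H. \<one>\<^bsub>G\<^esub>, \<one>\<^bsub>H\<^esub>)\<rparr>"

lemma group_wreath_product:
  assumes "group G" "group H"
  shows "group (wreath_product G H)"
proof -
  interpret G: group G by fact
  interpret H: group H by fact
  let ?W = "wreath_product G H"
  let ?F = "{f \<in> carrier H \<rightarrow>\<^sub>E carrier G. finite {z \<in> carrier H. f z \<noteq> \<one>\<^bsub>G\<^esub>}}"
  have shift: "finite {z \<in> carrier H. g (inv\<^bsub>H\<^esub> x \<otimes>\<^bsub>H\<^esub> z) \<noteq> \<one>\<^bsub>G\<^esub>}"
    if "finite {z \<in> carrier H. g z \<noteq> \<one>\<^bsub>G\<^esub>}" "x \<in> carrier H" for g x
  proof (rule finite_subset)
    show "finite ((\<lambda>z. x \<otimes>\<^bsub>H\<^esub> z) ` {z \<in> carrier H. g z \<noteq> \<one>\<^bsub>G\<^esub>})"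
      using that by blast
    show "{z \<in> carrier H. g (inv\<^bsub>H\<^esub> x \<otimes>\<^bsub>H\<^esub> z) \<noteq> \<one>\<^bsub>G\<^esub>}
            \<subseteq> (\<lambda>z. x \<otimes>\<^bsub>H\<^esub> z) ` {z \<in> carrier H. g z \<noteq> \<one>\<^bsub>G\<^esub>}"
    proof
      fix z assume z: "z \<in> {z \<in> carrier H. g (inv\<^bsub>H\<^esub> x \<otimes>\<^bsub>H\<^esub> z) \<noteq> \<one>\<^bsub>G\<^esub>}"
      with that have "z = x \<otimes>\<^bsub>H\<^esub> (inv\<^bsub>H\<^esub> x \<otimes>\<^bsub>H\<^esub> z)"
        by (simp flip: H.m_assoc)
      with z that show "z \<in> (\<lambda>z. x \<otimes>\<^bsub>H\<^esub> z) ` {z \<in> carrier H. g z \<noteq> \<one>\<^bsub>G\<^esub>}"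
        by (intro image_eqI[of _ _ "inv\<^bsub>H\<^esub> x \<otimes>\<^bsub>H\<^esub> z"]) auto
    qed
  qed
  have mult_F: "(\<lambda>z\<in>carrier H. f z \<otimes>\<^bsub>G\<^esub> g (inv\<^bsub>H\<^esub> x \<otimes>\<^bsub>H\<^esub> z)) \<in> ?F"
    if f: "f \<in> ?F" and g: "g \<in> ?F" and x: "x \<in> carrier H" for f g x
  proof -
    have "finite ({z \<in> carrier H. f z \<noteq> \<one>\<^bsub>G\<^esub>} \<union>
                  {z \<in> carrier H. g (inv\<^bsub>H\<^esub> x \<otimes>\<^bsub>H\<^esub> z) \<noteq> \<one>\<^bsub>G\<^esub>})"
      using f g x shift by auto
    then have "finite {z \<in> carrier H. f z \<otimes>\<^bsub>G\<^esub> g (inv\<^bsub>H\<^esub> x \<otimes>\<^bsub>H\<^esub> z) \<noteq> \<one>\<^bsub>G\<^esub>}"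
      by (rule rev_finite_subset) auto
    moreover have "{z \<in> carrier H. (\<lambda>z\<in>carrier H. f z \<otimes>\<^bsub>G\<^esub> g (inv\<^bsub>H\<^esub> x \<otimes>\<^bsub>H\<^esub> z)) z \<noteq> \<one>\<^bsub>G\<^esub>}
        = {z \<in> carrier H. f z \<otimes>\<^bsub>G\<^esub> g (inv\<^bsub>H\<^esub> x \<otimes>\<^bsub>H\<^esub> z) \<noteq> \<one>\<^bsub>G\<^esub>}"
      by auto
    ultimately show ?thesis using f g x by (auto simp: PiE_iff)
  qed
  show ?thesis
  proof (rule groupI)
    fix a b assume ab: "a \<in> carrier ?W" "b \<in> carrier ?W"
    obtain f x g y where eq: "a = (f, x)" "b = (g, y)" by (metis surj_pair)
    have "f \<in> ?F" "g \<in> ?F" and x: "x \<in> carrier H" and y: "y \<in> carrier H"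
      using ab by (simp_all add: eq wreath_product_def)
    then have "(\<lambda>z\<in>carrier H. f z \<otimes>\<^bsub>G\<^esub> g (inv\<^bsub>H\<^esub> x \<otimes>\<^bsub>H\<^esub> z)) \<in> ?F"
      by (intro mult_F)
    moreover have "x \<otimes>\<^bsub>H\<^esub> y \<in> carrier H" using x y by simp
    ultimately show "a \<otimes>\<^bsub>?W\<^esub> b \<in> carrier ?W"
      unfolding eq wreath_product_def partial_object.simps monoid.simps prod.case by (rule SigmaI)
  next
    show "\<one>\<^bsub>?W\<^esub> \<in> carrier ?W" by (auto simp: wreath_product_def)
  next
    fix a b c assume abc: "a \<in> carrier ?W" "b \<in> carrier ?W" "c \<in> carrier ?W"
    obtain f x g y h w where eq: "a = (f, x)" "b = (g, y)" "c = (h, w)"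
      by (metis surj_pair)
    have f: "\<And>z. z \<in> carrier H \<Longrightarrow> f z \<in> carrier G" and x: "x \<in> carrier H"
      and g: "\<And>z. z \<in> carrier H \<Longrightarrow> g z \<in> carrier G" and y: "y \<in> carrier H"
      and h: "\<And>z. z \<in> carrier H \<Longrightarrow> h z \<in> carrier G" and w: "w \<in> carrier H"
      using abc by (auto simp: eq wreath_product_def dest: PiE_mem)
    show "a \<otimes>\<^bsub>?W\<^esub> b \<otimes>\<^bsub>?W\<^esub> c = a \<otimes>\<^bsub>?W\<^esub> (b \<otimes>\<^bsub>?W\<^esub> c)"
      using x y w
      by (simp add: eq wreath_product_def f g h G.m_assoc H.m_assoc H.inv_mult_group
          cong: restrict_cong)
  next
    fix a assume A: "a \<in> carrier ?W"
    obtain f x where eq: "a = (f, x)" by (metis surj_pair)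
    have f: "f \<in> carrier H \<rightarrow>\<^sub>E carrier G" and x: "x \<in> carrier H"
      using A by (auto simp: eq wreath_product_def)
    have "(\<lambda>z\<in>carrier H. f z) = f" using f by (simp add: PiE_restrict)
    then show "\<one>\<^bsub>?W\<^esub> \<otimes>\<^bsub>?W\<^esub> a = a"
      using x by (simp add: eq wreath_product_def PiE_mem[OF f] cong: restrict_cong)
  next
    fix a assume "a \<in> carrier ?W"
    then obtain f x where a: "a = (f, x)" and f: "f \<in> ?F" and x: "x \<in> carrier H"
      by (auto simp: wreath_product_def)
    have fG: "f z \<in> carrier G" if "z \<in> carrier H" for z
      using f that by (auto dest: PiE_mem)
    let ?g = "\<lambda>z\<in>carrier H. inv\<^bsub>G\<^esub> f (x \<otimes>\<^bsub>H\<^esub> z)"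
    have "finite {z \<in> carrier H. f (x \<otimes>\<^bsub>H\<^esub> z) \<noteq> \<one>\<^bsub>G\<^esub>}"
      using shift[of f "inv\<^bsub>H\<^esub> x"] f x by simp
    then have "finite {z \<in> carrier H. ?g z \<noteq> \<one>\<^bsub>G\<^esub>}"
      by (rule rev_finite_subset) auto
    moreover have "?g \<in> carrier H \<rightarrow>\<^sub>E carrier G" using x fG by auto
    ultimately have "(?g, inv\<^bsub>H\<^esub> x) \<in> carrier ?W"
      using x by (simp add: wreath_product_def)
    moreover have "(?g, inv\<^bsub>H\<^esub> x) \<otimes>\<^bsub>?W\<^esub> a = \<one>\<^bsub>?W\<^esub>"
      using x by (simp add: a wreath_product_def fG cong: restrict_cong)
    ultimately show "\<exists>b\<in>carrier ?W. b \<otimes>\<^bsub>?W\<^esub> a = \<one>\<^bsub>?W\<^esub>" by blast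
  qed
qed


section \<open>Independence of the generating set\<close>

context group
begin

lemma sym_gen_set_exists:
  assumes "finitely_generated_group G"
  shows "\<exists>S. sym_gen_set G S"
proof -
  obtain S where S: "finite S" "S \<subseteq> carrier G" "generate G S = carrier G"
    using assms by (auto simp: finitely_generated_group_def)
  let ?T = "S \<union> (\<lambda>s. inv s) ` S"
  have T: "?T \<subseteq> carrier G" using S by auto
  have "generate G S \<subseteq> generate G ?T" by (rule mono_generate) auto
  then have "generate G ?T = carrier G"
    using S T generate_incl by (metis subset_antisym)
  then have "sym_gen_set G ?T" using S T unfolding sym_gen_set_def by auto
  then show ?thesis ..
qed

lemma word_prod_Nil [simp]: "word_prod G [] = \<one>"
  by (simp add: word_prod_def)

lemma word_prod_Cons [simp]: "word_prod G (s # ws) = s \<otimes> word_prod G ws"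
  by (simp add: word_prod_def)

lemma word_prod_closed [simp]: "set ws \<subseteq> carrier G \<Longrightarrow> word_prod G ws \<in> carrier G"
  by (induction ws) auto

lemma word_prod_append:
  "set us \<subseteq> carrier G \<Longrightarrow> set vs \<subseteq> carrier G \<Longrightarrow>
     word_prod G (us @ vs) = word_prod G us \<otimes> word_prod G vs"
  by (induction us) (auto simp: m_assoc)

lemma word_exists:
  assumes S: "sym_gen_set G S" and x: "x \<in> carrier G"
  shows "\<exists>ws. set ws \<subseteq> S \<and> word_prod G ws = x"
proof -
  have SG: "S \<subseteq> carrier G" using S by (simp add: sym_gen_set_def)
  have "x \<in> generate G S" using S x by (simp add: sym_gen_set_def)
  then show ?thesis
  proof induction
    case one
    show ?case by (rule exI[of _ "[]"]) simp
  next
    case (incl h)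
    then show ?case using SG by (intro exI[of _ "[h]"]) auto
  next
    case (inv h)
    then show ?case using S SG by (intro exI[of _ "[inv h]"]) (auto simp: sym_gen_set_def)
  next
    case (eng h1 h2)
    then obtain us vs where "set us \<subseteq> S" "word_prod G us = h1" "set vs \<subseteq> S" "word_prod G vs = h2"
      by blast
    then show ?case using SG by (intro exI[of _ "us @ vs"]) (auto simp: word_prod_append)
  qed
qed

lemma word_length_witness:
  assumes "sym_gen_set G S" "x \<in> carrier G"
  shows "\<exists>ws. set ws \<subseteq> S \<and> length ws = word_length G S x \<and> word_prod G ws = x"
  unfolding word_length_def by (rule LeastI_ex) (use word_exists[OF assms] in blast)

lemma word_length_le:
  "set ws \<subseteq> S \<Longrightarrow> word_prod G ws = x \<Longrightarrow> word_length G S x \<le> length ws"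
  unfolding word_length_def by (rule Least_le) blast

lemma word_length_mult:
  assumes S: "sym_gen_set G S" and x: "x \<in> carrier G" and y: "y \<in> carrier G"
  shows "word_length G S (x \<otimes> y) \<le> word_length G S x + word_length G S y"
proof -
  have SG: "S \<subseteq> carrier G" using S by (simp add: sym_gen_set_def)
  obtain us vs where
    "set us \<subseteq> S" "length us = word_length G S x" "word_prod G us = x"
    "set vs \<subseteq> S" "length vs = word_length G S y" "word_prod G vs = y"
    using word_length_witness[OF S] x y by metis
  then show ?thesis
    using word_length_le[of "us @ vs" S "x \<otimes> y"] SG by (auto simp: word_prod_append)
qed

lemma word_length_comparison:
  assumes S: "sym_gen_set G S" and T: "sym_gen_set G T"
  obtains K :: nat where "K \<ge> 1" "\<And>x. x \<in> carrier G \<Longrightarrow> word_length G S x \<le> K * word_length G T x"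
proof -
  have TG: "T \<subseteq> carrier G" and finT: "finite T" using T by (auto simp: sym_gen_set_def)
  define K where "K = Max (insert 1 (word_length G S ` T))"
  have K1: "K \<ge> 1" using finT by (simp add: K_def)
  have KT: "word_length G S t \<le> K" if "t \<in> T" for t
    using finT that by (simp add: K_def Max_ge)
  have *: "word_length G S (word_prod G ws) \<le> K * length ws" if "set ws \<subseteq> T" for ws
    using that
  proof (induction ws)
    case Nil
    show ?case using word_length_le[of "[]" S \<one>] by simp
  next
    case (Cons t ws)
    then have "word_length G S (t \<otimes> word_prod G ws)
        \<le> word_length G S t + word_length G S (word_prod G ws)"
      using TG by (intro word_length_mult[OF S]) auto
    also have "\<dots> \<le> K + K * length ws" using Cons KT by (intro add_mono) auto
    finally show ?case by simp
  qed
  have "word_length G S x \<le> K * word_length G T x" if "x \<in> carrier G" for x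
    using word_length_witness[OF T that] * by metis
  then show ?thesis by (rule that[OF K1])
qed

lemma word_ball_eq: "word_ball G S r = {x \<in> carrier G. real (word_length G S x) \<le> r}"
  by (auto simp: word_ball_def word_dist_def)

lemma finite_word_ball:
  assumes S: "sym_gen_set G S"
  shows "finite (word_ball G S r)"
proof -
  have "finite {ws. set ws \<subseteq> S \<and> length ws \<le> nat \<lfloor>r\<rfloor>}"
    using S by (intro finite_lists_length_le) (simp add: sym_gen_set_def)
  then have "finite (word_prod G ` {ws. set ws \<subseteq> S \<and> length ws \<le> nat \<lfloor>r\<rfloor>})" by blast
  moreover have "word_ball G S r \<subseteq> word_prod G ` {ws. set ws \<subseteq> S \<and> length ws \<le> nat \<lfloor>r\<rfloor>}"
  proof
    fix x assume x: "x \<in> word_ball G S r"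
    then obtain ws where ws: "set ws \<subseteq> S" "length ws = word_length G S x" "word_prod G ws = x"
      using word_length_witness[OF S] by (auto simp: word_ball_eq)
    moreover have "length ws \<le> nat \<lfloor>r\<rfloor>" using x ws by (simp add: word_ball_eq le_nat_floor)
    ultimately show "x \<in> word_prod G ` {ws. set ws \<subseteq> S \<and> length ws \<le> nat \<lfloor>r\<rfloor>}" by blast
  qed
  ultimately show ?thesis by (rule rev_finite_subset)
qed

lemma card_word_ball_comparison:
  assumes S: "sym_gen_set G S" and T: "sym_gen_set G T"
  obtains K :: nat where "K \<ge> 1" "\<And>r :: real. card (word_ball G T r) \<le> card (word_ball G S (real K * r))"
proof -
  obtain K :: nat where K: "K \<ge> 1"
    "\<And>x. x \<in> carrier G \<Longrightarrow> word_length G S x \<le> K * word_length G T x"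
    using word_length_comparison[OF S T] by blast
  have "word_ball G T r \<subseteq> word_ball G S (real K * r)" for r :: real
  proof
    fix x assume x: "x \<in> word_ball G T r"
    have "real (word_length G S x) \<le> real (K * word_length G T x)"
      using K(2)[of x] x by (simp only: of_nat_le_iff word_ball_eq) auto
    also have "\<dots> \<le> K * r" using x by (simp add: word_ball_eq mult_left_mono)
    finally show "x \<in> word_ball G S (K * r)" using x by (simp add: word_ball_eq)
  qed
  then have "card (word_ball G T r) \<le> card (word_ball G S (real K * r))" for r :: real
    by (intro card_mono finite_word_ball[OF S])
  then show ?thesis by (rule that[OF K(1)])
qed

lemma polynomial_growth_iff:
  assumes T: "sym_gen_set G T"
  shows "polynomial_growth G \<longleftrightarrow>
    (\<exists>C d :: real. \<forall>r\<ge>1. real (card (word_ball G T r)) \<le> C * r powr d)"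
proof
  assume "polynomial_growth G"
  then obtain S C d where S: "sym_gen_set G S"
    and C: "\<And>r. r \<ge> 1 \<Longrightarrow> real (card (word_ball G S r)) \<le> C * r powr d"
    by (auto simp: polynomial_growth_def)
  obtain K :: nat where K: "K \<ge> 1" "\<And>r :: real. card (word_ball G T r) \<le> card (word_ball G S (real K * r))"
    using card_word_ball_comparison[OF S T] by blast
  have "real (card (word_ball G T r)) \<le> (C * K powr d) * r powr d" if "r \<ge> 1" for r
  proof -
    have "1 * 1 \<le> real K * r" using K(1) that by (intro mult_mono) auto
    then have "real (card (word_ball G S (K * r))) \<le> C * (K * r) powr d" using C by simp
    moreover have "(K * r) powr d = K powr d * r powr d" using that by (simp add: powr_mult)
    ultimately show ?thesis using K(2)[of r] by (simp add: mult.assoc)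
  qed
  then show "\<exists>C d :: real. \<forall>r\<ge>1. real (card (word_ball G T r)) \<le> C * r powr d" by blast
qed (use T in \<open>auto simp: polynomial_growth_def\<close>)

lemma quadratic_growth_iff:
  assumes T: "sym_gen_set G T"
  shows "at_least_quadratic_growth G \<longleftrightarrow>
    (\<exists>c>0. \<forall>r\<ge>1. real (card (word_ball G T r)) \<ge> c * r\<^sup>2)"
proof
  assume "at_least_quadratic_growth G"
  then obtain S c where S: "sym_gen_set G S" and c: "c > 0"
    "\<And>r. r \<ge> 1 \<Longrightarrow> real (card (word_ball G S r)) \<ge> c * r\<^sup>2"
    by (auto simp: at_least_quadratic_growth_def)
  obtain K :: nat where K: "K \<ge> 1" "\<And>r :: real. card (word_ball G S r) \<le> card (word_ball G T (K * r))"
    using card_word_ball_comparison[OF T S] by blast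
  let ?c = "min c 1 / (real K)\<^sup>2"
  have "real (card (word_ball G T r)) \<ge> ?c * r\<^sup>2" if r: "r \<ge> 1" for r
  proof (cases "r \<ge> K")
    case True
    have "?c * r\<^sup>2 = min c 1 * (r / K)\<^sup>2" by (simp add: power_divide)
    also have "\<dots> \<le> c * (r / K)\<^sup>2" by (intro mult_right_mono) auto
    also have "\<dots> \<le> card (word_ball G S (r / K))" using True K(1) by (intro c(2)) auto
    also have "\<dots> \<le> card (word_ball G T r)" using K(1) K(2)[of "r / K"] by simp
    finally show ?thesis .
  next
    case False
    have "word_length G T \<one> = 0" using word_length_le[of "[]" T \<one>] by simp
    then have "\<one> \<in> word_ball G T r" using r by (simp add: word_ball_eq)
    then have "card (word_ball G T r) \<ge> 1"
      using finite_word_ball[OF T, of r] by (simp add: Suc_le_eq card_gt_0_iff) blast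
    moreover have "?c * r\<^sup>2 \<le> 1"
    proof -
      have "min c 1 * r\<^sup>2 \<le> 1 * (real K)\<^sup>2"
        using False r by (intro mult_mono power_mono) auto
      then show ?thesis using K(1) by (simp add: divide_simps)
    qed
    ultimately show ?thesis by linarith
  qed
  moreover have "?c > 0" using c(1) K(1) by simp
  ultimately show "\<exists>c>0. \<forall>r\<ge>1. real (card (word_ball G T r)) \<ge> c * r\<^sup>2" by blast
qed (use T in \<open>auto simp: at_least_quadratic_growth_def\<close>)

lemma Lp_compression_bound_mono:
  assumes S: "sym_gen_set G S" and T: "sym_gen_set G T" and "\<alpha> \<ge> 0"
    and "Lp_compression_bound p G S \<alpha>"
  shows "Lp_compression_bound p G T \<alpha>"
proof -
  obtain f L c where f: "f \<in> carrier G \<rightarrow> Lp_space p"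
    and L: "\<And>x y. x \<in> carrier G \<Longrightarrow> y \<in> carrier G \<Longrightarrow>
              Lp_dist p (f x) (f y) \<le> L * real (word_dist G S x y)"
    and c: "c > 0" "\<And>x y. x \<in> carrier G \<Longrightarrow> y \<in> carrier G \<Longrightarrow>
              Lp_dist p (f x) (f y) \<ge> c * real (word_dist G S x y) powr \<alpha>"
    using assms(4) unfolding Lp_compression_bound_def by blast
  obtain K :: nat where K: "K \<ge> 1"
    "\<And>x. x \<in> carrier G \<Longrightarrow> word_length G S x \<le> K * word_length G T x"
    using word_length_comparison[OF S T] by blast
  obtain M :: nat where M: "M \<ge> 1"
    "\<And>x. x \<in> carrier G \<Longrightarrow> word_length G T x \<le> M * word_length G S x"
    using word_length_comparison[OF T S] by blast
  have "Lp_dist p (f x) (f y) \<le> (\<bar>L\<bar> * K) * real (word_dist G T x y)"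
    if "x \<in> carrier G" "y \<in> carrier G" for x y
  proof -
    have "L * real (word_dist G S x y) \<le> \<bar>L\<bar> * real (word_dist G S x y)"
      by (intro mult_right_mono) auto
    also have "\<dots> \<le> \<bar>L\<bar> * real (K * word_dist G T x y)"
      using K(2)[of "inv x \<otimes> y"] that unfolding word_dist_def
      by (intro mult_left_mono) (simp_all only: of_nat_le_iff abs_ge_zero m_closed inv_closed)
    finally show ?thesis using L[OF that] by (simp add: mult.assoc)
  qed
  moreover have "(c / M powr \<alpha>) * real (word_dist G T x y) powr \<alpha> \<le> Lp_dist p (f x) (f y)"
    if "x \<in> carrier G" "y \<in> carrier G" for x y
  proof -
    have "real (word_dist G T x y) powr \<alpha> \<le> real (M * word_dist G S x y) powr \<alpha>"
      using M(2)[of "inv x \<otimes> y"] that \<open>\<alpha> \<ge> 0\<close> unfolding word_dist_def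
      by (intro powr_mono2) (simp_all only: of_nat_le_iff of_nat_0_le_iff m_closed inv_closed)
    also have "\<dots> = M powr \<alpha> * real (word_dist G S x y) powr \<alpha>"
      by (simp add: powr_mult)
    finally have "c * real (word_dist G T x y) powr \<alpha>
        \<le> c * (M powr \<alpha> * real (word_dist G S x y) powr \<alpha>)"
      using c(1) by (intro mult_left_mono) auto
    then have "(c / M powr \<alpha>) * real (word_dist G T x y) powr \<alpha>
        \<le> c * real (word_dist G S x y) powr \<alpha>"
      using M(1) by (simp add: divide_simps mult_ac)
    then show ?thesis using c(2)[OF that] by linarith
  qed
  moreover have "c / M powr \<alpha> > 0" using c(1) M(1) by simp
  ultimately show ?thesis using f unfolding Lp_compression_bound_def by blast
qed

lemma Lp_compression_eq:
  assumes "sym_gen_set G S"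
  shows "Lp_compression p G = Sup {ereal \<alpha> | \<alpha>. 0 \<le> \<alpha> \<and> Lp_compression_bound p G S \<alpha>}"
proof -
  have "{ereal \<alpha> | \<alpha> S. sym_gen_set G S \<and> 0 \<le> \<alpha> \<and> Lp_compression_bound p G S \<alpha>}
      = {ereal \<alpha> | \<alpha>. 0 \<le> \<alpha> \<and> Lp_compression_bound p G S \<alpha>}"
    using assms Lp_compression_bound_mono by blast
  then show ?thesis by (simp add: Lp_compression_def)
qed

end

end

theory Submission
  imports Defs "HOL-Real_Asymp.Real_Asymp"
begin

text \<open>
  Up to constant factors, the distance of \<open>(f, x)\<close> and \<open>(g, y)\<close> in the wreath product is the
  length of a shortest walk in \<open>H\<close> from \<open>x\<close> to \<open>y\<close> through all points \<open>z\<close> with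
  \<open>f z \<noteq> g z\<close>, plus the sum of the distances of \<open>f z\<close> and \<open>g z\<close> in \<open>G\<close>. Both halves
  of the theorem rest on this description.

  For the lower bound, \<open>(f, x)\<close> is mapped to the \<open>\<ell>\<^sub>p\<close>-sum of two families of coordinates. The
  first consists of the images of the lamp values \<open>f z\<close> under a good map of \<open>G\<close>; it recovers the
  sum over the lamps, because powers with exponent at most one are subadditive. The second family
  records the tour. For every scale \<open>2 ^ k\<close> and every window, a ball of that scale, it contains
  the pattern of the lamps in the window, multiplied by a cutoff that vanishes while the walker is
  in the window and is constant once the walker is away from it. A change of the lamp under the
  walker is then invisible, and a step of the walker affects only the windows near it, so the
  map is Lipschitz (\<open>wreath_embedding\<close>). Points where the lamps differ, which are separated
  at scale \<open>2 ^ k\<close> and far from the walker, are seen by disjoint sets of windows. They contribute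
  \<open>2 powr (\<theta> * k)\<close> each, for any fixed \<open>\<theta> < 1\<close>. Conversely, joining maximal separated sets
  of consecutive scales yields a tour whose length is bounded by exactly these contributions
  (\<open>multiscale_closed_tour\<close>, \<open>sum_scales_le\<close>). Taking roots of order \<open>p\<close> of the cutoffs turns
  this estimate for \<open>p = 1\<close> into compression arbitrarily close to \<open>1 / p\<close>. The growth of \<open>H\<close>
  enters here only through \<open>polynomial_growth_radii\<close>: at every scale there is a ball that is not
  much smaller than its neighbourhood of almost the same scale.

  For the upper bound, the power \<open>p\<close> of the \<open>L\<^sub>p\<close> distance is of negative type for \<open>p \<le> 2\<close>
  (\<open>Lp_negative_type\<close>). Consequently the energy of a symmetric Markov kernel at most doubles
  when the kernel is squared (\<open>energy_square_le\<close>), and after \<open>2 ^ k\<close> steps of a walk the expected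
  \<open>p\<close>-th power of the distance of the images is at most \<open>2 ^ k\<close> times that of one step.
  This is applied to a lamplighter that randomizes the lamps at the ends of its steps. Its steps are
  uniform on the ball of radius \<open>2 ^ j\<close> with probability proportional to \<open>4 ^ (- j)\<close>. They have
  \<open>p\<close>-th moment \<open>O(k)\<close>. If \<open>H\<close> has at least quadratic growth, the return probabilities decay like
  \<open>1 / m\<close> (\<open>walk_distribution_decay\<close>). So the walk meets about \<open>2 ^ k / k\<close> different points
  or more and changes half of the lamps there, and an exponent \<open>\<alpha>\<close> must satisfy
  \<open>(2 ^ k / k) powr (\<alpha> * p) = O(k * 2 ^ k)\<close>, that is \<open>\<alpha> \<le> 1 / p\<close>. The walk is run in a
  finite box, of which a fixed fraction of the starting points is far from the boundary.
\<close>


section \<open>Maps into \<open>L\<^sub>p\<close> assembled from coordinates\<close>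

text \<open>
  Convexity of the power \<open>p\<close>. It bounds a difference along a path by its steps, in the role of
  the triangle inequality of \<open>L\<^sub>p\<close>.
\<close>

lemma powr_sum_le_card_powr_sum:
  fixes a :: "'i \<Rightarrow> real"
  assumes p: "1 \<le> p" and A: "finite A"
  shows "\<bar>\<Sum>i\<in>A. a i\<bar> powr p \<le> real (card A) powr (p - 1) * (\<Sum>i\<in>A. \<bar>a i\<bar> powr p)"
proof -
  \<comment> \<open>Convexity is applied on the open half-line, so zero summands are dropped.\<close>
  define P where "P = {i\<in>A. a i \<noteq> 0}"
  have fP: "finite P" using A by (simp add: P_def)
  have eq: "(\<Sum>i\<in>A. \<bar>a i\<bar>) = (\<Sum>i\<in>P. \<bar>a i\<bar>)" "(\<Sum>i\<in>A. \<bar>a i\<bar> powr p) = (\<Sum>i\<in>P. \<bar>a i\<bar> powr p)"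
    by (rule sum.mono_neutral_right; use A in \<open>auto simp: P_def\<close>)+
  show ?thesis
  proof (cases "P = {}")
    case True
    then have "(\<Sum>i\<in>A. a i) = 0" unfolding P_def by (intro sum.neutral) auto
    then show ?thesis using p by (simp add: sum_nonneg)
  next
    case False
    let ?m = "real (card P)"
    have m: "?m > 0" using False fP by (simp add: card_gt_0_iff)
    have "(\<Sum>i\<in>P. (1/?m) *\<^sub>R \<bar>a i\<bar>) powr p \<le> (\<Sum>i\<in>P. (1/?m) * \<bar>a i\<bar> powr p)"
      using m by (intro convex_on_sum[OF fP False powr_convex[OF p]]) (auto simp: P_def)
    then have "((\<Sum>i\<in>P. \<bar>a i\<bar>) / ?m) powr p \<le> (\<Sum>i\<in>P. \<bar>a i\<bar> powr p) / ?m"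
      by (simp add: sum_divide_distrib)
    then have "(\<Sum>i\<in>P. \<bar>a i\<bar>) powr p / ?m powr p \<le> (\<Sum>i\<in>P. \<bar>a i\<bar> powr p) / ?m"
      using m by (simp add: powr_divide sum_nonneg)
    then have "(\<Sum>i\<in>P. \<bar>a i\<bar>) powr p \<le> ?m powr p * ((\<Sum>i\<in>P. \<bar>a i\<bar> powr p) / ?m)"
      using m by (simp add: divide_simps mult_ac)
    also have "\<dots> = ?m powr (p - 1) * (\<Sum>i\<in>P. \<bar>a i\<bar> powr p)"
      using m by (simp add: powr_diff)
    also have "\<dots> \<le> real (card A) powr (p - 1) * (\<Sum>i\<in>P. \<bar>a i\<bar> powr p)"
      using p A by (intro mult_right_mono powr_mono2 sum_nonneg) (auto simp: P_def card_mono)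
    finally have 1: "(\<Sum>i\<in>P. \<bar>a i\<bar>) powr p \<le> real (card A) powr (p - 1) * (\<Sum>i\<in>P. \<bar>a i\<bar> powr p)" .
    have "\<bar>\<Sum>i\<in>A. a i\<bar> powr p \<le> (\<Sum>i\<in>A. \<bar>a i\<bar>) powr p"
      using p by (intro powr_mono2) auto
    then show ?thesis using 1 by (simp add: eq)
  qed
qed

lemma Lp_dist_powr:
  assumes "p > 0"
  shows "Lp_dist p g h powr p = (\<integral>t. \<bar>g t - h t\<bar> powr p \<partial>lebesgue_on {0..1})"
  using assms by (simp add: Lp_dist_def Lp_norm_def powr_powr)

lemma Lp_dist_nonneg [simp]: "0 \<le> Lp_dist p g h"
  by (simp add: Lp_dist_def Lp_norm_def)

lemma Lp_dist_self [simp]: "Lp_dist p g g = 0"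
  by (simp add: Lp_dist_def Lp_norm_def)

lemma Lp_dist_commute: "Lp_dist p g h = Lp_dist p h g"
  by (simp add: Lp_dist_def Lp_norm_def abs_minus_commute)

lemma Lp_dist_const:
  assumes "p > 0"
  shows "Lp_dist p (\<lambda>_. a) (\<lambda>_. b) = \<bar>a - b\<bar>"
proof -
  have "emeasure (lebesgue_on {0..1::real}) {0..1} = 1" by (subst emeasure_restrict_space) auto
  then have "measure (lebesgue_on {0..1::real}) {0..1} = 1" by (simp add: measure_def)
  then show ?thesis using assms by (simp add: Lp_dist_def Lp_norm_def powr_powr)
qed

lemma const_in_Lp_space [simp]: "(\<lambda>_. a) \<in> Lp_space p"
  by (simp add: Lp_space_def)

lemma Lp_space_measurable: "h \<in> Lp_space p \<Longrightarrow> h \<in> borel_measurable (lebesgue_on {0..1})"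
  by (simp add: Lp_space_def)

lemma Lp_space_diff_integrable:
  assumes p: "1 \<le> p" and g: "g \<in> Lp_space p" and h: "h \<in> Lp_space p"
  shows "integrable (lebesgue_on {0..1}) (\<lambda>t. \<bar>g t - h t\<bar> powr p)"
proof (rule Bochner_Integration.integrable_bound)
  show "integrable (lebesgue_on {0..1}) (\<lambda>t. 2 powr (p - 1) * (\<bar>g t\<bar> powr p + \<bar>h t\<bar> powr p))"
    using g h by (auto simp: Lp_space_def)
  show "(\<lambda>t. \<bar>g t - h t\<bar> powr p) \<in> borel_measurable (lebesgue_on {0..1})"
    using g h by (intro measurable_abs_powr borel_measurable_diff)
      (auto simp: Lp_space_def)
  have "\<bar>g t - h t\<bar> powr p \<le> 2 powr (p - 1) * (\<bar>g t\<bar> powr p + \<bar>h t\<bar> powr p)" for t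
    using powr_sum_le_card_powr_sum[OF p, of "{0,1::nat}" "\<lambda>i. if i = 0 then g t else - h t"] by simp
  then show "AE t in lebesgue_on {0..1}. norm (\<bar>g t - h t\<bar> powr p)
      \<le> norm (2 powr (p - 1) * (\<bar>g t\<bar> powr p + \<bar>h t\<bar> powr p))"
    by (intro AE_I2) (simp add: order_trans[OF _ abs_ge_self])
qed

lemma Lp_space_diff:
  assumes "1 \<le> p" "g \<in> Lp_space p" "h \<in> Lp_space p"
  shows "(\<lambda>t. g t - h t) \<in> Lp_space p"
  using Lp_space_diff_integrable[OF assms] assms(2,3) by (auto simp: Lp_space_def)

text \<open>
  For a path whose \<open>n\<close> steps all have size at most \<open>L\<close> the right-hand side is
  \<open>n powr p * L powr p\<close>. The inequality is linear in the \<open>p\<close>-th powers of the distances, so it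
  can be summed over coordinates.
\<close>

lemma Lp_dist_powr_chain:
  fixes n :: nat
  assumes p: "1 \<le> p" and g: "\<And>l. l \<le> n \<Longrightarrow> g l \<in> Lp_space p"
  shows "Lp_dist p (g 0) (g n) powr p
           \<le> real n powr (p - 1) * (\<Sum>l<n. Lp_dist p (g l) (g (Suc l)) powr p)"
proof -
  let ?M = "lebesgue_on {0..1::real}"
  have int: "integrable ?M (\<lambda>t. \<bar>g l t - g (Suc l) t\<bar> powr p)" if "l < n" for l
    using that by (intro Lp_space_diff_integrable p g) auto
  have "(\<integral>t. \<bar>g 0 t - g n t\<bar> powr p \<partial>?M)
      \<le> (\<integral>t. real n powr (p - 1) * (\<Sum>l<n. \<bar>g l t - g (Suc l) t\<bar> powr p) \<partial>?M)"
  proof (rule integral_mono)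
    show "integrable ?M (\<lambda>t. \<bar>g 0 t - g n t\<bar> powr p)"
      by (intro Lp_space_diff_integrable p g) auto
    show "integrable ?M (\<lambda>t. real n powr (p - 1) * (\<Sum>l<n. \<bar>g l t - g (Suc l) t\<bar> powr p))"
      using int by (intro integrable_mult_right Bochner_Integration.integrable_sum) auto
    fix t
    have "(\<Sum>l<n. g l t - g (Suc l) t) = g 0 t - g n t"
      by (induction n) auto
    then show "\<bar>g 0 t - g n t\<bar> powr p \<le> real n powr (p - 1) * (\<Sum>l<n. \<bar>g l t - g (Suc l) t\<bar> powr p)"
      using powr_sum_le_card_powr_sum[OF p, of "{..<n}" "\<lambda>l. g l t - g (Suc l) t"] by simp
  qed
  also have "\<dots> = real n powr (p - 1) * (\<Sum>l<n. (\<integral>t. \<bar>g l t - g (Suc l) t\<bar> powr p \<partial>?M))"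
    using int by (simp add: Bochner_Integration.integral_sum)
  finally show ?thesis using p by (simp add: Lp_dist_powr)
qed

text \<open>
  The interval \<open>(1 / 2 ^ (n + 1), 1 / 2 ^ n]\<close>, written so that the affine map onto \<open>(0, 1]\<close> is
  visible. These intervals carry disjoint copies of \<open>L\<^sub>p([0,1])\<close> inside \<open>L\<^sub>p([0,1])\<close>.
\<close>

definition dyadic_block :: "nat \<Rightarrow> real set" where
  "dyadic_block n = {t. 0 < 2 ^ Suc n * t - 1 \<and> 2 ^ Suc n * t - 1 \<le> 1}"

lemma dyadic_block_pos:
  assumes "t \<in> dyadic_block n" shows "0 < t"
proof -
  have "0 < 2 ^ Suc n * t" using assms unfolding dyadic_block_def by (simp only: mem_Collect_eq) linarith
  then show ?thesis by (simp only: zero_less_mult_iff) (simp add: not_less)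
qed

lemma dyadic_block_disjoint:
  assumes "t \<in> dyadic_block m" "t \<in> dyadic_block n"
  shows "m = n"
proof -
  have *: False if "t \<in> dyadic_block m" "t \<in> dyadic_block n" "m < n" for m n
  proof -
    have "t > 0" using that(1) by (rule dyadic_block_pos)
    have "2 ^ Suc m * t \<le> 2 ^ n * t" using that(3) \<open>t > 0\<close> 
      by (intro mult_right_mono power_increasing) auto
    then show False using that(1,2) by (auto simp: dyadic_block_def)
  qed
  show ?thesis using *[OF assms] *[OF assms(2,1)] by (metis nat_neq_iff)
qed

lemma dyadic_block_measurable [measurable]: "dyadic_block n \<in> sets lebesgue"
proof -
  have "dyadic_block n \<in> sets borel" unfolding dyadic_block_def by measurable
  then show ?thesis by simp
qed

lemma dyadic_block_subset: "dyadic_block n \<subseteq> {0..1}"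
proof
  fix t assume t: "t \<in> dyadic_block n"
  have a: "0 < t" using t by (rule dyadic_block_pos)
  have "2 * t \<le> 2 ^ Suc n * t" using a by simp
  moreover have "2 ^ Suc n * t \<le> 2"
    using t unfolding dyadic_block_def by (simp only: mem_Collect_eq) linarith
  ultimately show "t \<in> {0..1}" using a unfolding atLeastAtMost_iff by linarith
qed

text \<open>
  The \<open>\<ell>\<^sub>p\<close>-sum of a sequence of functions: the function of index \<open>n\<close> is squeezed into the block
  of index \<open>n\<close> and rescaled so that its \<open>L\<^sub>p\<close> norm is preserved.
\<close>

definition Lp_glue :: "real \<Rightarrow> (nat \<Rightarrow> real \<Rightarrow> real) \<Rightarrow> real \<Rightarrow> real" where
  "Lp_glue p h t = suminf (\<lambda>n. if t \<in> dyadic_block n then 2 powr (real (Suc n) / p) * h n (2 ^ Suc n * t - 1) else 0)"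

lemma Lp_glue_eq:
  assumes "t \<in> dyadic_block n"
  shows "Lp_glue p h t = 2 powr (real (Suc n) / p) * h n (2 ^ Suc n * t - 1)"
proof -
  have "Lp_glue p h t = (\<Sum>m\<in>{n}. if t \<in> dyadic_block m then 2 powr (real (Suc m) / p) * h m (2 ^ Suc m * t - 1) else 0)"
    unfolding Lp_glue_def using dyadic_block_disjoint[OF assms] by (intro suminf_finite) auto
  then show ?thesis using assms by simp
qed

lemma Lp_glue_eq_0:
  assumes "\<And>n. t \<notin> dyadic_block n"
  shows "Lp_glue p h t = 0"
  using assms by (simp add: Lp_glue_def)

lemma Lp_glue_diff: "Lp_glue p g t - Lp_glue p h t = Lp_glue p (\<lambda>n t. g n t - h n t) t"
  by (cases "\<exists>n. t \<in> dyadic_block n") (auto simp: Lp_glue_eq Lp_glue_eq_0 algebra_simps)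

text \<open>
  Change of variables on one block; the half-open block and \<open>[0,1]\<close> differ by a null set.
\<close>

lemma nn_integral_dyadic_block:
  assumes h: "h \<in> borel_measurable (lebesgue_on {0..1})"
  shows "(\<integral>\<^sup>+t. (if t \<in> dyadic_block n then ennreal (2 ^ Suc n * \<bar>h (2 ^ Suc n * t - 1)\<bar> powr p) else 0) \<partial>lebesgue)
     = (\<integral>\<^sup>+t. ennreal (\<bar>h t\<bar> powr p) \<partial>lebesgue_on {0..1})"
    and "(\<lambda>t. if t \<in> dyadic_block n then h (2 ^ Suc n * t - 1) else 0) \<in> borel_measurable lebesgue"
proof -
  define H where "H = (\<lambda>t. if t \<in> {0..1} then h t else 0)"
  have H [measurable]: "H \<in> borel_measurable lebesgue"
    using borel_measurable_if_I[OF h] by (simp add: H_def)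
  define c where "c = (2::real) ^ Suc n"
  have c: "c > 0" by (simp add: c_def)
  define N where "N = (\<lambda>u::real. if u \<in> {0<..1} then ennreal (c * \<bar>H u\<bar> powr p) else 0)"
  have [measurable]: "{0<..1::real} \<in> sets lebesgue" by simp
  have N: "N \<in> borel_measurable lebesgue" unfolding N_def by measurable
  have aff: "(\<lambda>t::real. -1 + c * t) \<in> lebesgue \<rightarrow>\<^sub>M lebesgue"
    using lebesgue_affine_measurable[of "\<lambda>_. c" "-1::real"] c by simp
  have N2: "(\<lambda>t. N (-1 + c * t)) \<in> borel_measurable lebesgue"
    using measurable_compose[OF aff N] .
  have "(\<lambda>t. if t \<in> dyadic_block n then H (-1 + c * t) else 0) \<in> borel_measurable lebesgue"
    using measurable_compose[OF aff H] by measurable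
  moreover have "(\<lambda>t. if t \<in> dyadic_block n then h (2 ^ Suc n * t - 1) else 0)
      = (\<lambda>t. if t \<in> dyadic_block n then H (-1 + c * t) else 0)"
    by (auto simp: H_def c_def dyadic_block_def fun_eq_iff)
  ultimately show "(\<lambda>t. if t \<in> dyadic_block n then h (2 ^ Suc n * t - 1) else 0) \<in> borel_measurable lebesgue"
    by simp
  have "(\<integral>\<^sup>+t. (if t \<in> dyadic_block n then ennreal (2 ^ Suc n * \<bar>h (2 ^ Suc n * t - 1)\<bar> powr p) else 0) \<partial>lebesgue)
     = (\<integral>\<^sup>+t. N (-1 + c * t) \<partial>lebesgue)"
    by (intro nn_integral_cong) (auto simp: N_def H_def c_def dyadic_block_def)
  also have "\<dots> = ennreal \<bar>1/c\<bar> * (\<integral>\<^sup>+u. N (-1 + c * (1/c + 1/c * u)) \<partial>lebesgue)"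
    using nn_integral_real_affine_lebesgue[OF N2, of "1/c" "1/c"] c by simp
  also have "\<dots> = (\<integral>\<^sup>+u. ennreal \<bar>1/c\<bar> * N u \<partial>lebesgue)"
    using c N by (subst nn_integral_cmult) (auto simp: algebra_simps)
  also have "\<dots> = (\<integral>\<^sup>+u. ennreal (\<bar>h u\<bar> powr p) * indicator {0..1} u \<partial>lebesgue)"
  proof (rule nn_integral_cong_AE)
    have "AE u::real in lebesgue. u \<noteq> 0"
      by (rule AE_I[where N="{0}"]) auto
    then show "AE u in lebesgue. ennreal \<bar>1/c\<bar> * N u = ennreal (\<bar>h u\<bar> powr p) * indicator {0..1} u"
      by eventually_elim (use c in \<open>auto simp: N_def H_def indicator_def ennreal_mult[symmetric]\<close>)
  qed
  also have "\<dots> = (\<integral>\<^sup>+t. ennreal (\<bar>h t\<bar> powr p) \<partial>lebesgue_on {0..1})"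
    by (subst nn_integral_restrict_space) auto
  finally show "(\<integral>\<^sup>+t. (if t \<in> dyadic_block n then ennreal (2 ^ Suc n * \<bar>h (2 ^ Suc n * t - 1)\<bar> powr p) else 0) \<partial>lebesgue)
     = (\<integral>\<^sup>+t. ennreal (\<bar>h t\<bar> powr p) \<partial>lebesgue_on {0..1})" .
qed


text \<open>
  Only one block is active at each point, so the \<open>p\<close>-th power of the sum is the sum of the
  \<open>p\<close>-th powers, and monotone convergence integrates it block by block.
\<close>

lemma Lp_glue:
  assumes p: "0 < p" and h: "\<And>n. h n \<in> Lp_space p"
    and summ: "summable (\<lambda>n. \<integral>t. \<bar>h n t\<bar> powr p \<partial>lebesgue_on {0..1})"
  shows "Lp_glue p h \<in> Lp_space p"
    and "(\<integral>t. \<bar>Lp_glue p h t\<bar> powr p \<partial>lebesgue_on {0..1})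
           = (suminf (\<lambda>n. \<integral>t. \<bar>h n t\<bar> powr p \<partial>lebesgue_on {0..1}))"
proof -
  let ?M = "lebesgue_on {0..1::real}"
  have hm: "h n \<in> borel_measurable ?M" for n using h by (rule Lp_space_measurable)
  let ?g = "\<lambda>n t. if t \<in> dyadic_block n then h n (2 ^ Suc n * t - 1) else 0"
  have gm: "?g n \<in> borel_measurable lebesgue" for n by (rule nn_integral_dyadic_block(2)[OF hm])
  have "(\<lambda>t. suminf (\<lambda>n. 2 powr (real (Suc n) / p) * ?g n t)) \<in> borel_measurable lebesgue"
    using gm by (intro borel_measurable_suminf borel_measurable_times) auto
  moreover have "Lp_glue p h = (\<lambda>t. suminf (\<lambda>n. 2 powr (real (Suc n) / p) * ?g n t))"
    unfolding Lp_glue_def by (intro ext arg_cong[where f=suminf]) auto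
  ultimately have meas0: "Lp_glue p h \<in> borel_measurable lebesgue" by (simp only:)
  then have meas: "Lp_glue p h \<in> borel_measurable ?M"
    by (rule measurable_restrict_space1)
  let ?G = "\<lambda>n t. if t \<in> dyadic_block n then ennreal (2 ^ Suc n * \<bar>h n (2 ^ Suc n * t - 1)\<bar> powr p) else 0"
  have Gm: "?G n \<in> borel_measurable lebesgue" for n
  proof -
    have "(\<lambda>t. ennreal (2 ^ Suc n * \<bar>?g n t\<bar> powr p)) \<in> borel_measurable lebesgue"
      using gm by (intro measurable_compose[OF _ measurable_ennreal]
          borel_measurable_times measurable_abs_powr borel_measurable_const) assumption
    moreover have "?G n = (\<lambda>t. ennreal (2 ^ Suc n * \<bar>?g n t\<bar> powr p))"
      using p by (auto simp: fun_eq_iff)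
    ultimately show ?thesis by (simp only:)
  qed
  have ptw: "ennreal (\<bar>Lp_glue p h t\<bar> powr p) * indicator {0..1} t = (suminf (\<lambda>n. ?G n t))" for t
  proof (cases "\<exists>n. t \<in> dyadic_block n")
    case True
    then obtain n where n: "t \<in> dyadic_block n" by blast
    have "(suminf (\<lambda>n. ?G n t)) = (\<Sum>n\<in>{n}. ?G n t)"
      using dyadic_block_disjoint[OF n] by (intro suminf_finite) auto
    moreover have "(2 powr (real (Suc n) / p)) powr p = 2 ^ Suc n"
      using p by (simp add: powr_powr powr_realpow del: of_nat_Suc power_Suc)
    ultimately show ?thesis using n dyadic_block_subset[of n] p
      by (auto simp: Lp_glue_eq[OF n] abs_mult powr_mult simp del: of_nat_Suc power_Suc)
  next
    case False
    then show ?thesis using p by (simp add: Lp_glue_eq_0)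
  qed
  have nn: "(\<integral>\<^sup>+t. ennreal (\<bar>Lp_glue p h t\<bar> powr p) \<partial>?M)
      = ennreal (suminf (\<lambda>n. \<integral>t. \<bar>h n t\<bar> powr p \<partial>?M))"
  proof -
    have "(\<integral>\<^sup>+t. ennreal (\<bar>Lp_glue p h t\<bar> powr p) \<partial>?M)
        = (\<integral>\<^sup>+t. ennreal (\<bar>Lp_glue p h t\<bar> powr p) * indicator {0..1} t \<partial>lebesgue)"
      by (subst nn_integral_restrict_space) auto
    also have "\<dots> = (\<integral>\<^sup>+t. (suminf (\<lambda>n. ?G n t)) \<partial>lebesgue)" by (simp only: ptw)
    also have "\<dots> = (suminf (\<lambda>n. \<integral>\<^sup>+t. ?G n t \<partial>lebesgue))"
      using Gm by (intro nn_integral_suminf) auto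
    also have "\<dots> = (suminf (\<lambda>n. \<integral>\<^sup>+t. ennreal (\<bar>h n t\<bar> powr p) \<partial>?M))"
      by (simp only: nn_integral_dyadic_block(1)[OF hm])
    also have "\<dots> = (suminf (\<lambda>n. ennreal (\<integral>t. \<bar>h n t\<bar> powr p \<partial>?M)))"
      using h by (intro arg_cong[where f=suminf] ext nn_integral_eq_integral) (auto simp: Lp_space_def)
    also have "\<dots> = ennreal (suminf (\<lambda>n. \<integral>t. \<bar>h n t\<bar> powr p \<partial>?M))"
      using summ by (intro suminf_ennreal2) auto
    finally show ?thesis .
  qed
  have pm: "(\<lambda>t. \<bar>Lp_glue p h t\<bar> powr p) \<in> borel_measurable ?M"
    using meas by (intro measurable_abs_powr) auto
  show "Lp_glue p h \<in> Lp_space p"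
    using meas pm nn by (auto simp: Lp_space_def intro!: integrableI_nonneg)
  show "(\<integral>t. \<bar>Lp_glue p h t\<bar> powr p \<partial>?M) = (suminf (\<lambda>n. \<integral>t. \<bar>h n t\<bar> powr p \<partial>?M))"
    using pm nn summ by (subst integral_eq_nn_integral) (auto intro!: enn2real_ennreal suminf_nonneg)
qed

text \<open>
  The maps are recentred at \<open>x0\<close> before gluing: the coordinates themselves need not be
  \<open>p\<close>-summable, only their differences.
\<close>

lemma Lp_maps_glue:
  fixes F :: "nat \<Rightarrow> 'x \<Rightarrow> real \<Rightarrow> real"
  assumes p: "1 \<le> p" and F: "\<And>n x. x \<in> A \<Longrightarrow> F n x \<in> Lp_space p" and x0: "x0 \<in> A"
    and summ: "\<And>x y. x \<in> A \<Longrightarrow> y \<in> A \<Longrightarrow> summable (\<lambda>n. Lp_dist p (F n x) (F n y) powr p)"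
  obtains f where "\<And>x. x \<in> A \<Longrightarrow> f x \<in> Lp_space p"
    "\<And>x y. x \<in> A \<Longrightarrow> y \<in> A \<Longrightarrow>
       Lp_dist p (f x) (f y) powr p = (suminf (\<lambda>n. Lp_dist p (F n x) (F n y) powr p))"
proof -
  have p0: "p > 0" using p by simp
  define f where "f x = Lp_glue p (\<lambda>n t. F n x t - F n x0 t)" for x
  show ?thesis
  proof (rule that)
    fix x assume x: "x \<in> A"
    show "f x \<in> Lp_space p"
      unfolding f_def using summ[OF x x0] p p0 F x x0
      by (intro Lp_glue(1) Lp_space_diff) (auto simp: Lp_dist_powr)
    fix y assume y: "y \<in> A"
    have eq: "(\<lambda>n t. F n x t - F n x0 t - (F n y t - F n x0 t)) = (\<lambda>n t. F n x t - F n y t)"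
      by auto
    have "Lp_dist p (f x) (f y) powr p
        = (\<integral>t. \<bar>Lp_glue p (\<lambda>n t. F n x t - F n y t) t\<bar> powr p \<partial>lebesgue_on {0..1})"
      by (simp add: Lp_dist_powr[OF p0] f_def Lp_glue_diff eq)
    also have "\<dots> = (suminf (\<lambda>n. Lp_dist p (F n x) (F n y) powr p))"
      using summ[OF x y] p p0 F x y by (subst Lp_glue(2)) (auto simp: Lp_dist_powr intro!: Lp_space_diff)
    finally show "Lp_dist p (f x) (f y) powr p = (suminf (\<lambda>n. Lp_dist p (F n x) (F n y) powr p))" .
  qed
qed

context group
begin

text \<open>
  It is enough to control a family of coordinates along single generators: a geodesic word and
  convexity then bound all finite partial sums, which gives both the convergence needed for
  gluing and the Lipschitz property. Every finite subfamily remains visible in the lower bound.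
\<close>

lemma Lp_map_from_coordinates:
  fixes F :: "'i \<Rightarrow> 'a \<Rightarrow> real \<Rightarrow> real"
  assumes p: "1 \<le> p" and S: "sym_gen_set G S" and I: "countable I"
    and F: "\<And>i x. i \<in> I \<Longrightarrow> x \<in> carrier G \<Longrightarrow> F i x \<in> Lp_space p"
    and L: "\<And>J x s. finite J \<Longrightarrow> J \<subseteq> I \<Longrightarrow> x \<in> carrier G \<Longrightarrow> s \<in> S \<Longrightarrow>
              (\<Sum>i\<in>J. Lp_dist p (F i x) (F i (x \<otimes>\<^bsub>G\<^esub> s)) powr p) \<le> L"
  obtains f where "f \<in> carrier G \<rightarrow> Lp_space p"
    "\<And>x y. x \<in> carrier G \<Longrightarrow> y \<in> carrier G \<Longrightarrow>
       Lp_dist p (f x) (f y) \<le> L powr (1 / p) * real (word_dist G S x y)"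
    "\<And>x y J. x \<in> carrier G \<Longrightarrow> y \<in> carrier G \<Longrightarrow> finite J \<Longrightarrow> J \<subseteq> I \<Longrightarrow>
       (\<Sum>i\<in>J. Lp_dist p (F i x) (F i y) powr p) \<le> Lp_dist p (f x) (f y) powr p"
proof -
  have p0: "p > 0" using p by simp
  have SG: "S \<subseteq> carrier G" using S by (simp add: sym_gen_set_def)
  have bound: "(\<Sum>i\<in>J. Lp_dist p (F i x) (F i y) powr p) \<le> L * real (word_dist G S x y) powr p"
    if J: "finite J" "J \<subseteq> I" and x: "x \<in> carrier G" and y: "y \<in> carrier G" for J x y
  proof -
    define n where "n = word_dist G S x y"
    obtain ws where ws: "set ws \<subseteq> S" "length ws = n" "word_prod G ws = inv x \<otimes> y"
      using word_length_witness[OF S, of "inv x \<otimes> y"] x y by (auto simp: n_def word_dist_def)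
    define u where "u l = x \<otimes> word_prod G (take l ws)" for l
    have wsG: "set (take l ws) \<subseteq> carrier G" for l using ws(1) SG set_take_subset[of l ws] by blast
    have u: "u l \<in> carrier G" for l using x wsG by (simp add: u_def)
    have u0: "u 0 = x" using x by (simp add: u_def)
    have un: "u n = y" using x y ws by (simp add: u_def flip: m_assoc)
    have step: "u (Suc l) = u l \<otimes> ws ! l" "ws ! l \<in> S" if "l < n" for l
    proof -
      show 1: "ws ! l \<in> S" using that ws by auto
      then show "u (Suc l) = u l \<otimes> ws ! l"
        using that ws x wsG[of l] SG
        by (auto simp: u_def take_Suc_conv_app_nth word_prod_append m_assoc subset_iff)
    qed
    have "(\<Sum>i\<in>J. Lp_dist p (F i x) (F i y) powr p)
        \<le> (\<Sum>i\<in>J. real n powr (p - 1) * (\<Sum>l<n. Lp_dist p (F i (u l)) (F i (u (Suc l))) powr p))"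
    proof (rule sum_mono)
      fix i assume "i \<in> J"
      then show "Lp_dist p (F i x) (F i y) powr p
          \<le> real n powr (p - 1) * (\<Sum>l<n. Lp_dist p (F i (u l)) (F i (u (Suc l))) powr p)"
        using Lp_dist_powr_chain[OF p, of n "\<lambda>l. F i (u l)"] F u J by (auto simp: u0 un)
    qed
    also have "\<dots> = real n powr (p - 1) * (\<Sum>l<n. \<Sum>i\<in>J. Lp_dist p (F i (u l)) (F i (u (Suc l))) powr p)"
      by (simp add: sum_distrib_left[symmetric] sum.swap[of _ _ J])
    also have "\<dots> \<le> real n powr (p - 1) * (\<Sum>l<n. L)"
      using L[OF J u] by (intro mult_left_mono sum_mono) (auto simp: step)
    also have "\<dots> = L * real n powr p"
      by (cases "n = 0") (auto simp: powr_diff)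
    finally show ?thesis by (simp add: n_def)
  qed
  \<comment> \<open>The coordinates are renumbered by natural numbers, with the zero function at unused
    indices.\<close>
  define E where "E n x = (if n \<in> to_nat_on I ` I then F (inv_into I (to_nat_on I) n) x else (\<lambda>_. 0))" for n x
  have inj: "inj_on (to_nat_on I) I" using I by (rule inj_on_to_nat_on)
  have E_sum: "(\<Sum>n\<in>N. Lp_dist p (E n x) (E n y) powr p)
      = (\<Sum>i\<in>{i\<in>I. to_nat_on I i \<in> N}. Lp_dist p (F i x) (F i y) powr p)"
    if "finite N" for N x y
  proof -
    have "(\<Sum>n\<in>N. Lp_dist p (E n x) (E n y) powr p)
        = (\<Sum>n\<in>to_nat_on I ` {i\<in>I. to_nat_on I i \<in> N}. Lp_dist p (E n x) (E n y) powr p)"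
      using that p0 by (intro sum.mono_neutral_right) (auto simp: E_def)
    also have "\<dots> = (\<Sum>i\<in>{i\<in>I. to_nat_on I i \<in> N}. Lp_dist p (E (to_nat_on I i) x) (E (to_nat_on I i) y) powr p)"
      using inj by (subst sum.reindex) (auto simp: inj_on_def)
    also have "\<dots> = (\<Sum>i\<in>{i\<in>I. to_nat_on I i \<in> N}. Lp_dist p (F i x) (F i y) powr p)"
      using inj by (intro sum.cong) (auto simp: E_def)
    finally show ?thesis .
  qed
  have fin_pre: "finite {i\<in>I. to_nat_on I i \<in> N}" if "finite N" for N
    using finite_vimage_IntI[OF that inj] by (rule rev_finite_subset) auto
  have E_bound: "(\<Sum>n\<in>N. Lp_dist p (E n x) (E n y) powr p) \<le> L * real (word_dist G S x y) powr p"
    if "finite N" "x \<in> carrier G" "y \<in> carrier G" for N x y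
    unfolding E_sum[OF that(1)] using that fin_pre by (intro bound) auto
  have E_summ: "summable (\<lambda>n. Lp_dist p (E n x) (E n y) powr p)"
    if "x \<in> carrier G" "y \<in> carrier G" for x y
    using E_bound[of "{..<n}" x y for n] that by (intro summableI_nonneg_bounded) auto
  have EL: "E n x \<in> Lp_space p" if "x \<in> carrier G" for n x
    using F that inj by (auto simp: E_def)
  obtain f where f: "\<And>x. x \<in> carrier G \<Longrightarrow> f x \<in> Lp_space p"
    "\<And>x y. x \<in> carrier G \<Longrightarrow> y \<in> carrier G \<Longrightarrow>
       Lp_dist p (f x) (f y) powr p = (suminf (\<lambda>n. Lp_dist p (E n x) (E n y) powr p))"
    by (rule Lp_maps_glue[OF p EL one_closed E_summ]) blast+
  show ?thesis
  proof (rule that)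
    show "f \<in> carrier G \<rightarrow> Lp_space p" using f(1) by auto
    fix x y assume xy: "x \<in> carrier G" "y \<in> carrier G"
    have "Lp_dist p (f x) (f y) powr p \<le> L * real (word_dist G S x y) powr p"
      unfolding f(2)[OF xy] using E_summ[OF xy] E_bound[of "{..<n}" x y for n] xy
      by (intro suminf_le_const) auto
    then have "(Lp_dist p (f x) (f y) powr p) powr (1 / p) \<le> (L * real (word_dist G S x y) powr p) powr (1 / p)"
      using p0 by (intro powr_mono2) auto
    then show "Lp_dist p (f x) (f y) \<le> L powr (1 / p) * real (word_dist G S x y)"
      using p0 by (simp add: powr_powr powr_mult)
    fix J assume J: "finite J" "J \<subseteq> I"
    have "{i \<in> I. to_nat_on I i \<in> to_nat_on I ` J} = J"
      using J inj by (auto simp: inj_on_def)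
    then have "(\<Sum>i\<in>J. Lp_dist p (F i x) (F i y) powr p)
        = (\<Sum>n\<in>to_nat_on I ` J. Lp_dist p (E n x) (E n y) powr p)"
      using J by (simp add: E_sum)
    also have "\<dots> \<le> (suminf (\<lambda>n. Lp_dist p (E n x) (E n y) powr p))"
      using J E_summ[OF xy] by (intro sum_le_suminf) auto
    finally show "(\<Sum>i\<in>J. Lp_dist p (F i x) (F i y) powr p) \<le> Lp_dist p (f x) (f y) powr p"
      by (simp add: f(2)[OF xy])
  qed
qed

end

section \<open>Negative type of the power \<open>p\<close> of the \<open>L\<^sub>p\<close> distance\<close>

text \<open>
  With \<open>C\<close> and \<open>D\<close> the weighted sums of the cosines and sines and \<open>m\<close> the total mass, the
  difference of the two sides is \<open>(m - C)\<^sup>2 + D\<^sup>2\<close>.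
\<close>

lemma cos_double_sum:
  fixes x \<rho> :: "'x \<Rightarrow> real"
  assumes A: "finite A"
  shows "(\<Sum>a\<in>A. \<Sum>b\<in>A. \<rho> a * \<rho> b * (1 - cos (s * (x a - x b))))
           \<le> 2 * (\<Sum>a\<in>A. \<rho> a) * (\<Sum>a\<in>A. \<rho> a * (1 - cos (s * (x a - y))))"
proof -
  define m C D where "m = (\<Sum>a\<in>A. \<rho> a)" and "C = (\<Sum>a\<in>A. \<rho> a * cos (s * (x a - y)))"
    and "D = (\<Sum>a\<in>A. \<rho> a * sin (s * (x a - y)))"
  have cosd: "cos (s * (x a - x b)) = cos (s * (x a - y)) * cos (s * (x b - y))
      + sin (s * (x a - y)) * sin (s * (x b - y))" for a b
    using cos_diff[of "s * (x a - y)" "s * (x b - y)"] by (simp add: algebra_simps)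
  have "(\<Sum>a\<in>A. \<Sum>b\<in>A. \<rho> a * \<rho> b * (1 - cos (s * (x a - x b)))) = m * m - (C * C + D * D)"
    unfolding m_def C_def D_def sum_product cosd
    by (simp add: algebra_simps sum.distrib sum_subtractf)
  moreover have "(\<Sum>a\<in>A. \<rho> a * (1 - cos (s * (x a - y)))) = m - C"
    unfolding m_def C_def by (simp add: algebra_simps sum_subtractf)
  moreover have "0 \<le> (m - C)\<^sup>2 + D\<^sup>2" by simp
  then have "m * m - (C * C + D * D) \<le> 2 * m * (m - C)"
    by (simp add: power2_eq_square algebra_simps)
  ultimately show ?thesis by (simp add: m_def)
qed

text \<open>
  For \<open>0 < p < 2\<close> the integral of this function over \<open>s\<close> is a positive multiple of \<open>\<bar>u\<bar> powr p\<close>,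
  which exhibits the power as a mixture of the functions \<open>1 - cos (s * u)\<close>.
\<close>

definition cos_kernel :: "real \<Rightarrow> real \<Rightarrow> real \<Rightarrow> real" where
  "cos_kernel p u s = indicator {0<..} s * ((1 - cos (s * u)) * s powr (-1 - p))"

lemma one_minus_cos_le_square: "1 - cos x \<le> x\<^sup>2 / 2" for x :: real
proof -
  have "1 - cos x = 2 * (sin (x / 2))\<^sup>2" using cos_double_sin[of "x / 2"] by simp
  also have "(sin (x / 2))\<^sup>2 \<le> (x / 2)\<^sup>2"
    by (rule iffD1[OF abs_le_square_iff abs_sin_x_le_abs_x])
  finally show ?thesis by (simp add: power2_eq_square)
qed

lemma cos_kernel_nonneg: "0 \<le> cos_kernel p u s"
  by (simp add: cos_kernel_def)

text \<open>
  Near the origin \<open>1 - cos\<close> is quadratic and \<open>p < 2\<close> makes the integral converge; at infinity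
  \<open>1 - cos\<close> is bounded and \<open>p > 0\<close> does.
\<close>

lemma integrable_cos_kernel:
  assumes p: "0 < p" "p < 2"
  shows "integrable lborel (cos_kernel p u)"
proof (rule Bochner_Integration.integrable_bound)
  have 1: "set_integrable lebesgue {0..1} (\<lambda>s::real. s powr (1 - p))"
    using p by (intro nonnegative_absolutely_integrable_1 integrable_on_powr_from_0) auto
  have 2: "set_integrable lebesgue {1..} (\<lambda>s::real. s powr (-1 - p))"
    using has_integral_powr_to_inf[of "-1 - p" 1] p
    by (intro nonnegative_absolutely_integrable_1) (auto simp: integrable_on_def)
  have 1: "integrable lborel (\<lambda>s::real. indicator {0..1} s * s powr (1 - p))"
    and 2: "integrable lborel (\<lambda>s::real. indicator {1..} s * s powr (-1 - p))"
    using 1 2 by (simp_all add: set_integrable_def integrable_completion)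
  show "integrable lborel (\<lambda>s. (u\<^sup>2 + 2) * (indicator {0..1} s * s powr (1 - p) + indicator {1..} s * s powr (-1 - p)))"
    by (intro integrable_mult_right Bochner_Integration.integrable_add 1 2)
  show "cos_kernel p u \<in> borel_measurable lborel"
    unfolding cos_kernel_def by measurable
  show "AE s in lborel. norm (cos_kernel p u s)
      \<le> norm ((u\<^sup>2 + 2) * (indicator {0..1} s * s powr (1 - p) + indicator {1..} s * s powr (-1 - p)))"
  proof (rule AE_I2)
    fix s :: real
    have "cos_kernel p u s \<le> (u\<^sup>2 + 2) * (indicator {0..1} s * s powr (1 - p) + indicator {1..} s * s powr (-1 - p))"
    proof -
      consider "s \<le> 0" | "0 < s" "s \<le> 1" | "1 < s" by linarith
      then show ?thesis
      proof cases
        case 1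
        then show ?thesis by (auto simp: cos_kernel_def indicator_def)
      next
        case 2
        have "s\<^sup>2 * s powr (-1 - p) = s powr (1 - p)"
          using 2 by (simp add: powr_add[symmetric] flip: powr_numeral)
        moreover have "(1 - cos (s * u)) * s powr (-1 - p) \<le> ((u\<^sup>2 + 2) * s\<^sup>2) * s powr (-1 - p)"
        proof (intro mult_right_mono)
          have "1 - cos (s * u) \<le> (s * u)\<^sup>2 / 2" by (rule one_minus_cos_le_square)
          also have "\<dots> \<le> (u\<^sup>2 + 2) * s\<^sup>2"
            by (simp add: power_mult_distrib algebra_simps add_increasing)
          finally show "1 - cos (s * u) \<le> (u\<^sup>2 + 2) * s\<^sup>2" .
        qed auto
        ultimately have "(1 - cos (s * u)) * s powr (-1 - p) \<le> (u\<^sup>2 + 2) * s powr (1 - p)"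
          by (simp add: mult.assoc)
        also have "\<dots> \<le> (u\<^sup>2 + 2) * (indicator {0..1} s * s powr (1 - p) + indicator {1..} s * s powr (-1 - p))"
          using 2 by (intro mult_left_mono) auto
        finally show ?thesis using 2 by (simp add: cos_kernel_def)
      next
        case 3
        have "(1 - cos (s * u)) * s powr (-1 - p) \<le> (u\<^sup>2 + 2) * s powr (-1 - p)"
        proof (intro mult_right_mono)
          have "1 - cos (s * u) \<le> 2" using cos_ge_minus_one[of "s * u"] by linarith
          also have "\<dots> \<le> u\<^sup>2 + 2" by simp
          finally show "1 - cos (s * u) \<le> u\<^sup>2 + 2" .
        qed auto
        then show ?thesis using 3 by (simp add: cos_kernel_def)
      qed
    qed
    then show "norm (cos_kernel p u s)
      \<le> norm ((u\<^sup>2 + 2) * (indicator {0..1} s * s powr (1 - p) + indicator {1..} s * s powr (-1 - p)))"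
      using cos_kernel_nonneg[of p u s] by (simp only: real_norm_def abs_of_nonneg)
  qed
qed

text \<open>The substitution \<open>s \<mapsto> s / \<bar>u\<bar>\<close> extracts the power of \<open>u\<close>.\<close>

lemma integral_cos_kernel:
  assumes p: "0 < p" "p < 2"
  shows "(\<integral>s. cos_kernel p u s \<partial>lborel) = \<bar>u\<bar> powr p * (\<integral>s. cos_kernel p 1 s \<partial>lborel)"
proof (cases "u = 0")
  case True
  then show ?thesis using p by (simp add: cos_kernel_def)
next
  case False
  have "(\<integral>s. cos_kernel p u s \<partial>lborel) = \<bar>1/\<bar>u\<bar>\<bar> * (\<integral>s. cos_kernel p u (0 + 1/\<bar>u\<bar> * s) \<partial>lborel)"
    using lborel_integral_real_affine[of "1/\<bar>u\<bar>" "cos_kernel p u" 0] False by simp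
  also have "(\<lambda>s. cos_kernel p u (0 + 1/\<bar>u\<bar> * s)) = (\<lambda>s. \<bar>u\<bar> powr (1 + p) * cos_kernel p 1 s)"
  proof
    fix s :: real
    show "cos_kernel p u (0 + 1/\<bar>u\<bar> * s) = \<bar>u\<bar> powr (1 + p) * cos_kernel p 1 s"
    proof (cases "s > 0")
      case True
      have "cos (s / \<bar>u\<bar> * u) = cos s" using False by (cases "u > 0") auto
      moreover have "(s / \<bar>u\<bar>) powr (-1 - p) = \<bar>u\<bar> powr (1 + p) * s powr (-1 - p)"
        using True False by (simp add: powr_divide powr_diff powr_add powr_minus field_simps)
      ultimately show ?thesis using True False by (simp add: cos_kernel_def)
    next
      case False
      then show ?thesis by (simp add: cos_kernel_def divide_simps)
    qed
  qed
  also have "\<bar>1/\<bar>u\<bar>\<bar> * (\<integral>s. \<bar>u\<bar> powr (1 + p) * cos_kernel p 1 s \<partial>lborel)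
      = \<bar>u\<bar> powr p * (\<integral>s. cos_kernel p 1 s \<partial>lborel)"
    using False by (simp add: powr_add)
  finally show ?thesis .
qed

lemma integral_cos_kernel_pos:
  assumes p: "0 < p" "p < 2"
  shows "(\<integral>s. cos_kernel p 1 s \<partial>lborel) > 0"
proof -
  define c where "c = (1 - cos 1) * (2::real) powr (-1 - p)"
  have "cos 1 < cos (0::real)" using pi_gt3 by (intro cos_monotone_0_pi) auto
  then have c: "c > 0" by (simp add: c_def)
  have "c = (\<integral>s. indicator {1..2::real} s * c \<partial>lborel)" by simp
  also have "\<dots> \<le> (\<integral>s. cos_kernel p 1 s \<partial>lborel)"
  proof (rule integral_mono[OF _ integrable_cos_kernel[OF p]])
    show "integrable lborel (\<lambda>s::real. indicator {1..2} s * c)"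
      by (intro integrable_mult_left) (auto simp: integrable_indicator_iff)
    fix s :: real
    show "indicator {1..2} s * c \<le> cos_kernel p 1 s"
    proof (cases "s \<in> {1..2}")
      case True
      have "cos s \<le> cos 1" using True pi_gt3 by (intro cos_monotone_0_pi_le) auto
      moreover have "2 powr (-1 - p) \<le> s powr (-1 - p)" using True p by (intro powr_mono2') auto
      ultimately show ?thesis using True unfolding c_def cos_kernel_def
        by (auto intro!: mult_mono)
    qed (simp add: cos_kernel_nonneg)
  qed
  finally show ?thesis using c by linarith
qed

text \<open>
  The power is a mixture of functions \<open>1 - cos (s * u)\<close>, for which the inequality is a sum of
  squares. The mixture degenerates at \<open>p = 2\<close>, where the inequality is the expansion of a
  variance.
\<close>

lemma powr_negative_type:
  fixes x \<rho> :: "'x \<Rightarrow> real"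
  assumes p: "0 < p" "p \<le> 2" and A: "finite A"
  shows "(\<Sum>a\<in>A. \<Sum>b\<in>A. \<rho> a * \<rho> b * \<bar>x a - x b\<bar> powr p)
           \<le> 2 * (\<Sum>a\<in>A. \<rho> a) * (\<Sum>a\<in>A. \<rho> a * \<bar>x a - y\<bar> powr p)"
proof (cases "p = 2")
  case True
  define m C D where "m = (\<Sum>a\<in>A. \<rho> a)" and "C = (\<Sum>a\<in>A. \<rho> a * (x a - y))"
    and "D = (\<Sum>a\<in>A. \<rho> a * (x a - y)\<^sup>2)"
  have sq: "(x a - x b)\<^sup>2 = (x a - y)\<^sup>2 + (x b - y)\<^sup>2 - 2 * ((x a - y) * (x b - y))" for a b
    by (simp add: power2_eq_square algebra_simps)
  have "(\<Sum>a\<in>A. \<Sum>b\<in>A. \<rho> a * \<rho> b * (x a - x b)\<^sup>2)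
      = (\<Sum>a\<in>A. \<Sum>b\<in>A. (\<rho> a * (x a - y)\<^sup>2) * \<rho> b + \<rho> a * (\<rho> b * (x b - y)\<^sup>2)
            - 2 * ((\<rho> a * (x a - y)) * (\<rho> b * (x b - y))))"
    by (intro sum.cong refl) (simp add: sq algebra_simps)
  also have "\<dots> = D * m + m * D - 2 * (C * C)"
    unfolding m_def C_def D_def sum_product
    by (simp add: sum.distrib sum_subtractf sum_distrib_left)
  also have "\<dots> \<le> 2 * m * D" by simp
  finally show ?thesis using True by (simp add: m_def D_def)
next
  case False
  with p have p: "0 < p" "p < 2" by auto
  let ?J = "\<integral>s. cos_kernel p 1 s \<partial>lborel"
  have J: "?J > 0" by (rule integral_cos_kernel_pos[OF p])
  note int = integrable_cos_kernel[OF p]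
  have "(\<Sum>a\<in>A. \<Sum>b\<in>A. \<rho> a * \<rho> b * \<bar>x a - x b\<bar> powr p) * ?J
      = (\<integral>s. (\<Sum>a\<in>A. \<Sum>b\<in>A. \<rho> a * \<rho> b * cos_kernel p (x a - x b) s) \<partial>lborel)"
    using int by (simp add: Bochner_Integration.integral_sum Bochner_Integration.integrable_sum
        sum_distrib_right integral_cos_kernel[OF p, of "x _ - x _"] mult.assoc)
  also have "\<dots> \<le> (\<integral>s. 2 * (\<Sum>a\<in>A. \<rho> a) * (\<Sum>a\<in>A. \<rho> a * cos_kernel p (x a - y) s) \<partial>lborel)"
  proof (rule integral_mono)
    show "integrable lborel (\<lambda>s. \<Sum>a\<in>A. \<Sum>b\<in>A. \<rho> a * \<rho> b * cos_kernel p (x a - x b) s)"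
      using int by (intro Bochner_Integration.integrable_sum integrable_mult_right)
    show "integrable lborel (\<lambda>s. 2 * (\<Sum>a\<in>A. \<rho> a) * (\<Sum>a\<in>A. \<rho> a * cos_kernel p (x a - y) s))"
      using int by (intro Bochner_Integration.integrable_sum integrable_mult_right)
    fix s
    let ?w = "indicator {0<..} s * s powr (-1 - p)"
    have w: "cos_kernel p u s = ?w * (1 - cos (s * u))" for u by (simp add: cos_kernel_def)
    have "(\<Sum>a\<in>A. \<Sum>b\<in>A. \<rho> a * \<rho> b * cos_kernel p (x a - x b) s)
        = ?w * (\<Sum>a\<in>A. \<Sum>b\<in>A. \<rho> a * \<rho> b * (1 - cos (s * (x a - x b))))"
      unfolding w sum_distrib_left by (intro sum.cong refl) (simp add: mult_ac)
    also have "\<dots> \<le> ?w * (2 * (\<Sum>a\<in>A. \<rho> a) * (\<Sum>a\<in>A. \<rho> a * (1 - cos (s * (x a - y)))))"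
      by (intro mult_left_mono cos_double_sum A) auto
    also have "\<dots> = 2 * (\<Sum>a\<in>A. \<rho> a) * (\<Sum>a\<in>A. \<rho> a * cos_kernel p (x a - y) s)"
      unfolding w sum_distrib_left by (intro sum.cong refl) (simp add: mult_ac)
    finally show "(\<Sum>a\<in>A. \<Sum>b\<in>A. \<rho> a * \<rho> b * cos_kernel p (x a - x b) s)
        \<le> 2 * (\<Sum>a\<in>A. \<rho> a) * (\<Sum>a\<in>A. \<rho> a * cos_kernel p (x a - y) s)" .
  qed
  also have "\<dots> = (2 * (\<Sum>a\<in>A. \<rho> a) * (\<Sum>a\<in>A. \<rho> a * \<bar>x a - y\<bar> powr p)) * ?J"
    using int by (simp add: Bochner_Integration.integral_sum Bochner_Integration.integrable_sum
        sum_distrib_right integral_cos_kernel[OF p, of "x _ - y"] mult.assoc)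
  finally show ?thesis using J by simp
qed

text \<open>
  In probabilistic terms: for two independent random points with law \<open>\<rho>\<close>, the expected \<open>p\<close>-th
  power of their distance is at most twice the expected \<open>p\<close>-th power of the distance of one of
  them to any fixed point. Lost mass is harmless, which is what makes the inequality usable for
  walks that are killed at a boundary.
\<close>

lemma Lp_negative_type:
  fixes \<rho> :: "'x \<Rightarrow> real"
  assumes p: "1 \<le> p" "p \<le> 2" and A: "finite A"
    and \<rho>: "\<And>a. a \<in> A \<Longrightarrow> 0 \<le> \<rho> a" "(\<Sum>a\<in>A. \<rho> a) \<le> 1"
    and f: "\<And>a. a \<in> A \<Longrightarrow> f a \<in> Lp_space p" and g: "g \<in> Lp_space p"
  shows "(\<Sum>a\<in>A. \<Sum>b\<in>A. \<rho> a * \<rho> b * Lp_dist p (f a) (f b) powr p)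
           \<le> 2 * (\<Sum>a\<in>A. \<rho> a * Lp_dist p (f a) g powr p)"
proof -
  let ?M = "lebesgue_on {0..1::real}"
  have p0: "0 < p" using p by simp
  note int = Lp_space_diff_integrable[OF p(1)]
  have "(\<Sum>a\<in>A. \<Sum>b\<in>A. \<rho> a * \<rho> b * Lp_dist p (f a) (f b) powr p)
      = (\<integral>t. (\<Sum>a\<in>A. \<Sum>b\<in>A. \<rho> a * \<rho> b * \<bar>f a t - f b t\<bar> powr p) \<partial>?M)"
    using int[OF f f] by (simp add: Bochner_Integration.integral_sum Bochner_Integration.integrable_sum
        Lp_dist_powr[OF p0])
  also have "\<dots> \<le> (\<integral>t. 2 * (\<Sum>a\<in>A. \<rho> a) * (\<Sum>a\<in>A. \<rho> a * \<bar>f a t - g t\<bar> powr p) \<partial>?M)"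
    using int[OF f f] int[OF f g] p0 p
    by (intro integral_mono Bochner_Integration.integrable_sum integrable_mult_right powr_negative_type A)
  also have "\<dots> = (\<Sum>a\<in>A. \<rho> a) * (2 * (\<Sum>a\<in>A. \<rho> a * Lp_dist p (f a) g powr p))"
    using int[OF f g] by (simp add: Bochner_Integration.integral_sum Bochner_Integration.integrable_sum
        Lp_dist_powr[OF p0])
  also have "\<dots> \<le> 1 * (2 * (\<Sum>a\<in>A. \<rho> a * Lp_dist p (f a) g powr p))"
    using \<rho> by (intro mult_right_mono mult_nonneg_nonneg sum_nonneg) auto
  finally show ?thesis by simp
qed

section \<open>Tours and the word metric of a wreath product\<close>

definition lamp :: "('a, 'm) monoid_scheme \<Rightarrow> ('b, 'n) monoid_scheme \<Rightarrow> 'a \<Rightarrow> ('b \<Rightarrow> 'a) \<times> 'b" where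
  "lamp G H g = (\<lambda>z\<in>carrier H. if z = \<one>\<^bsub>H\<^esub> then g else \<one>\<^bsub>G\<^esub>, \<one>\<^bsub>H\<^esub>)"

definition move :: "('a, 'm) monoid_scheme \<Rightarrow> ('b, 'n) monoid_scheme \<Rightarrow> 'b \<Rightarrow> ('b \<Rightarrow> 'a) \<times> 'b" where
  "move G H h = (\<lambda>z\<in>carrier H. \<one>\<^bsub>G\<^esub>, h)"

definition wreath_gens ::
    "('a, 'm) monoid_scheme \<Rightarrow> ('b, 'n) monoid_scheme \<Rightarrow> 'a set \<Rightarrow> 'b set \<Rightarrow> (('b \<Rightarrow> 'a) \<times> 'b) set" where
  "wreath_gens G H SG SH = lamp G H ` SG \<union> move G H ` SH"

text \<open>The vertices of the path in the Cayley graph that starts at \<open>x\<close> and reads the word.\<close>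

primrec visited :: "('b, 'n) monoid_scheme \<Rightarrow> 'b \<Rightarrow> 'b list \<Rightarrow> 'b set" where
  "visited H x [] = {x}"
| "visited H x (s # ws) = insert x (visited H (x \<otimes>\<^bsub>H\<^esub> s) ws)"

definition closed_tour :: "('b, 'n) monoid_scheme \<Rightarrow> 'b set \<Rightarrow> 'b \<Rightarrow> 'b set \<Rightarrow> nat \<Rightarrow> bool" where
  "closed_tour H S x A n \<longleftrightarrow>
     (\<exists>ws. set ws \<subseteq> S \<and> length ws \<le> n \<and> word_prod H ws = \<one>\<^bsub>H\<^esub> \<and> A \<subseteq> visited H x ws)"

context group
begin

lemma word_dist_self [simp]: "x \<in> carrier G \<Longrightarrow> word_dist G S x x = 0"
  using word_length_le[of "[]" S \<one>] by (simp add: word_dist_def)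

lemma word_length_inv_le:
  assumes S: "sym_gen_set G S" and x: "x \<in> carrier G"
  shows "word_length G S (inv x) \<le> word_length G S x"
proof -
  have SG: "S \<subseteq> carrier G" and inv: "\<And>s. s \<in> S \<Longrightarrow> inv s \<in> S"
    using S by (auto simp: sym_gen_set_def)
  have *: "\<exists>vs. set vs \<subseteq> S \<and> length vs = length ws \<and> word_prod G vs = inv (word_prod G ws)"
    if "set ws \<subseteq> S" for ws
    using that
  proof (induction ws)
    case Nil
    then show ?case by simp
  next
    case (Cons s ws)
    then obtain vs where "set vs \<subseteq> S" "length vs = length ws" "word_prod G vs = inv (word_prod G ws)"
      by auto
    then show ?case using Cons.prems SG inv
      by (intro exI[of _ "vs @ [inv s]"]) (auto simp: word_prod_append inv_mult_group subset_iff)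
  qed
  obtain ws where "set ws \<subseteq> S" "length ws = word_length G S x" "word_prod G ws = x"
    using word_length_witness[OF S x] by blast
  with *[of ws] show ?thesis by (metis word_length_le)
qed

lemma word_dist_commute:
  assumes S: "sym_gen_set G S" and "x \<in> carrier G" "y \<in> carrier G"
  shows "word_dist G S x y = word_dist G S y x"
  using word_length_inv_le[OF S, of "inv x \<otimes> y"] word_length_inv_le[OF S, of "inv y \<otimes> x"] assms(2,3)
  by (simp add: word_dist_def inv_mult_group)

lemma word_dist_triangle:
  assumes S: "sym_gen_set G S" and "x \<in> carrier G" "y \<in> carrier G" "z \<in> carrier G"
  shows "word_dist G S x z \<le> word_dist G S x y + word_dist G S y z"
proof -
  have "inv x \<otimes> z = (inv x \<otimes> y) \<otimes> (inv y \<otimes> z)"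
  proof -
    have "y \<otimes> (inv y \<otimes> z) = z" using assms by (simp flip: m_assoc)
    then show ?thesis using assms by (simp add: m_assoc)
  qed
  then show ?thesis
    using word_length_mult[OF S, of "inv x \<otimes> y" "inv y \<otimes> z"] assms by (simp add: word_dist_def)
qed

lemma word_dist_eq_0:
  assumes S: "sym_gen_set G S" and "x \<in> carrier G" "y \<in> carrier G" and "word_dist G S x y = 0"
  shows "x = y"
proof -
  have "inv x \<otimes> y = \<one>"
    using word_length_witness[OF S, of "inv x \<otimes> y"] assms(2-) by (auto simp: word_dist_def)
  then show ?thesis using assms by (metis inv_equality inv_inv inv_closed)
qed

lemma word_dist_generator_le:
  assumes S: "sym_gen_set G S" and "x \<in> carrier G" "s \<in> S"
  shows "word_dist G S x (x \<otimes> s) \<le> 1"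
proof -
  have "s \<in> carrier G" using S assms by (auto simp: sym_gen_set_def)
  then show ?thesis using word_length_le[of "[s]" S s] assms
    by (simp add: word_dist_def m_assoc[symmetric])
qed

lemma word_dist_word_le:
  assumes "set us \<subseteq> S" "S \<subseteq> carrier G" "x \<in> carrier G" "y = x \<otimes> word_prod G us"
  shows "word_dist G S x y \<le> length us"
proof -
  have "set us \<subseteq> carrier G" using assms(1,2) by blast
  then have "inv x \<otimes> y = word_prod G us" using assms(3,4) by (simp flip: m_assoc)
  then show ?thesis using word_length_le[OF assms(1)] by (simp add: word_dist_def)
qed

lemma word_dist_witness:
  assumes S: "sym_gen_set G S" and "x \<in> carrier G" "y \<in> carrier G"
  obtains ws where "set ws \<subseteq> S" "length ws = word_dist G S x y" "x \<otimes> word_prod G ws = y"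
proof -
  obtain ws where ws: "set ws \<subseteq> S" "length ws = word_dist G S x y" "word_prod G ws = inv x \<otimes> y"
    using word_length_witness[OF S, of "inv x \<otimes> y"] assms(2-) by (auto simp: word_dist_def)
  then have "x \<otimes> word_prod G ws = y" using assms by (simp flip: m_assoc)
  with ws show ?thesis using that by blast
qed

lemma start_visited: "x \<in> visited G x ws"
  by (cases ws) auto

lemma visited_append:
  assumes "set us \<subseteq> carrier G" "set vs \<subseteq> carrier G" "x \<in> carrier G"
  shows "visited G x (us @ vs) = visited G x us \<union> visited G (x \<otimes> word_prod G us) vs"
  using assms start_visited[of "x \<otimes> word_prod G us" vs]
proof (induction us arbitrary: x)
  case (Cons u us)
  then have "visited G (x \<otimes> u) (us @ vs)
      = visited G (x \<otimes> u) us \<union> visited G ((x \<otimes> u) \<otimes> word_prod G us) vs"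
    by (intro Cons.IH) (auto simp: start_visited)
  then show ?case using Cons.prems by (simp add: m_assoc)
qed auto

lemma visited_split:
  assumes "y \<in> visited G x ws" "set ws \<subseteq> carrier G" "x \<in> carrier G"
  shows "\<exists>us vs. ws = us @ vs \<and> y = x \<otimes> word_prod G us"
  using assms
proof (induction ws arbitrary: x)
  case Nil
  then show ?case by simp
next
  case (Cons s ws)
  show ?case
  proof (cases "y = x")
    case True
    then show ?thesis using Cons.prems by (intro exI[of _ "[]"] exI[of _ "s # ws"]) auto
  next
    case False
    then obtain us vs where "ws = us @ vs" "y = (x \<otimes> s) \<otimes> word_prod G us"
      using Cons.IH[of "x \<otimes> s"] Cons.prems by auto
    then show ?thesis using Cons.prems
      by (intro exI[of _ "s # us"] exI[of _ vs]) (auto simp: m_assoc)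
  qed
qed

lemma closed_tour_start: "x \<in> carrier G \<Longrightarrow> closed_tour G S x {x} 0"
  unfolding closed_tour_def by (intro exI[of _ "[]"]) simp

text \<open>
  A tour visits a further point by a detour from an already visited one, there and back.
\<close>

lemma closed_tour_insert:
  assumes S: "sym_gen_set G S" and x: "x \<in> carrier G" and tour: "closed_tour G S x A n"
    and y: "y \<in> A" "y \<in> carrier G" and z: "z \<in> carrier G" and d: "word_dist G S y z \<le> m"
  shows "closed_tour G S x (insert z A) (n + 2 * m)"
proof -
  have SG: "S \<subseteq> carrier G" using S by (auto simp: sym_gen_set_def)
  obtain ws where ws: "set ws \<subseteq> S" "length ws \<le> n" "word_prod G ws = \<one>" "A \<subseteq> visited G x ws"
    using tour by (auto simp: closed_tour_def)
  then obtain us vs where uv: "ws = us @ vs" "y = x \<otimes> word_prod G us"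
    using visited_split[of y x ws] y x SG by blast
  have sub: "set us \<subseteq> carrier G" "set vs \<subseteq> carrier G" "set us \<subseteq> S" "set vs \<subseteq> S"
    using ws uv SG by auto
  obtain q where q: "set q \<subseteq> S" "length q \<le> m" "y \<otimes> word_prod G q = z"
    using word_dist_witness[OF S y(2) z] d by metis
  obtain r where r: "set r \<subseteq> S" "length r \<le> m" "z \<otimes> word_prod G r = y"
    using word_dist_witness[OF S z y(2)] d word_dist_commute[OF S y(2) z] by metis
  have sub': "set q \<subseteq> carrier G" "set r \<subseteq> carrier G" using q r SG by auto
  have qr: "word_prod G q \<otimes> word_prod G r = \<one>"
  proof -
    have "y \<otimes> (word_prod G q \<otimes> word_prod G r) = y \<otimes> \<one>"
      using q(3) r(3) y(2) sub' m_assoc[of y "word_prod G q" "word_prod G r"] by simp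
    then show ?thesis using y(2) sub' by (subst (asm) l_cancel) auto
  qed
  have "visited G x (us @ q @ r @ vs) = visited G x us \<union> visited G y (q @ r @ vs)"
    using sub sub' x uv(2) by (subst visited_append) auto
  moreover have "visited G y (q @ r @ vs) = visited G y q \<union> visited G z (r @ vs)"
    using sub sub' y(2) q(3) by (subst visited_append) auto
  moreover have "visited G z (r @ vs) = visited G z r \<union> visited G y vs"
    using sub sub' z r(3) by (subst visited_append) auto
  moreover have "visited G x ws = visited G x us \<union> visited G y vs"
    using sub x uv by (simp add: visited_append)
  ultimately have "insert z A \<subseteq> visited G x (us @ q @ r @ vs)"
    using ws(4) start_visited[of z r] by auto
  moreover have "word_prod G (us @ q @ r @ vs) = \<one>"
  proof -
    have "word_prod G (us @ q @ r @ vs) = word_prod G us \<otimes> ((word_prod G q \<otimes> word_prod G r) \<otimes> word_prod G vs)"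
      using sub sub' by (simp add: word_prod_append m_assoc)
    also have "\<dots> = word_prod G ws" using sub uv by (simp add: qr word_prod_append)
    finally show ?thesis using ws by simp
  qed
  moreover have "length (us @ q @ r @ vs) \<le> n + 2 * m" using ws uv q r by simp
  moreover have "set (us @ q @ r @ vs) \<subseteq> S" using sub q r by simp
  ultimately show ?thesis unfolding closed_tour_def by blast
qed

lemma closed_tour_extend:
  assumes S: "sym_gen_set G S" and x: "x \<in> carrier G" and tour: "closed_tour G S x A n"
    and A: "A \<subseteq> carrier G" and Z: "finite Z" "Z \<subseteq> carrier G"
    and near: "\<And>z. z \<in> Z \<Longrightarrow> \<exists>y\<in>A. word_dist G S y z \<le> m"
  shows "closed_tour G S x (Z \<union> A) (n + 2 * m * card Z)"
  using Z near
proof (induction Z rule: finite_induct)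
  case empty
  then show ?case using tour by simp
next
  case (insert z Z)
  then have "closed_tour G S x (Z \<union> A) (n + 2 * m * card Z)" by auto
  moreover obtain y where "y \<in> A" "word_dist G S y z \<le> m" using insert.prems by blast
  ultimately have "closed_tour G S x (insert z (Z \<union> A)) (n + 2 * m * card Z + 2 * m)"
    using insert.prems A by (intro closed_tour_insert[OF S x, of _ _ y]) auto
  then show ?case using insert.hyps by (simp add: algebra_simps)
qed

lemma closed_tour_mono:
  "closed_tour G S x A n \<Longrightarrow> B \<subseteq> A \<Longrightarrow> n \<le> m \<Longrightarrow> closed_tour G S x B m"
  unfolding closed_tour_def by (meson order_trans)

end

locale wreath = G: group G + H: group H
  for G :: "('a, 'm) monoid_scheme" and H :: "('b, 'n) monoid_scheme" +
  fixes SG :: "'a set" and SH :: "'b set"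
  assumes SG: "sym_gen_set G SG" and SH: "sym_gen_set H SH"
begin

abbreviation W where "W \<equiv> wreath_product G H"
abbreviation T where "T \<equiv> wreath_gens G H SG SH"

definition configs :: "('b \<Rightarrow> 'a) set" where
  "configs = {f \<in> carrier H \<rightarrow>\<^sub>E carrier G. finite {z \<in> carrier H. f z \<noteq> \<one>\<^bsub>G\<^esub>}}"

definition diff_set :: "('b \<Rightarrow> 'a) \<Rightarrow> ('b \<Rightarrow> 'a) \<Rightarrow> 'b set" where
  "diff_set f g = {z \<in> carrier H. f z \<noteq> g z}"

sublocale W: group W
  by (intro group_wreath_product G.group_axioms H.group_axioms)

lemma SG_carrier: "SG \<subseteq> carrier G" and SH_carrier: "SH \<subseteq> carrier H"
  using SG SH by (auto simp: sym_gen_set_def)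

lemma carrier_W: "carrier W = configs \<times> carrier H"
  by (simp add: wreath_product_def configs_def)

lemma configs_closed [simp]: "f \<in> configs \<Longrightarrow> z \<in> carrier H \<Longrightarrow> f z \<in> carrier G"
  by (auto simp: configs_def)

lemma finite_diff_set: "f \<in> configs \<Longrightarrow> g \<in> configs \<Longrightarrow> finite (diff_set f g)"
  by (rule finite_subset[of _ "{z \<in> carrier H. f z \<noteq> \<one>\<^bsub>G\<^esub>} \<union> {z \<in> carrier H. g z \<noteq> \<one>\<^bsub>G\<^esub>}"])
    (auto simp: configs_def diff_set_def)

lemma diff_set_carrier: "diff_set f g \<subseteq> carrier H"
  by (auto simp: diff_set_def)

lemma configs_eqI:
  assumes "f \<in> configs" "g \<in> configs" "diff_set f g = {}"
  shows "f = g"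
proof (rule extensionalityI[of f "carrier H"])
  show "f \<in> extensional (carrier H)" "g \<in> extensional (carrier H)"
    using assms(1,2) unfolding configs_def PiE_def by blast+
  show "f z = g z" if "z \<in> carrier H" for z
    using assms(3) that unfolding diff_set_def by blast
qed

lemma configs_upd:
  assumes "f \<in> configs" "x \<in> carrier H" "a \<in> carrier G"
  shows "f(x := a) \<in> configs"
proof -
  have "finite {z \<in> carrier H. (f(x := a)) z \<noteq> \<one>\<^bsub>G\<^esub>}"
    by (rule finite_subset[of _ "insert x {z \<in> carrier H. f z \<noteq> \<one>\<^bsub>G\<^esub>}"])
      (use assms in \<open>auto simp: configs_def\<close>)
  moreover have "f(x := a) \<in> carrier H \<rightarrow>\<^sub>E carrier G"
    using assms unfolding configs_def by (auto simp: PiE_iff extensional_def)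
  ultimately show ?thesis by (simp add: configs_def)
qed

lemma lamp_mult:
  assumes "f \<in> configs" "x \<in> carrier H" "g \<in> carrier G"
  shows "(f, x) \<otimes>\<^bsub>W\<^esub> lamp G H g = (f(x := f x \<otimes>\<^bsub>G\<^esub> g), x)"
proof -
  have 1: "inv\<^bsub>H\<^esub> x \<otimes>\<^bsub>H\<^esub> z = \<one>\<^bsub>H\<^esub> \<longleftrightarrow> z = x" if "z \<in> carrier H" for z
    using assms(2) that by (metis H.inv_closed H.inv_equality H.inv_inv H.l_inv)
  have "(\<lambda>z\<in>carrier H. f z) = f" using assms by (auto simp: configs_def PiE_restrict)
  then have "f z = undefined" if "z \<notin> carrier H" for z using that by (metis restrict_apply)
  with 1 show ?thesis using assms
    by (auto simp: lamp_def wreath_product_def fun_eq_iff)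
qed

lemma move_mult:
  assumes "f \<in> configs" "x \<in> carrier H" "h \<in> carrier H"
  shows "(f, x) \<otimes>\<^bsub>W\<^esub> move G H h = (f, x \<otimes>\<^bsub>H\<^esub> h)"
proof -
  have "(\<lambda>z\<in>carrier H. f z) = f" using assms by (auto simp: configs_def PiE_restrict)
  then have "f z = undefined" if "z \<notin> carrier H" for z using that by (metis restrict_apply)
  then show ?thesis using assms
    by (auto simp: move_def wreath_product_def fun_eq_iff)
qed

lemma lamp_carrier: "g \<in> carrier G \<Longrightarrow> lamp G H g \<in> carrier W"
proof -
  assume g: "g \<in> carrier G"
  have "finite {z \<in> carrier H. (\<lambda>z\<in>carrier H. if z = \<one>\<^bsub>H\<^esub> then g else \<one>\<^bsub>G\<^esub>) z \<noteq> \<one>\<^bsub>G\<^esub>}"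
    by (rule finite_subset[of _ "{\<one>\<^bsub>H\<^esub>}"]) auto
  then show ?thesis using g by (auto simp: lamp_def carrier_W configs_def)
qed

lemma move_carrier: "h \<in> carrier H \<Longrightarrow> move G H h \<in> carrier W"
  by (auto simp: move_def carrier_W configs_def)

lemma T_carrier: "T \<subseteq> carrier W"
  using lamp_carrier move_carrier SG_carrier SH_carrier by (auto simp: wreath_gens_def)

lemma T_cases:
  assumes "s \<in> T" "f \<in> configs" "x \<in> carrier H"
  obtains g where "g \<in> SG" "(f, x) \<otimes>\<^bsub>W\<^esub> s = (f(x := f x \<otimes>\<^bsub>G\<^esub> g), x)"
  | h where "h \<in> SH" "(f, x) \<otimes>\<^bsub>W\<^esub> s = (f, x \<otimes>\<^bsub>H\<^esub> h)"
  using assms lamp_mult move_mult SG_carrier SH_carrier unfolding wreath_gens_def by blast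

lemma lamp_word:
  assumes "set vs \<subseteq> SG" "f \<in> configs" "x \<in> carrier H"
  shows "(f, x) \<otimes>\<^bsub>W\<^esub> word_prod W (map (lamp G H) vs) = (f(x := f x \<otimes>\<^bsub>G\<^esub> word_prod G vs), x)"
  using assms
proof (induction vs arbitrary: f)
  case Nil
  then show ?case using carrier_W by simp
next
  case (Cons v vs)
  define f' where "f' = f(x := f x \<otimes>\<^bsub>G\<^esub> v)"
  have v: "v \<in> carrier G" and vs: "set vs \<subseteq> carrier G" using Cons.prems SG_carrier by auto
  have fx: "(f, x) \<in> carrier W" using Cons.prems carrier_W by auto
  have "set (map (lamp G H) vs) \<subseteq> carrier W" using vs lamp_carrier by auto
  then have "(f, x) \<otimes>\<^bsub>W\<^esub> word_prod W (map (lamp G H) (v # vs))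
      = ((f, x) \<otimes>\<^bsub>W\<^esub> lamp G H v) \<otimes>\<^bsub>W\<^esub> word_prod W (map (lamp G H) vs)"
    using fx lamp_carrier[OF v] by (simp add: W.m_assoc)
  also have "\<dots> = (f', x) \<otimes>\<^bsub>W\<^esub> word_prod W (map (lamp G H) vs)"
    using lamp_mult[of f x v] Cons.prems v by (simp add: f'_def)
  also have "\<dots> = (f'(x := f' x \<otimes>\<^bsub>G\<^esub> word_prod G vs), x)"
  proof (rule Cons.IH)
    show "f' \<in> configs" unfolding f'_def using Cons.prems v by (intro configs_upd) auto
  qed (use Cons.prems in auto)
  also have "\<dots> = (f(x := f x \<otimes>\<^bsub>G\<^esub> word_prod G (v # vs)), x)"
    using Cons.prems v vs by (simp add: f'_def G.m_assoc)
  finally show ?case .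
qed

text \<open>
  The sum of the lamp distances drops by exactly the length of the word, so the cost of a walk
  with lamp changes can be accounted for by induction along the walk.
\<close>

lemma set_lamp_word:
  assumes f: "f \<in> configs" and g: "g \<in> configs" and x: "x \<in> carrier H"
  obtains us where "set us \<subseteq> T" "(f, x) \<otimes>\<^bsub>W\<^esub> word_prod W us = (f(x := g x), x)"
    "(\<Sum>z\<in>diff_set f g. word_dist G SG (f z) (g z))
      = length us + (\<Sum>z\<in>diff_set (f(x := g x)) g. word_dist G SG (f z) (g z))"
proof -
  obtain vs where vs: "set vs \<subseteq> SG" "length vs = word_dist G SG (f x) (g x)"
    "f x \<otimes>\<^bsub>G\<^esub> word_prod G vs = g x"
    using G.word_dist_witness[OF SG, of "f x" "g x"] f g x by auto
  have "diff_set (f(x := g x)) g = diff_set f g - {x}" by (auto simp: diff_set_def)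
  moreover have "(\<Sum>z\<in>diff_set f g. word_dist G SG (f z) (g z))
      = word_dist G SG (f x) (g x) + (\<Sum>z\<in>diff_set f g - {x}. word_dist G SG (f z) (g z))"
  proof (cases "x \<in> diff_set f g")
    case True
    then show ?thesis using finite_diff_set[OF f g] by (simp add: sum.remove)
  next
    case False
    then have "f x = g x" using x by (auto simp: diff_set_def)
    then show ?thesis using False g x by simp
  qed
  ultimately show ?thesis
    using vs lamp_word[OF vs(1) f x]
    by (intro that[of "map (lamp G H) vs"]) (auto simp: wreath_gens_def)
qed

text \<open>
  The lighter walks along the path and sets every lamp to its final value when first standing at
  it.
\<close>

lemma word_along_path:
  assumes "f \<in> configs" "g \<in> configs" "x \<in> carrier H" "set ws \<subseteq> SH" "diff_set f g \<subseteq> visited H x ws"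
  shows "\<exists>us. set us \<subseteq> T \<and> length us \<le> length ws + (\<Sum>z\<in>diff_set f g. word_dist G SG (f z) (g z))
     \<and> (f, x) \<otimes>\<^bsub>W\<^esub> word_prod W us = (g, x \<otimes>\<^bsub>H\<^esub> word_prod H ws)"
  using assms
proof (induction ws arbitrary: f x)
  case Nil
  obtain us where us: "set us \<subseteq> T" "(f, x) \<otimes>\<^bsub>W\<^esub> word_prod W us = (f(x := g x), x)"
    "(\<Sum>z\<in>diff_set f g. word_dist G SG (f z) (g z))
      = length us + (\<Sum>z\<in>diff_set (f(x := g x)) g. word_dist G SG (f z) (g z))"
    using set_lamp_word[OF Nil(1-3)] by blast
  have "diff_set (f(x := g x)) g = {}" using Nil by (auto simp: diff_set_def)
  then have "f(x := g x) = g" using Nil by (intro configs_eqI configs_upd) auto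
  then show ?case using us Nil by (intro exI[of _ us]) simp
next
  case (Cons s ws)
  have s: "s \<in> carrier H" "s \<in> SH" and ws: "set ws \<subseteq> SH" "set ws \<subseteq> carrier H"
    using Cons.prems SH_carrier by auto
  define f' where "f' = f(x := g x)"
  have f': "f' \<in> configs" using Cons.prems by (simp add: f'_def configs_upd)
  obtain vs where vs: "set vs \<subseteq> T" "(f, x) \<otimes>\<^bsub>W\<^esub> word_prod W vs = (f', x)"
    "(\<Sum>z\<in>diff_set f g. word_dist G SG (f z) (g z))
      = length vs + (\<Sum>z\<in>diff_set f' g. word_dist G SG (f z) (g z))"
    using set_lamp_word[OF Cons.prems(1-3)] unfolding f'_def by blast
  have sum': "(\<Sum>z\<in>diff_set f' g. word_dist G SG (f z) (g z)) = (\<Sum>z\<in>diff_set f' g. word_dist G SG (f' z) (g z))"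
    by (intro sum.cong) (auto simp: f'_def diff_set_def)
  have "diff_set f' g \<subseteq> visited H (x \<otimes>\<^bsub>H\<^esub> s) ws"
    using Cons.prems by (auto simp: f'_def diff_set_def split: if_splits)
  then obtain us where us: "set us \<subseteq> T"
    "length us \<le> length ws + (\<Sum>z\<in>diff_set f' g. word_dist G SG (f' z) (g z))"
    "(f', x \<otimes>\<^bsub>H\<^esub> s) \<otimes>\<^bsub>W\<^esub> word_prod W us = (g, (x \<otimes>\<^bsub>H\<^esub> s) \<otimes>\<^bsub>H\<^esub> word_prod H ws)"
    using Cons.IH[OF f', of "x \<otimes>\<^bsub>H\<^esub> s"] Cons.prems ws s by auto
  have carr: "set us \<subseteq> carrier W" "set vs \<subseteq> carrier W" using us vs T_carrier by blast+
  have fx: "(f, x) \<in> carrier W" using Cons.prems carrier_W by auto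
  have "(f, x) \<otimes>\<^bsub>W\<^esub> word_prod W (vs @ move G H s # us)
      = (((f, x) \<otimes>\<^bsub>W\<^esub> word_prod W vs) \<otimes>\<^bsub>W\<^esub> move G H s) \<otimes>\<^bsub>W\<^esub> word_prod W us"
    using fx carr move_carrier[OF s(1)] by (simp add: W.word_prod_append W.m_assoc)
  also have "\<dots> = (g, x \<otimes>\<^bsub>H\<^esub> word_prod H (s # ws))"
    using us move_mult[OF f' _ s(1)] s Cons.prems ws by (simp add: vs(2) H.m_assoc)
  finally show ?case
    using us vs s sum' by (intro exI[of _ "vs @ move G H s # us"]) (auto simp: wreath_gens_def)
qed

lemma sym_gen_set_T: "sym_gen_set W T"
proof -
  have "generate W T = carrier W"
  proof
    show "generate W T \<subseteq> carrier W" using W.generate_incl[OF T_carrier] .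
    show "carrier W \<subseteq> generate W T"
    proof
      fix w assume "w \<in> carrier W"
      then obtain f x where w: "w = (f, x)" and f: "f \<in> configs" and x: "x \<in> carrier H"
        using carrier_W by auto
      define e where "e = (\<lambda>z\<in>carrier H. \<one>\<^bsub>G\<^esub>)"
      have e: "e \<in> configs" by (simp add: e_def configs_def)
      have one: "\<one>\<^bsub>W\<^esub> = (e, \<one>\<^bsub>H\<^esub>)" by (simp add: wreath_product_def e_def)
      define m where "m = Max (word_dist H SH \<one>\<^bsub>H\<^esub> ` diff_set e f)"
      have "closed_tour H SH \<one>\<^bsub>H\<^esub> (diff_set e f \<union> {\<one>\<^bsub>H\<^esub>}) (0 + 2 * m * card (diff_set e f))"
        using finite_diff_set[OF e f] diff_set_carrier
        by (intro H.closed_tour_extend[OF SH]) (auto simp: m_def intro!: H.closed_tour_start)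
      then obtain ws where ws: "set ws \<subseteq> SH" "word_prod H ws = \<one>\<^bsub>H\<^esub>" "diff_set e f \<subseteq> visited H \<one>\<^bsub>H\<^esub> ws"
        unfolding closed_tour_def by auto
      obtain vs where vs: "set vs \<subseteq> SH" "word_prod H vs = x"
        using H.word_exists[OF SH x] by blast
      have "diff_set e f \<subseteq> visited H \<one>\<^bsub>H\<^esub> (ws @ vs)"
        using ws vs SH_carrier by (subst H.visited_append) auto
      then obtain us where us: "set us \<subseteq> T" "(e, \<one>\<^bsub>H\<^esub>) \<otimes>\<^bsub>W\<^esub> word_prod W us = (f, \<one>\<^bsub>H\<^esub> \<otimes>\<^bsub>H\<^esub> word_prod H (ws @ vs))"
        using word_along_path[OF e f H.one_closed, of "ws @ vs"] ws vs by auto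
      have "set us \<subseteq> carrier W" using us T_carrier by blast
      moreover have "set ws \<subseteq> carrier H" "set vs \<subseteq> carrier H" using ws vs SH_carrier by auto
      ultimately have "word_prod W us = w"
        using us ws vs x w by (simp add: H.word_prod_append flip: one)
      moreover have "word_prod W us \<in> generate W T"
        using us(1) by (induction us) (auto intro: generate.intros)
      ultimately show "w \<in> generate W T" by simp
    qed
  qed
  moreover have "inv\<^bsub>W\<^esub> s \<in> T" if "s \<in> T" for s
  proof -
    define e where "e = (\<lambda>z\<in>carrier H. \<one>\<^bsub>G\<^esub>)"
    have e: "e \<in> configs" by (simp add: e_def configs_def)
    have one: "\<one>\<^bsub>W\<^esub> = (e, \<one>\<^bsub>H\<^esub>)" by (simp add: wreath_product_def e_def)
    have eu: "e(\<one>\<^bsub>H\<^esub> := \<one>\<^bsub>G\<^esub>) = e" by (auto simp: e_def fun_eq_iff)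
    have lamp0: "lamp G H g = (e(\<one>\<^bsub>H\<^esub> := g), \<one>\<^bsub>H\<^esub>)" for g
      by (auto simp: lamp_def e_def fun_eq_iff)
    have move0: "move G H h = (e, h)" for h by (simp add: move_def e_def)
    from that consider g where "g \<in> SG" "s = lamp G H g" | h where "h \<in> SH" "s = move G H h"
      by (auto simp: wreath_gens_def)
    then show ?thesis
    proof cases
      case 1
      then have g: "g \<in> carrier G" "inv\<^bsub>G\<^esub> g \<in> SG" using SG SG_carrier by (auto simp: sym_gen_set_def)
      have "lamp G H (inv\<^bsub>G\<^esub> g) \<otimes>\<^bsub>W\<^esub> lamp G H g = \<one>\<^bsub>W\<^esub>"
        using g e eu lamp_mult[of "e(\<one>\<^bsub>H\<^esub> := inv\<^bsub>G\<^esub> g)" "\<one>\<^bsub>H\<^esub>" g]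
        by (simp add: lamp0[of "inv\<^bsub>G\<^esub> g"] one configs_upd)
      then have "inv\<^bsub>W\<^esub> s = lamp G H (inv\<^bsub>G\<^esub> g)"
        using 1 g lamp_carrier W.inv_equality by auto
      then show ?thesis using g by (auto simp: wreath_gens_def)
    next
      case 2
      then have h: "h \<in> carrier H" "inv\<^bsub>H\<^esub> h \<in> SH" using SH SH_carrier by (auto simp: sym_gen_set_def)
      have "move G H (inv\<^bsub>H\<^esub> h) \<otimes>\<^bsub>W\<^esub> move G H h = \<one>\<^bsub>W\<^esub>"
        using h e move_mult[of e "inv\<^bsub>H\<^esub> h" h] by (simp add: move0[of "inv\<^bsub>H\<^esub> h"] one)
      then have "inv\<^bsub>W\<^esub> s = move G H (inv\<^bsub>H\<^esub> h)"
        using 2 h move_carrier W.inv_equality by auto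
      then show ?thesis using h by (auto simp: wreath_gens_def)
    qed
  qed
  moreover have "finite T" using SG SH by (simp add: wreath_gens_def sym_gen_set_def)
  ultimately show ?thesis using T_carrier unfolding sym_gen_set_def by blast
qed

text \<open>
  The lighter first makes the round trip, correcting all lamps, and then goes to its final
  position.
\<close>

lemma word_dist_wreath_le:
  assumes f: "f \<in> configs" and g: "g \<in> configs" and x: "x \<in> carrier H" and y: "y \<in> carrier H"
    and tour: "closed_tour H SH x (diff_set f g) n"
  shows "word_dist W T (f, x) (g, y)
    \<le> n + word_dist H SH x y + (\<Sum>z\<in>diff_set f g. word_dist G SG (f z) (g z))"
proof -
  obtain ws where ws: "set ws \<subseteq> SH" "length ws \<le> n" "word_prod H ws = \<one>\<^bsub>H\<^esub>"
    "diff_set f g \<subseteq> visited H x ws"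
    using tour unfolding closed_tour_def by auto
  obtain vs where vs: "set vs \<subseteq> SH" "length vs = word_dist H SH x y" "x \<otimes>\<^bsub>H\<^esub> word_prod H vs = y"
    using H.word_dist_witness[OF SH x y] by blast
  have carr: "set ws \<subseteq> carrier H" "set vs \<subseteq> carrier H" using ws vs SH_carrier by auto
  have "diff_set f g \<subseteq> visited H x (ws @ vs)"
    using ws carr x by (subst H.visited_append) auto
  then obtain us where us: "set us \<subseteq> T"
    "length us \<le> length (ws @ vs) + (\<Sum>z\<in>diff_set f g. word_dist G SG (f z) (g z))"
    "(f, x) \<otimes>\<^bsub>W\<^esub> word_prod W us = (g, x \<otimes>\<^bsub>H\<^esub> word_prod H (ws @ vs))"
    using word_along_path[OF f g x, of "ws @ vs"] ws vs by auto
  have "(g, y) = (f, x) \<otimes>\<^bsub>W\<^esub> word_prod W us"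
    using us(3) ws vs carr by (simp add: H.word_prod_append)
  then have "word_dist W T (f, x) (g, y) \<le> length us"
    using W.word_dist_word_le[OF us(1) T_carrier, of "(f, x)" "(g, y)"] f x carrier_W by auto
  then show ?thesis using us ws vs by simp
qed

text \<open>Each generator changes at most one lamp.\<close>

lemma card_diff_set_le_word_dist:
  assumes f: "f \<in> configs" and g: "g \<in> configs" and x: "x \<in> carrier H" and y: "y \<in> carrier H"
  shows "card (diff_set f g) \<le> word_dist W T (f, x) (g, y)"
proof -
  have *: "card (diff_set f h) \<le> length us \<and> h \<in> configs"
    if "set us \<subseteq> T" "f \<in> configs" "x \<in> carrier H" "(f, x) \<otimes>\<^bsub>W\<^esub> word_prod W us = (h, z)" for f x us h z
    using that
  proof (induction us arbitrary: f x)
    case Nil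
    then show ?case using carrier_W by (auto simp: diff_set_def)
  next
    case (Cons s us)
    have carr: "s \<in> carrier W" "set us \<subseteq> carrier W" "(f, x) \<in> carrier W"
      using Cons.prems T_carrier carrier_W by auto
    obtain f' x' where f'x': "(f, x) \<otimes>\<^bsub>W\<^esub> s = (f', x')" by (metis surj_pair)
    then have "(f', x') \<in> carrier W" using carr by (metis W.m_closed)
    then have f': "f' \<in> configs" "x' \<in> carrier H" using carrier_W by auto
    have "s \<in> T" using Cons.prems by simp
    then have sub: "diff_set f f' \<subseteq> {x}"
      using Cons.prems(2,3) by (cases rule: T_cases) (auto simp: f'x' diff_set_def)
    have "(f', x') \<otimes>\<^bsub>W\<^esub> word_prod W us = (h, z)"
      using Cons.prems(4) carr f'x' by (simp flip: W.m_assoc)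
    then have IH: "card (diff_set f' h) \<le> length us" "h \<in> configs"
      using Cons.IH[of f' x'] f' Cons.prems by auto
    have "diff_set f h \<subseteq> insert x (diff_set f' h)" using sub by (auto simp: diff_set_def)
    then have "card (diff_set f h) \<le> card (insert x (diff_set f' h))"
      using finite_diff_set f' IH by (intro card_mono) auto
    also have "\<dots> \<le> Suc (card (diff_set f' h))"
      using finite_diff_set f' IH by (simp add: card_insert_if)
    finally show ?case using IH by simp
  qed
  obtain us where "set us \<subseteq> T" "length us = word_dist W T (f, x) (g, y)"
    "(f, x) \<otimes>\<^bsub>W\<^esub> word_prod W us = (g, y)"
    using W.word_dist_witness[OF sym_gen_set_T, of "(f, x)" "(g, y)"] assms carrier_W by auto
  then show ?thesis using *[of us f x g y] f x by auto
qed

end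

section \<open>Balls that are well separated from their boundary\<close>

text \<open>Both summands \<open>u\<close> satisfy \<open>u powr p \<le> u * (x + y) powr (p - 1)\<close>.\<close>

lemma powr_superadditive:
  fixes x y p :: real
  assumes p: "1 \<le> p" and "0 \<le> x" "0 \<le> y"
  shows "x powr p + y powr p \<le> (x + y) powr p"
proof (cases "x + y = 0")
  case True
  then show ?thesis using assms by (simp add: add_nonneg_eq_0_iff)
next
  case False
  define s where "s = x + y"
  have s: "s > 0" using False assms by (simp add: s_def)
  have *: "u powr p \<le> u * s powr (p - 1)" if "0 \<le> u" "u \<le> s" for u
  proof (cases "u = 0")
    case False
    then have "u powr p = u * u powr (p - 1)" using that by (simp add: powr_diff)
    also have "\<dots> \<le> u * s powr (p - 1)" using that p by (intro mult_left_mono powr_mono2) auto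
    finally show ?thesis .
  qed (use p in simp)
  have "x powr p + y powr p \<le> x * s powr (p - 1) + y * s powr (p - 1)"
    using assms by (intro add_mono *) (auto simp: s_def)
  also have "\<dots> = s * s powr (p - 1)" by (simp add: s_def algebra_simps)
  also have "\<dots> = s powr p" using s by (simp add: powr_diff)
  finally show ?thesis by (simp add: s_def)
qed

lemma powr_subadditive:
  fixes x y a :: real
  assumes a: "0 \<le> a" "a \<le> 1" and "0 \<le> x" "0 \<le> y"
  shows "(x + y) powr a \<le> x powr a + y powr a"
proof (cases "a = 0 \<or> x + y = 0")
  case True
  then show ?thesis using assms by (auto simp: add_nonneg_eq_0_iff)
next
  case False
  then have "a > 0" "x + y > 0" using assms by auto
  have "x + y \<le> (x powr a + y powr a) powr (1 / a)"
    using powr_superadditive[of "1 / a" "x powr a" "y powr a"] assms \<open>a > 0\<close>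
    by (simp add: powr_powr)
  then have "(x + y) powr a \<le> ((x powr a + y powr a) powr (1 / a)) powr a"
    using assms by (intro powr_mono2) auto
  then show ?thesis using \<open>a > 0\<close> by (simp add: powr_powr)
qed

lemma powr_sum_subadditive:
  fixes x :: "'i \<Rightarrow> real"
  assumes "0 \<le> a" "a \<le> 1" "finite A" "\<And>i. i \<in> A \<Longrightarrow> 0 \<le> x i"
  shows "(\<Sum>i\<in>A. x i) powr a \<le> (\<Sum>i\<in>A. x i powr a)"
  using assms(3,4)
proof (induction A rule: finite_induct)
  case (insert i A)
  then have "(x i + (\<Sum>i\<in>A. x i)) powr a \<le> x i powr a + (\<Sum>i\<in>A. x i) powr a"
    using assms by (intro powr_subadditive) (auto intro: sum_nonneg)
  then show ?case using insert by fastforce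
qed simp

text \<open>
  The root of order \<open>p\<close> of a Lipschitz function has increments whose \<open>p\<close>-th power is again
  linear. This is how an estimate in \<open>L\<^sub>1\<close> becomes one in \<open>L\<^sub>p\<close> with exponents divided by \<open>p\<close>.
\<close>

lemma powr_inverse_diff:
  fixes u v p :: real
  assumes p: "1 \<le> p" and "0 \<le> u" "0 \<le> v"
  shows "\<bar>u powr (1 / p) - v powr (1 / p)\<bar> powr p \<le> \<bar>u - v\<bar>"
proof -
  have *: "\<bar>u powr (1 / p) - v powr (1 / p)\<bar> powr p \<le> \<bar>u - v\<bar>" if "0 \<le> v" "v \<le> u" for u v
  proof -
    have "v powr (1 / p) \<le> u powr (1 / p)" using that p by (intro powr_mono2) auto
    then have "(u powr (1 / p) - v powr (1 / p)) powr p + (v powr (1 / p)) powr p \<le> (u powr (1 / p)) powr p"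
      using powr_superadditive[OF p, of "u powr (1 / p) - v powr (1 / p)" "v powr (1 / p)"] by simp
    moreover have "(u powr (1 / p)) powr p = u" "(v powr (1 / p)) powr p = v"
      using that p by (auto simp: powr_powr)
    ultimately show ?thesis using \<open>v powr (1 / p) \<le> u powr (1 / p)\<close> that by simp
  qed
  show ?thesis using *[of v u] *[of u v] assms
    by (cases "v \<le> u") (auto simp: abs_minus_commute)
qed

context group
begin

lemma card_word_ball_pos:
  assumes S: "sym_gen_set G S" and "0 \<le> r"
  shows "1 \<le> card (word_ball G S r)"
proof -
  have "\<one> \<in> word_ball G S r" using assms by (simp add: word_ball_def)
  then show ?thesis using finite_word_ball[OF S, of r] by (simp add: Suc_le_eq card_gt_0_iff) blast
qed

lemma card_word_ball_mono:
  assumes S: "sym_gen_set G S" and "r \<le> s"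
  shows "card (word_ball G S r) \<le> card (word_ball G S s)"
  using assms by (intro card_mono finite_word_ball[OF S]) (auto simp: word_ball_def)

lemma translated_ball:
  assumes "x \<in> carrier G"
  shows "{y \<in> carrier G. real (word_dist G S x y) \<le> r} = (\<lambda>y. x \<otimes> y) ` word_ball G S r"
proof safe
  fix y assume y: "y \<in> carrier G" "real (word_dist G S x y) \<le> r"
  then have "y = x \<otimes> (inv x \<otimes> y)" "inv x \<otimes> y \<in> word_ball G S r"
    using assms by (auto simp: word_ball_eq word_dist_def simp flip: m_assoc)
  then show "y \<in> (\<lambda>y. x \<otimes> y) ` word_ball G S r" by blast
next
  fix y assume "y \<in> word_ball G S r"
  then show "x \<otimes> y \<in> carrier G" "real (word_dist G S x (x \<otimes> y)) \<le> r"
    using assms by (auto simp: word_ball_eq word_dist_def simp flip: m_assoc)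
qed

lemma card_translated_ball:
  assumes "x \<in> carrier G"
  shows "card {y \<in> carrier G. real (word_dist G S x y) \<le> r} = card (word_ball G S r)"
  unfolding translated_ball[OF assms]
  using assms by (intro card_image inj_onI) (auto simp: word_ball_def)

lemma finite_translated_ball:
  assumes "sym_gen_set G S" "x \<in> carrier G"
  shows "finite {y \<in> carrier G. real (word_dist G S x y) \<le> r}"
  unfolding translated_ball[OF assms(2)] using finite_word_ball[OF assms(1)] by blast

lemma countable_carrier:
  assumes S: "sym_gen_set G S"
  shows "countable (carrier G)"
proof -
  have "carrier G \<subseteq> word_prod G ` lists S" using word_exists[OF S] by (force simp: lists_eq_set)
  moreover have "countable (lists S)" using S by (intro countable_lists countable_finite) (simp add: sym_gen_set_def)
  ultimately show ?thesis by (meson countable_image countable_subset)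
qed

text \<open>
  Between \<open>2 ^ k / 8\<close> and twice that radius there are \<open>k + 1\<close> steps of equal width. If the ball
  grew by more than the factor \<open>M\<close> at every step, its size would reach \<open>M ^ (k + 1)\<close>, while the
  growth bound \<open>C * r powr d\<close> keeps it below \<open>(max 1 C * 2 powr max d 0) ^ (k + 1)\<close>. So for \<open>M\<close>
  larger than this base one of the radii has the required property, whatever \<open>k\<close> is.
\<close>

lemma polynomial_growth_radii:
  assumes S: "sym_gen_set G S" and poly: "polynomial_growth G"
  obtains M :: real and r :: "nat \<Rightarrow> real" where "M > 0"
    "\<And>k. 2 ^ k / 8 \<le> r k" "\<And>k. r k \<le> 2 ^ k / 4"
    "\<And>k. real (card (word_ball G S (r k + 2 ^ k / 8 / real (k + 1)))) \<le> M * real (card (word_ball G S (r k)))"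
proof -
  define V where "V r = real (card (word_ball G S r))" for r
  obtain C d :: real where Cd: "\<And>r. r \<ge> 1 \<Longrightarrow> V r \<le> C * r powr d"
    using poly polynomial_growth_iff[OF S] by (auto simp: V_def)
  have V1: "V r \<ge> 1" if "r \<ge> 0" for r using card_word_ball_pos[OF S that] by (simp add: V_def)
  define M where "M = 1 + max 1 C * 2 powr max d 0"
  have M: "M > 1" by (simp add: M_def)
  have "\<exists>r. 2 ^ k / 8 \<le> r \<and> r \<le> 2 ^ k / 4 \<and> V (r + 2 ^ k / 8 / real (k + 1)) \<le> M * V r" for k
  proof (rule ccontr)
    assume contr: "\<not> ?thesis"
    define R where "R = (2::real) ^ k / 8"
    define a where "a m = R + real m * (R / real (k + 1))" for m
    have R: "R > 0" by (simp add: R_def)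
    have grow: "V (a (Suc m)) > M * V (a m)" if "m \<le> k" for m
    proof -
      have "real m * (R / real (k + 1)) \<le> real (k + 1) * (R / real (k + 1))"
        using that R by (intro mult_right_mono) auto
      also have "\<dots> = R" by simp
      finally have "a m \<le> 2 * R" unfolding a_def by linarith
      then have "a m \<le> 2 ^ k / 4" by (simp add: R_def)
      moreover have "R \<le> a m" using R by (simp add: a_def)
      moreover have "a (Suc m) = a m + 2 ^ k / 8 / real (k + 1)"
        by (simp add: a_def R_def algebra_simps add_divide_distrib)
      ultimately show ?thesis using contr unfolding R_def by (metis not_le)
    qed
    have pow: "V (a m) \<ge> M ^ m" if "m \<le> k + 1" for m
      using that
    proof (induction m)
      case 0
      then show ?case using V1[of "a 0"] R by (simp add: a_def)
    next
      case (Suc m)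
      then have "M * M ^ m \<le> M * V (a m)" using M by (intro mult_left_mono) auto
      then show ?case using grow[of m] Suc by simp
    qed
    have "real (k + 1) * (R / real (k + 1)) = R" by simp
    then have "a (k + 1) = 2 * R" unfolding a_def by linarith
    also have "\<dots> = 2 ^ k / 4" by (simp add: R_def)
    finally have a_end: "a (k + 1) = 2 ^ k / 4" .
    have "M ^ (k + 1) \<le> V (a (k + 1))" by (rule pow) simp
    then have "M ^ (k + 1) \<le> V (2 ^ k / 4)" unfolding a_end .
    also have "\<dots> \<le> V (2 ^ (k + 1))"
      unfolding V_def using card_word_ball_mono[OF S] by simp
    also have "\<dots> \<le> C * (2 ^ (k + 1)) powr d"
      by (intro Cd one_le_power) auto
    also have "\<dots> \<le> max 1 C ^ (k + 1) * (2 ^ (k + 1)) powr max d 0"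
    proof (intro mult_mono powr_mono)
      have "C \<le> max 1 C ^ 1" by simp
      also have "\<dots> \<le> max 1 C ^ (k + 1)" by (intro power_increasing) auto
      finally show "C \<le> max 1 C ^ (k + 1)" .
    qed (auto simp: one_le_power[of 2 "Suc k", simplified])
    also have "\<dots> = (M - 1) ^ (k + 1)"
      by (simp add: M_def power_mult_distrib powr_realpow[symmetric] powr_powr mult.commute add.commute del: power_Suc)
    also have "\<dots> < M ^ (k + 1)" using M by (intro power_strict_mono) auto
    finally show False by simp
  qed
  then obtain r where "\<And>k. 2 ^ k / 8 \<le> r k \<and> r k \<le> 2 ^ k / 4 \<and> V (r k + 2 ^ k / 8 / real (k + 1)) \<le> M * V (r k)"
    by metis
  then show ?thesis using M by (intro that[of M r]) (auto simp: V_def)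
qed

end

context wreath
begin

definition local_ball :: "'b \<Rightarrow> real \<Rightarrow> 'b set" where
  "local_ball x r = {y \<in> carrier H. real (word_dist H SH x y) \<le> r}"

text \<open>
  Seen from a walker at \<open>x\<close>: zero while the walker is inside the ball of radius \<open>r\<close> around \<open>y\<close>,
  growing with slope one outside, and constantly \<open>\<tau>\<close> from distance \<open>r + \<tau>\<close> on.
\<close>

definition cutoff :: "real \<Rightarrow> real \<Rightarrow> 'b \<Rightarrow> 'b \<Rightarrow> real" where
  "cutoff \<tau> r y x = min \<tau> (max 0 (real (word_dist H SH x y) - r))"

lemma finite_local_ball: "x \<in> carrier H \<Longrightarrow> finite (local_ball x r)"
  unfolding local_ball_def by (rule H.finite_translated_ball[OF SH])

lemma card_local_ball: "x \<in> carrier H \<Longrightarrow> card (local_ball x r) = card (word_ball H SH r)"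
  unfolding local_ball_def by (rule H.card_translated_ball)

lemma cutoff_nonneg: "0 \<le> \<tau> \<Longrightarrow> 0 \<le> cutoff \<tau> r y x"
  by (simp add: cutoff_def)

lemma cutoff_eq_0: "real (word_dist H SH x y) \<le> r \<Longrightarrow> 0 \<le> \<tau> \<Longrightarrow> cutoff \<tau> r y x = 0"
  by (simp add: cutoff_def)

lemma cutoff_eq: "r + \<tau> \<le> real (word_dist H SH x y) \<Longrightarrow> 0 \<le> \<tau> \<Longrightarrow> cutoff \<tau> r y x = \<tau>"
  by (simp add: cutoff_def)

text \<open>
  A step changes each cutoff by at most one, and only the cutoffs centred within \<open>r + \<tau>\<close> of the
  old or the new position change at all.
\<close>

lemma sum_cutoff_diff_le:
  assumes x: "x \<in> carrier H" and s: "s \<in> SH" and Y: "finite Y" "Y \<subseteq> carrier H" and \<tau>: "0 \<le> \<tau>"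
  shows "(\<Sum>y\<in>Y. \<bar>cutoff \<tau> r y x - cutoff \<tau> r y (x \<otimes>\<^bsub>H\<^esub> s)\<bar>) \<le> 2 * real (card (word_ball H SH (r + \<tau>)))"
proof -
  let ?x = "x \<otimes>\<^bsub>H\<^esub> s"
  have s': "s \<in> carrier H" "?x \<in> carrier H" using s x SH_carrier by auto
  have le: "\<bar>cutoff \<tau> r y x - cutoff \<tau> r y ?x\<bar> \<le> 1" if "y \<in> carrier H" for y
  proof -
    have "word_dist H SH x ?x \<le> 1" using H.word_dist_generator_le[OF SH x s] .
    moreover have "word_dist H SH x y \<le> word_dist H SH x ?x + word_dist H SH ?x y"
      by (intro H.word_dist_triangle[OF SH] x s' that)
    moreover have "word_dist H SH ?x y \<le> word_dist H SH ?x x + word_dist H SH x y"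
      by (intro H.word_dist_triangle[OF SH] x s' that)
    moreover have "word_dist H SH ?x x = word_dist H SH x ?x" by (intro H.word_dist_commute[OF SH] x s')
    ultimately have "\<bar>real (word_dist H SH x y) - real (word_dist H SH ?x y)\<bar> \<le> 1" by linarith
    then show ?thesis unfolding cutoff_def by (auto simp: min_def max_def)
  qed
  let ?B = "local_ball x (r + \<tau>) \<union> local_ball ?x (r + \<tau>)"
  have fin: "finite ?B" using finite_local_ball x s' by auto
  have "(\<Sum>y\<in>Y. \<bar>cutoff \<tau> r y x - cutoff \<tau> r y ?x\<bar>) = (\<Sum>y\<in>Y \<inter> ?B. \<bar>cutoff \<tau> r y x - cutoff \<tau> r y ?x\<bar>)"
  proof -
    have far: "cutoff \<tau> r y x' = \<tau>" if "y \<in> carrier H" "y \<notin> local_ball x' (r + \<tau>)" for y x'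
      using that \<tau> by (intro cutoff_eq) (auto simp: local_ball_def)
    have "cutoff \<tau> r y x - cutoff \<tau> r y ?x = 0" if "y \<in> Y - Y \<inter> ?B" for y
      using that Y far[of y x] far[of y ?x] by auto
    then show ?thesis using Y by (intro sum.mono_neutral_right) auto
  qed
  also have "\<dots> \<le> (\<Sum>y\<in>Y \<inter> ?B. 1)" using Y le by (intro sum_mono) auto
  also have "\<dots> = real (card (Y \<inter> ?B))" by simp
  also have "card (Y \<inter> ?B) \<le> card ?B" using fin by (intro card_mono) auto
  also have "card ?B \<le> card (local_ball x (r + \<tau>)) + card (local_ball ?x (r + \<tau>))" by (rule card_Un_le)
  finally show ?thesis using x s' by (simp add: card_local_ball)
qed

end

section \<open>The window embedding of a wreath product\<close>

context wreath
begin

lemma countable_configs: "countable configs"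
proof -
  have "configs = fst ` carrier W" using carrier_W H.one_closed by force
  then show ?thesis using W.countable_carrier[OF sym_gen_set_T] by (metis countable_image)
qed

text \<open>
  The coordinate with index \<open>(k, y, h)\<close> is active if the lamps in the window around \<open>y\<close> form the
  pattern \<open>h\<close>. For two different patterns the coordinates are thus disjointly supported, as for
  basis vectors of \<open>\<ell>\<^sub>p\<close>. The factor \<open>c k\<close> weighs the scale.
\<close>

definition window_coord :: "real \<Rightarrow> (nat \<Rightarrow> real) \<Rightarrow> (nat \<Rightarrow> real) \<Rightarrow> (nat \<Rightarrow> real) \<Rightarrow>
    nat \<times> 'b \<times> ('b \<Rightarrow> 'a) \<Rightarrow> ('b \<Rightarrow> 'a) \<times> 'b \<Rightarrow> real" where
  "window_coord p c r \<tau> = (\<lambda>(k, y, h) (f, x).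
     if restrict f (local_ball y (r k)) = h then (c k * cutoff (\<tau> k) (r k) y x) powr (1 / p) else 0)"

definition window_index :: "(nat \<Rightarrow> real) \<Rightarrow> (nat \<times> 'b \<times> ('b \<Rightarrow> 'a)) set" where
  "window_index r = (SIGMA k:UNIV. SIGMA y:carrier H. (\<lambda>f. restrict f (local_ball y (r k))) ` configs)"

lemma countable_window_index: "countable (window_index r)"
  unfolding window_index_def using countable_configs H.countable_carrier[OF SH]
  by (intro countable_SIGMA) auto

text \<open>
  A lamp can be changed only where the walker stands, and the cutoff of every window containing
  the walker vanishes.
\<close>

lemma window_coord_lamp:
  assumes p: "1 \<le> p" and \<tau>: "\<And>k. 0 \<le> \<tau> k" and x: "x \<in> carrier H" and t: "t \<in> window_index r"
  shows "window_coord p c r \<tau> t (f(x := a), x) = window_coord p c r \<tau> t (f, x)"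
proof -
  obtain k y h where t: "t = (k, y, h)" and y: "y \<in> carrier H"
    using t by (auto simp: window_index_def)
  show ?thesis
  proof (cases "x \<in> local_ball y (r k)")
    case True
    then have "cutoff (\<tau> k) (r k) y x = 0"
      using x y \<tau> H.word_dist_commute[OF SH x y] by (intro cutoff_eq_0) (auto simp: local_ball_def)
    then show ?thesis using p by (simp add: t window_coord_def)
  next
    case False
    then have "restrict (f(x := a)) (local_ball y (r k)) = restrict f (local_ball y (r k))"
      by (auto simp: restrict_def fun_eq_iff)
    then show ?thesis by (simp add: t window_coord_def)
  qed
qed

text \<open>
  For given \<open>k\<close> and \<open>y\<close> only the current pattern contributes, so the sum over patterns collapses
  and the change of the cutoffs remains.
\<close>

lemma window_coord_move:
  assumes p: "1 \<le> p" and c: "\<And>k. 0 \<le> c k" and \<tau>: "\<And>k. 0 \<le> \<tau> k"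
    and x: "x \<in> carrier H" and s: "s \<in> SH" and J: "finite J" "J \<subseteq> window_index r"
    and summ: "summable (\<lambda>k. c k * (2 * real (card (word_ball H SH (r k + \<tau> k)))))"
  shows "(\<Sum>t\<in>J. \<bar>window_coord p c r \<tau> t (f, x) - window_coord p c r \<tau> t (f, x \<otimes>\<^bsub>H\<^esub> s)\<bar> powr p)
     \<le> suminf (\<lambda>k. c k * (2 * real (card (word_ball H SH (r k + \<tau> k)))))"
proof -
  let ?x = "x \<otimes>\<^bsub>H\<^esub> s"
  define e where "e = (\<lambda>(k, y). c k * \<bar>cutoff (\<tau> k) (r k) y x - cutoff (\<tau> k) (r k) y ?x\<bar>)"
  define J' where "J' = {(k, y, h) \<in> J. restrict f (local_ball y (r k)) = h}"
  define \<pi> :: "nat \<times> 'b \<times> ('b \<Rightarrow> 'a) \<Rightarrow> nat \<times> 'b" where "\<pi> = (\<lambda>(k, y, h). (k, y))"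
  have fin': "finite J'" using J by (intro finite_subset[of J' J]) (auto simp: J'_def)
  have e0: "0 \<le> e q" for q using c by (cases q) (simp add: e_def)
  have "(\<Sum>t\<in>J. \<bar>window_coord p c r \<tau> t (f, x) - window_coord p c r \<tau> t (f, ?x)\<bar> powr p)
      = (\<Sum>t\<in>J'. \<bar>window_coord p c r \<tau> t (f, x) - window_coord p c r \<tau> t (f, ?x)\<bar> powr p)"
    using J by (intro sum.mono_neutral_right) (auto simp: J'_def window_coord_def split: if_splits)
  also have "\<dots> \<le> (\<Sum>t\<in>J'. e (\<pi> t))"
  proof (rule sum_mono)
    fix t assume "t \<in> J'"
    then obtain k y h where t: "t = (k, y, h)" "restrict f (local_ball y (r k)) = h"
      by (auto simp: J'_def)
    have "\<bar>(c k * cutoff (\<tau> k) (r k) y x) powr (1 / p) - (c k * cutoff (\<tau> k) (r k) y ?x) powr (1 / p)\<bar> powr p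
        \<le> \<bar>c k * cutoff (\<tau> k) (r k) y x - c k * cutoff (\<tau> k) (r k) y ?x\<bar>"
      using c \<tau> by (intro powr_inverse_diff[OF p] mult_nonneg_nonneg cutoff_nonneg)
    also have "\<dots> = e (\<pi> t)"
      using c[of k] by (simp add: t e_def \<pi>_def abs_mult flip: right_diff_distrib)
    finally show "\<bar>window_coord p c r \<tau> t (f, x) - window_coord p c r \<tau> t (f, ?x)\<bar> powr p \<le> e (\<pi> t)"
      using t by (simp add: window_coord_def)
  qed
  also have "\<dots> = (\<Sum>q\<in>\<pi> ` J'. e q)"
    by (subst sum.reindex) (auto simp: inj_on_def \<pi>_def J'_def)
  also have "\<dots> \<le> (\<Sum>q\<in>{..Max (insert 0 (fst ` \<pi> ` J'))} \<times> snd ` \<pi> ` J'. e q)"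
    using fin' e0 by (intro sum_mono2) (auto intro!: Max_ge image_eqI simp: \<pi>_def)
  also have "\<dots> = (\<Sum>k\<le>Max (insert 0 (fst ` \<pi> ` J')). c k * (\<Sum>y\<in>snd ` \<pi> ` J'. \<bar>cutoff (\<tau> k) (r k) y x - cutoff (\<tau> k) (r k) y ?x\<bar>))"
    by (simp add: sum.cartesian_product[symmetric] e_def sum_distrib_left)
  also have "\<dots> \<le> (\<Sum>k\<le>Max (insert 0 (fst ` \<pi> ` J')). c k * (2 * real (card (word_ball H SH (r k + \<tau> k)))))"
    using c \<tau> fin' J(2)
    by (intro sum_mono mult_left_mono sum_cutoff_diff_le x s) (auto simp: J'_def \<pi>_def window_index_def)
  also have "\<dots> \<le> suminf (\<lambda>k. c k * (2 * real (card (word_ball H SH (r k + \<tau> k)))))"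
    using summ c by (intro sum_le_suminf) auto
  finally show ?thesis .
qed

text \<open>
  The lower bounds on the \<open>p\<close>-th power of the distance of two images from which the word metric
  is recovered later: by the lamps, by the distance of the walkers, and by separated sets \<open>Z\<close> of
  differing lamps away from the first walker. At scale \<open>2 ^ k\<close> each point counts
  \<open>2 powr (\<theta> * k)\<close>; the exponent \<open>\<theta> < 1\<close> is the price for summing over all scales. The smallest
  scale is below one, so that it sees every differing lamp but the one under the walker, and
  every change of position.
\<close>

definition detects_travel ::
    "real \<Rightarrow> real \<Rightarrow> ('a \<Rightarrow> real \<Rightarrow> real) \<Rightarrow> (('b \<Rightarrow> 'a) \<times> 'b \<Rightarrow> real \<Rightarrow> real) \<Rightarrow> bool" where
  "detects_travel p \<theta> \<phi> F \<longleftrightarrow>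
    (\<forall>f\<in>configs. \<forall>g\<in>configs. \<forall>x\<in>carrier H. \<forall>y\<in>carrier H.
       (\<Sum>z\<in>diff_set f g. Lp_dist p (\<phi> (f z)) (\<phi> (g z)) powr p) \<le> Lp_dist p (F (f, x)) (F (g, y)) powr p \<and>
       (\<forall>k::nat. 5 * 2 ^ k / 8 < real (word_dist H SH x y) \<longrightarrow>
          2 powr (\<theta> * real k) / 8 \<le> Lp_dist p (F (f, x)) (F (g, y)) powr p) \<and>
       (\<forall>(k::nat) Z. Z \<subseteq> diff_set f g \<and> (\<forall>z\<in>Z. 5 * 2 ^ k / 8 < real (word_dist H SH x z)) \<and>
          (\<forall>z\<in>Z. \<forall>z'\<in>Z. z \<noteq> z' \<longrightarrow> 2 ^ k / 2 < real (word_dist H SH z z')) \<longrightarrow>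
          real (card Z) * 2 powr (\<theta> * real k) / 8 \<le> Lp_dist p (F (f, x)) (F (g, y)) powr p))"

text \<open>
  There is a window around every point; the factor \<open>1 / V k\<close> turns sums over the windows near a
  point into averages. One generator changes the coordinates of scale \<open>k\<close> by at most
  \<open>2 * M * (k + 1) * 2 powr ((\<theta> - 1) * k)\<close> in total, which is summable over \<open>k\<close>. Conversely a
  differing lamp at \<open>z\<close> is seen by every window centred in the ball around \<open>z\<close>; these balls are
  disjoint for separated points, and each contributes \<open>2 powr (\<theta> * k) / 8\<close> if the walker is far
  enough for the cutoff to be saturated.
\<close>

lemma wreath_embedding:
  assumes p: "1 \<le> p" and \<theta>: "0 < \<theta>" "\<theta> < 1" and poly: "polynomial_growth H"
    and \<phi>: "\<phi> \<in> carrier G \<rightarrow> Lp_space p"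
    and L: "\<And>a b. a \<in> carrier G \<Longrightarrow> b \<in> carrier G \<Longrightarrow> Lp_dist p (\<phi> a) (\<phi> b) \<le> L * real (word_dist G SG a b)"
  shows "\<exists>F K. F \<in> carrier W \<rightarrow> Lp_space p \<and>
    (\<forall>w\<in>carrier W. \<forall>v\<in>carrier W. Lp_dist p (F w) (F v) \<le> K * real (word_dist W T w v)) \<and>
    detects_travel p \<theta> \<phi> F"
proof -
  obtain M r where M: "M > 0" and r: "\<And>k. 2 ^ k / 8 \<le> r k" "\<And>k. r k \<le> 2 ^ k / 4"
    and doubling: "\<And>k. real (card (word_ball H SH (r k + 2 ^ k / 8 / real (k + 1)))) \<le> M * real (card (word_ball H SH (r k)))"
    using H.polynomial_growth_radii[OF SH poly] by metis
  \<comment> \<open>The width of the cutoff must fit into the gap provided by the choice of radii. The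
    factor lost by its being smaller than the scale is returned in \<open>c\<close>.\<close>
  define \<tau> where "\<tau> k = (2::real) ^ k / 8 / real (k + 1)" for k
  define V where "V k = real (card (word_ball H SH (r k)))" for k
  define c where "c k = real (k + 1) * (2 powr (\<theta> - 1)) ^ k / V k" for k
  have p0: "p > 0" using p by simp
  have \<tau>0: "0 \<le> \<tau> k" for k by (simp add: \<tau>_def)
  have \<tau>1: "\<tau> k \<le> 2 ^ k / 8" for k
    by (simp add: \<tau>_def divide_simps)
  have r0: "0 \<le> r k" for k using r(1)[of k] by (rule order_trans[rotated]) simp
  have V1: "1 \<le> V k" for k using H.card_word_ball_pos[OF SH r0[of k]] by (simp add: V_def)
  have c0: "0 \<le> c k" for k using V1[of k] by (simp add: c_def)
  have pow: "(2 powr (\<theta> - 1)) ^ k * 2 ^ k = 2 powr (\<theta> * real k)" for k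
  proof -
    have "(2 powr (\<theta> - 1)) ^ k * 2 ^ k = 2 powr ((\<theta> - 1) * real k) * 2 powr real k"
      by (simp add: powr_realpow powr_powr[symmetric])
    also have "\<dots> = 2 powr (\<theta> * real k)" by (simp add: powr_add[symmetric] algebra_simps)
    finally show ?thesis .
  qed
  have cV: "V k * (c k * \<tau> k) = 2 powr (\<theta> * real k) / 8" for k
  proof -
    define n where "n = real (k + 1)"
    have "n \<noteq> 0" "V k \<noteq> 0" using V1[of k] by (auto simp: n_def)
    moreover have "c k = n * (2 powr (\<theta> - 1)) ^ k / V k" "\<tau> k = 2 ^ k / 8 / n"
      by (simp_all add: c_def \<tau>_def n_def)
    ultimately show ?thesis by (simp only: pow[symmetric]) simp
  qed
  have summ: "summable (\<lambda>k. c k * (2 * real (card (word_ball H SH (r k + \<tau> k)))))"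
  proof (rule summable_comparison_test')
    have "norm (2 powr (\<theta> - 1) :: real) < 1" using \<theta> powr_less_mono[of "\<theta> - 1" 0 2] by simp
    then show "summable (\<lambda>k. (2 * M) * (real (Suc k) * (2 powr (\<theta> - 1)) ^ k))"
      using geometric_deriv_sums[of "2 powr (\<theta> - 1) :: real"] by (intro summable_mult sums_summable)
    fix k :: nat
    have "c k * (2 * real (card (word_ball H SH (r k + \<tau> k)))) \<le> c k * (2 * (M * V k))"
      using doubling[of k] c0[of k] by (intro mult_left_mono) (auto simp: \<tau>_def V_def)
    also have "\<dots> = (2 * M) * (real (Suc k) * (2 powr (\<theta> - 1)) ^ k)"
      using V1[of k] by (simp add: c_def)
    finally show "norm (c k * (2 * real (card (word_ball H SH (r k + \<tau> k))))) \<le> (2 * M) * (real (Suc k) * (2 powr (\<theta> - 1)) ^ k)"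
      using c0[of k] by simp
  qed
  define I where "I = Inl ` window_index r \<union> Inr ` carrier H"
  define E where "E i w = (case i of Inl t \<Rightarrow> (\<lambda>_. window_coord p c r \<tau> t w) | Inr z \<Rightarrow> \<phi> (fst w z))" for i w
  define L0 where "L0 = \<bar>L\<bar> powr p + suminf (\<lambda>k. c k * (2 * real (card (word_ball H SH (r k + \<tau> k)))))"
  have suminf0: "0 \<le> suminf (\<lambda>k. c k * (2 * real (card (word_ball H SH (r k + \<tau> k)))))"
    using summ c0 by (intro suminf_nonneg) auto
  have I: "countable I"
    unfolding I_def using countable_window_index H.countable_carrier[OF SH] by auto
  have E_Lp: "E i w \<in> Lp_space p" if "i \<in> I" "w \<in> carrier W" for i w
    using that \<phi> carrier_W by (auto simp: E_def I_def)
  have split: "(\<Sum>i\<in>J. Lp_dist p (E i w) (E i v) powr p)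
      = (\<Sum>t\<in>Inl -` J. \<bar>window_coord p c r \<tau> t w - window_coord p c r \<tau> t v\<bar> powr p)
        + (\<Sum>z\<in>Inr -` J. Lp_dist p (\<phi> (fst w z)) (\<phi> (fst v z)) powr p)" if "finite J" for J w v
  proof -
    have fin: "finite (Inl -` J)" "finite (Inr -` J)" using that by (auto intro: finite_vimageI)
    let ?h = "\<lambda>i. Lp_dist p (E i w) (E i v) powr p"
    have "J = (Inl ` (Inl -` J)) \<union> (Inr ` (Inr -` J))"
    proof (rule Set.set_eqI)
      show "i \<in> J \<longleftrightarrow> i \<in> (Inl ` (Inl -` J)) \<union> (Inr ` (Inr -` J))" for i by (cases i) auto
    qed
    then have "sum ?h J = sum ?h ((Inl ` (Inl -` J)) \<union> (Inr ` (Inr -` J)))"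
      by (rule arg_cong[where f="sum ?h"])
    also have "\<dots> = sum ?h (Inl ` (Inl -` J)) + sum ?h (Inr ` (Inr -` J))"
      by (rule sum.union_disjoint[OF finite_imageI[OF fin(1)] finite_imageI[OF fin(2)]]) blast
    finally have "sum ?h J = sum ?h (Inl ` (Inl -` J)) + sum ?h (Inr ` (Inr -` J))" .
    then show ?thesis using p0 by (simp only: sum.reindex inj_Inl inj_Inr o_def E_def sum.case Lp_dist_const)
  qed
  have step: "(\<Sum>i\<in>J. Lp_dist p (E i w) (E i (w \<otimes>\<^bsub>W\<^esub> s)) powr p) \<le> L0"
    if J: "finite J" "J \<subseteq> I" and w: "w \<in> carrier W" and s: "s \<in> T" for J w s
  proof -
    obtain f x where fx: "w = (f, x)" and f: "f \<in> configs" and x: "x \<in> carrier H"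
      using w carrier_W by auto
    have Jl: "finite (Inl -` J)" "Inl -` J \<subseteq> window_index r" "finite (Inr -` J)"
      using J by (auto simp: I_def intro: finite_vimageI)
    from s f x show ?thesis
    proof (cases rule: T_cases)
      case (1 g)
      then have g: "g \<in> carrier G" using SG_carrier by auto
      have "(\<Sum>t\<in>Inl -` J. \<bar>window_coord p c r \<tau> t w - window_coord p c r \<tau> t (w \<otimes>\<^bsub>W\<^esub> s)\<bar> powr p) = 0"
        using window_coord_lamp[OF p \<tau>0 x] Jl(2) p by (intro sum.neutral) (auto simp: fx 1)
      moreover have "(\<Sum>z\<in>Inr -` J. Lp_dist p (\<phi> (fst w z)) (\<phi> (fst (w \<otimes>\<^bsub>W\<^esub> s) z)) powr p)
          \<le> (\<Sum>z\<in>{x}. Lp_dist p (\<phi> (fst w z)) (\<phi> (fst (w \<otimes>\<^bsub>W\<^esub> s) z)) powr p)"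
      proof -
        let ?h = "\<lambda>z. Lp_dist p (\<phi> (fst w z)) (\<phi> (fst (w \<otimes>\<^bsub>W\<^esub> s) z)) powr p"
        have "sum ?h (Inr -` J) = sum ?h (Inr -` J \<inter> {x})"
          using Jl p0 by (intro sum.mono_neutral_right) (auto simp: fx 1)
        also have "\<dots> \<le> sum ?h {x}" by (intro sum_mono2) auto
        finally show ?thesis .
      qed
      moreover have "Lp_dist p (\<phi> (f x)) (\<phi> (f x \<otimes>\<^bsub>G\<^esub> g)) powr p \<le> \<bar>L\<bar> powr p"
      proof (intro powr_mono2)
        have "Lp_dist p (\<phi> (f x)) (\<phi> (f x \<otimes>\<^bsub>G\<^esub> g)) \<le> L * real (word_dist G SG (f x) (f x \<otimes>\<^bsub>G\<^esub> g))"
          using f x g by (intro L) auto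
        also have "\<dots> \<le> \<bar>L\<bar> * 1"
          using G.word_dist_generator_le[OF SG, of "f x" g] f x 1 by (intro mult_mono) auto
        finally show "Lp_dist p (\<phi> (f x)) (\<phi> (f x \<otimes>\<^bsub>G\<^esub> g)) \<le> \<bar>L\<bar>" by simp
      qed (use p0 in auto)
      ultimately show ?thesis
        unfolding split[OF J(1)] L0_def using suminf0 by (simp add: fx 1)
    next
      case (2 h)
      have "(\<Sum>t\<in>Inl -` J. \<bar>window_coord p c r \<tau> t w - window_coord p c r \<tau> t (w \<otimes>\<^bsub>W\<^esub> s)\<bar> powr p)
          \<le> suminf (\<lambda>k. c k * (2 * real (card (word_ball H SH (r k + \<tau> k)))))"
        unfolding fx 2(2) by (intro window_coord_move[OF p c0 \<tau>0 x 2(1)] Jl summ)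
      moreover have "(\<Sum>z\<in>Inr -` J. Lp_dist p (\<phi> (fst w z)) (\<phi> (fst (w \<otimes>\<^bsub>W\<^esub> s) z)) powr p) = 0"
        using p0 by (intro sum.neutral) (auto simp: fx 2)
      ultimately show ?thesis unfolding split[OF J(1)] L0_def
        using powr_ge_zero[of "\<bar>L\<bar>" p] by linarith
    qed
  qed
  obtain F where F: "F \<in> carrier W \<rightarrow> Lp_space p"
    "\<And>w v. w \<in> carrier W \<Longrightarrow> v \<in> carrier W \<Longrightarrow> Lp_dist p (F w) (F v) \<le> L0 powr (1 / p) * real (word_dist W T w v)"
    "\<And>w v J. w \<in> carrier W \<Longrightarrow> v \<in> carrier W \<Longrightarrow> finite J \<Longrightarrow> J \<subseteq> I \<Longrightarrow>
       (\<Sum>i\<in>J. Lp_dist p (E i w) (E i v) powr p) \<le> Lp_dist p (F w) (F v) powr p"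
  proof -
    show thesis
      by (rule W.Lp_map_from_coordinates[OF p sym_gen_set_T I E_Lp step]) (assumption | rule that)+
  qed
  have windows: "real (card Y) * (c k * \<tau> k) \<le> Lp_dist p (F w) (F v) powr p"
    if w: "w \<in> carrier W" and v: "v \<in> carrier W" and f: "f \<in> configs" and Y: "finite Y" "Y \<subseteq> carrier H"
      and diff: "\<And>y. y \<in> Y \<Longrightarrow> \<bar>window_coord p c r \<tau> (k, y, restrict f (local_ball y (r k))) w
         - window_coord p c r \<tau> (k, y, restrict f (local_ball y (r k))) v\<bar> powr p = c k * \<tau> k"
    for w v f Y k
  proof -
    define J where "J = (\<lambda>y. Inl (k, y, restrict f (local_ball y (r k))) :: (nat \<times> 'b \<times> ('b \<Rightarrow> 'a)) + 'b) ` Y"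
    have "inj_on (\<lambda>y. Inl (k, y, restrict f (local_ball y (r k))) :: (nat \<times> 'b \<times> ('b \<Rightarrow> 'a)) + 'b) Y"
      by (auto simp: inj_on_def)
    then have "(\<Sum>i\<in>J. Lp_dist p (E i w) (E i v) powr p) = (\<Sum>y\<in>Y. c k * \<tau> k)"
      unfolding J_def using p0 diff by (subst sum.reindex) (auto simp: E_def Lp_dist_const)
    moreover have "finite J" "J \<subseteq> I" using Y f by (auto simp: J_def I_def window_index_def)
    ultimately show ?thesis using F(3)[OF w v, of J] by simp
  qed
  have "detects_travel p \<theta> \<phi> F"
    unfolding detects_travel_def
  proof (intro ballI)
    fix f g x y assume f: "f \<in> configs" and g: "g \<in> configs" and x: "x \<in> carrier H" and y: "y \<in> carrier H"
    have w: "(f, x) \<in> carrier W" "(g, y) \<in> carrier W" using f g x y carrier_W by auto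
    have "(\<Sum>i\<in>Inr ` diff_set f g. Lp_dist p (E i (f, x)) (E i (g, y)) powr p) \<le> Lp_dist p (F (f, x)) (F (g, y)) powr p"
      using finite_diff_set[OF f g] diff_set_carrier[of f g] by (intro F(3) w) (auto simp: I_def)
    then have lamps: "(\<Sum>z\<in>diff_set f g. Lp_dist p (\<phi> (f z)) (\<phi> (g z)) powr p) \<le> Lp_dist p (F (f, x)) (F (g, y)) powr p"
      by (simp add: sum.reindex E_def)
    have pc: "((c k * \<tau> k) powr (1 / p)) powr p = c k * \<tau> k" for k
      using c0[of k] \<tau>0[of k] p0 by (simp add: powr_powr)
    have walker: "2 powr (\<theta> * real k) / 8 \<le> Lp_dist p (F (f, x)) (F (g, y)) powr p"
      if far: "5 * 2 ^ k / 8 < real (word_dist H SH x y)" for k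
    proof -
      have "real (card (local_ball x (r k))) * (c k * \<tau> k) \<le> Lp_dist p (F (f, x)) (F (g, y)) powr p"
      proof (rule windows[OF w g finite_local_ball[OF x]])
        show "local_ball x (r k) \<subseteq> carrier H" by (auto simp: local_ball_def)
        fix u assume u: "u \<in> local_ball x (r k)"
        then have u': "u \<in> carrier H" by (simp add: local_ball_def)
        have "cutoff (\<tau> k) (r k) u x = 0" using u \<tau>0 by (intro cutoff_eq_0) (auto simp: local_ball_def)
        moreover have "cutoff (\<tau> k) (r k) u y = \<tau> k"
        proof (rule cutoff_eq[OF _ \<tau>0])
          have "word_dist H SH x y \<le> word_dist H SH x u + word_dist H SH u y"
            by (intro H.word_dist_triangle[OF SH] x y u')
          moreover have "word_dist H SH u y = word_dist H SH y u" by (intro H.word_dist_commute[OF SH] y u')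
          moreover have "real (word_dist H SH x u) \<le> r k" using u by (simp add: local_ball_def)
          ultimately show "r k + \<tau> k \<le> real (word_dist H SH y u)"
            using far r(2)[of k] \<tau>1[of k] by linarith
        qed
        ultimately show "\<bar>window_coord p c r \<tau> (k, u, restrict g (local_ball u (r k))) (f, x)
           - window_coord p c r \<tau> (k, u, restrict g (local_ball u (r k))) (g, y)\<bar> powr p = c k * \<tau> k"
          using p0 pc by (simp add: window_coord_def)
      qed
      then show ?thesis
        using cV[of k] x by (simp add: card_local_ball V_def)
    qed
    have separated: "real (card Z) * 2 powr (\<theta> * real k) / 8 \<le> Lp_dist p (F (f, x)) (F (g, y)) powr p"
      if Z: "Z \<subseteq> diff_set f g"
        and far: "\<And>z. z \<in> Z \<Longrightarrow> 5 * 2 ^ k / 8 < real (word_dist H SH x z)"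
        and sep: "\<And>z z'. z \<in> Z \<Longrightarrow> z' \<in> Z \<Longrightarrow> z \<noteq> z' \<Longrightarrow> 2 ^ k / 2 < real (word_dist H SH z z')"
      for k Z
    proof -
      have Zc: "Z \<subseteq> carrier H" using Z diff_set_carrier by blast
      have finZ: "finite Z" using Z finite_diff_set[OF f g] finite_subset by blast
      define Y where "Y = (\<Union>z\<in>Z. local_ball z (r k))"
      have "card Y = (\<Sum>z\<in>Z. card (local_ball z (r k)))"
        unfolding Y_def
      proof (rule card_UN_disjoint[OF finZ])
        show "\<forall>z\<in>Z. finite (local_ball z (r k))" using Zc finite_local_ball by blast
        show "\<forall>z\<in>Z. \<forall>z'\<in>Z. z \<noteq> z' \<longrightarrow> local_ball z (r k) \<inter> local_ball z' (r k) = {}"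
        proof (intro ballI impI)
          fix z z' assume zz: "z \<in> Z" "z' \<in> Z" "z \<noteq> z'"
          have False if u: "u \<in> local_ball z (r k)" "u \<in> local_ball z' (r k)" for u
          proof -
            have u': "u \<in> carrier H" "z \<in> carrier H" "z' \<in> carrier H" using u zz Zc by (auto simp: local_ball_def)
            have "word_dist H SH z z' \<le> word_dist H SH z u + word_dist H SH u z'"
              by (intro H.word_dist_triangle[OF SH] u')
            moreover have "word_dist H SH u z' = word_dist H SH z' u" by (intro H.word_dist_commute[OF SH] u')
            moreover have "real (word_dist H SH z u) \<le> r k" "real (word_dist H SH z' u) \<le> r k"
              using u by (auto simp: local_ball_def)
            ultimately show False using sep[OF zz] r(2)[of k] by linarith
          qed
          then show "local_ball z (r k) \<inter> local_ball z' (r k) = {}" by blast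
        qed
      qed
      also have "\<dots> = (\<Sum>z\<in>Z. card (word_ball H SH (r k)))"
        using Zc card_local_ball by (intro sum.cong) auto
      finally have cardY: "real (card Y) = real (card Z) * V k" by (simp add: V_def)
      have "real (card Y) * (c k * \<tau> k) \<le> Lp_dist p (F (f, x)) (F (g, y)) powr p"
      proof (rule windows[OF w f])
        show "finite Y" unfolding Y_def using finZ Zc finite_local_ball by blast
        show "Y \<subseteq> carrier H" by (auto simp: Y_def local_ball_def)
        fix u assume "u \<in> Y"
        then obtain z where z: "z \<in> Z" "u \<in> local_ball z (r k)" by (auto simp: Y_def)
        have u': "u \<in> carrier H" "z \<in> carrier H" using z Zc by (auto simp: local_ball_def)
        have zu: "real (word_dist H SH z u) \<le> r k" using z by (simp add: local_ball_def)
        have comm: "word_dist H SH u z = word_dist H SH z u" by (intro H.word_dist_commute[OF SH] u')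
        have "cutoff (\<tau> k) (r k) u x = \<tau> k"
        proof (rule cutoff_eq[OF _ \<tau>0])
          have "word_dist H SH x z \<le> word_dist H SH x u + word_dist H SH u z"
            by (intro H.word_dist_triangle[OF SH] x u')
          then show "r k + \<tau> k \<le> real (word_dist H SH x u)"
            using far[OF z(1)] zu comm r(2)[of k] \<tau>1[of k] by linarith
        qed
        moreover have "restrict g (local_ball u (r k)) \<noteq> restrict f (local_ball u (r k))"
        proof
          assume eq: "restrict g (local_ball u (r k)) = restrict f (local_ball u (r k))"
          have "z \<in> local_ball u (r k)" using zu comm u' by (simp add: local_ball_def)
          then have "f z = g z" using fun_cong[OF eq, of z] by simp
          then show False using z Z by (auto simp: diff_set_def)
        qed
        ultimately show "\<bar>window_coord p c r \<tau> (k, u, restrict f (local_ball u (r k))) (f, x)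
           - window_coord p c r \<tau> (k, u, restrict f (local_ball u (r k))) (g, y)\<bar> powr p = c k * \<tau> k"
          using pc c0 \<tau>0 by (simp add: window_coord_def)
      qed
      then show ?thesis
        using cV[of k] by (simp add: cardY mult.assoc)
    qed
    show "(\<Sum>z\<in>diff_set f g. Lp_dist p (\<phi> (f z)) (\<phi> (g z)) powr p) \<le> Lp_dist p (F (f, x)) (F (g, y)) powr p \<and>
       (\<forall>k::nat. 5 * 2 ^ k / 8 < real (word_dist H SH x y) \<longrightarrow>
          2 powr (\<theta> * real k) / 8 \<le> Lp_dist p (F (f, x)) (F (g, y)) powr p) \<and>
       (\<forall>(k::nat) Z. Z \<subseteq> diff_set f g \<and> (\<forall>z\<in>Z. 5 * 2 ^ k / 8 < real (word_dist H SH x z)) \<and>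
          (\<forall>z\<in>Z. \<forall>z'\<in>Z. z \<noteq> z' \<longrightarrow> 2 ^ k / 2 < real (word_dist H SH z z')) \<longrightarrow>
          real (card Z) * 2 powr (\<theta> * real k) / 8 \<le> Lp_dist p (F (f, x)) (F (g, y)) powr p)"
    proof (intro conjI allI impI)
      fix k :: nat and Z
      assume Z: "Z \<subseteq> diff_set f g \<and> (\<forall>z\<in>Z. 5 * 2 ^ k / 8 < real (word_dist H SH x z)) \<and>
          (\<forall>z\<in>Z. \<forall>z'\<in>Z. z \<noteq> z' \<longrightarrow> 2 ^ k / 2 < real (word_dist H SH z z'))"
      show "real (card Z) * 2 powr (\<theta> * real k) / 8 \<le> Lp_dist p (F (f, x)) (F (g, y)) powr p"
        by (rule separated[OF conjunct1[OF Z] bspec[OF conjunct1[OF conjunct2[OF Z]]]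
            conjunct2[OF conjunct2[OF Z], rule_format]])
    qed (fact lamps, rule walker)
  qed
  then show ?thesis using F(1,2) by blast
qed

end

section \<open>Tours through nets of all scales\<close>

context group
begin

lemma maximal_separated_subset:
  assumes A: "finite A" "A \<subseteq> carrier G"
  shows "\<exists>Z\<subseteq>A. (\<forall>z\<in>Z. \<forall>z'\<in>Z. z \<noteq> z' \<longrightarrow> \<delta> < real (word_dist G S z z')) \<and>
           (\<forall>a\<in>A. \<exists>z\<in>Z. z = a \<or> real (word_dist G S z a) \<le> \<delta> \<or> real (word_dist G S a z) \<le> \<delta>)"
  using A
proof (induction A rule: finite_induct)
  case empty
  then show ?case by auto
next
  case (insert a A)
  then obtain Z where Z: "Z \<subseteq> A" "\<forall>z\<in>Z. \<forall>z'\<in>Z. z \<noteq> z' \<longrightarrow> \<delta> < real (word_dist G S z z')"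
    "\<forall>a\<in>A. \<exists>z\<in>Z. z = a \<or> real (word_dist G S z a) \<le> \<delta> \<or> real (word_dist G S a z) \<le> \<delta>"
    by auto
  show ?case
  proof (cases "\<exists>z\<in>Z. real (word_dist G S z a) \<le> \<delta> \<or> real (word_dist G S a z) \<le> \<delta>")
    case True
    then show ?thesis using Z by (intro exI[of _ Z]) auto
  next
    case False
    then show ?thesis using Z by (intro exI[of _ "insert a Z"]) (auto simp: not_le)
  qed
qed

text \<open>
  At every scale take a maximal separated set among the points of \<open>A\<close> that are far from \<open>x\<close>. A
  point of \<open>Z k\<close> is close to \<open>x\<close> or close to a point of \<open>Z (Suc k)\<close>, in both cases within
  \<open>2 ^ Suc k\<close>. So a tour of \<open>Z (Suc k)\<close> extends to \<open>Z k\<close> by one detour of length at most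
  \<open>2 * 2 ^ Suc k\<close> per point. For large \<open>k\<close> no point is far, and \<open>Z 0\<close> contains all of \<open>A\<close> but
  \<open>x\<close>.
\<close>

lemma multiscale_closed_tour:
  assumes S: "sym_gen_set G S" and x: "x \<in> carrier G" and A: "finite A" "A \<subseteq> carrier G"
  obtains N :: nat and Z :: "nat \<Rightarrow> 'a set" where
    "\<And>k. Z k \<subseteq> A" "\<And>k z. z \<in> Z k \<Longrightarrow> 5 * 2 ^ k / 8 < real (word_dist G S x z)"
    "\<And>k z z'. z \<in> Z k \<Longrightarrow> z' \<in> Z k \<Longrightarrow> z \<noteq> z' \<Longrightarrow> 2 ^ k / 2 < real (word_dist G S z z')"
    "closed_tour G S x A (\<Sum>k<N. 4 * 2 ^ k * card (Z k))"
proof -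
  \<comment> \<open>The bound is chosen such that a window of radius at most \<open>2 ^ k / 4\<close> with a cutoff of
    width at most \<open>2 ^ k / 8\<close> that contains a point of \<open>B k\<close> is saturated at \<open>x\<close>.\<close>
  define B where "B k = {a \<in> A. 5 * 2 ^ k / 8 < real (word_dist G S x a)}" for k :: nat
  have B: "finite (B k)" "B k \<subseteq> carrier G" "B k \<subseteq> A" for k using A by (auto simp: B_def)
  define P where "P k Z \<longleftrightarrow> Z \<subseteq> B k \<and>
    (\<forall>z\<in>Z. \<forall>z'\<in>Z. z \<noteq> z' \<longrightarrow> 2 ^ k / 2 < real (word_dist G S z z')) \<and>
    (\<forall>a\<in>B k. \<exists>z\<in>Z. z = a \<or> real (word_dist G S z a) \<le> 2 ^ k / 2 \<or> real (word_dist G S a z) \<le> 2 ^ k / 2)"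
    for k Z
  have "\<exists>Z. P k Z" for k
    using maximal_separated_subset[OF B(1,2), of k "2 ^ k / 2" S] unfolding P_def by blast
  then obtain Z where "\<And>k. P k (Z k)" by metis
  then have Z: "\<And>k. Z k \<subseteq> B k"
    "\<And>k z z'. z \<in> Z k \<Longrightarrow> z' \<in> Z k \<Longrightarrow> z \<noteq> z' \<Longrightarrow> 2 ^ k / 2 < real (word_dist G S z z')"
    "\<And>k a. a \<in> B k \<Longrightarrow> \<exists>z\<in>Z k. z = a \<or> real (word_dist G S z a) \<le> 2 ^ k / 2 \<or> real (word_dist G S a z) \<le> 2 ^ k / 2"
    unfolding P_def by blast+
  have near: "\<exists>z\<in>Z k. real (word_dist G S z a) \<le> 2 ^ k / 2" if a: "a \<in> B k" for a k
  proof -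
    obtain z where z: "z \<in> Z k" "z = a \<or> real (word_dist G S z a) \<le> 2 ^ k / 2 \<or> real (word_dist G S a z) \<le> 2 ^ k / 2"
      using Z(3)[OF a] by blast
    moreover have "word_dist G S a z = word_dist G S z a"
      using z a B Z by (intro word_dist_commute[OF S]) blast+
    moreover have "a \<in> carrier G" using a B by blast
    ultimately show ?thesis by (intro bexI[of _ z]) auto
  qed
  define N where "N = Suc (Max (insert 0 (word_dist G S x ` A)))"
  have BN: "B N = {}"
  proof -
    have "\<not> 5 * 2 ^ N / 8 < real (word_dist G S x a)" if "a \<in> A" for a
    proof -
      have "word_dist G S x a \<le> Max (insert 0 (word_dist G S x ` A))" using A that by (intro Max_ge) auto
      then have "real (word_dist G S x a) \<le> real N - 1" by (simp add: N_def)
      moreover have "real N \<le> 2 ^ (N - 1)"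
      proof -
        have "N - 1 < 2 ^ (N - 1)" by (rule less_exp)
        then have "N \<le> 2 ^ (N - 1)" by linarith
        then show ?thesis by (metis of_nat_le_iff of_nat_numeral of_nat_power)
      qed
      moreover have "(2::real) ^ N = 2 * 2 ^ (N - 1)" by (simp add: N_def)
      ultimately show ?thesis by linarith
    qed
    then show ?thesis by (auto simp: B_def)
  qed
  have tour: "closed_tour G S x (insert x (Z (N - j))) (\<Sum>k\<in>{N - j..<N}. 4 * 2 ^ k * card (Z k))" if "j \<le> N" for j
    using that
  proof (induction j)
    case 0
    \<comment> \<open>All points of \<open>A\<close> are within \<open>5 * 2 ^ N / 8\<close> of \<open>x\<close>.\<close>
    have "Z N = {}" using Z(1)[of N] BN by simp
    then show ?case using closed_tour_start[OF x] by simp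
  next
    case (Suc j)
    define k where "k = N - Suc j"
    have k: "N - j = Suc k" "k < N" using Suc.prems by (auto simp: k_def)
    have IH: "closed_tour G S x (insert x (Z (Suc k))) (\<Sum>k\<in>{Suc k..<N}. 4 * 2 ^ k * card (Z k))"
      using Suc k by simp
    have Zk: "finite (Z k)" "Z k \<subseteq> carrier G" "Z (Suc k) \<subseteq> carrier G"
      using Z(1) B by (meson finite_subset subset_trans)+
    have "closed_tour G S x (Z k \<union> insert x (Z (Suc k)))
        ((\<Sum>k\<in>{Suc k..<N}. 4 * 2 ^ k * card (Z k)) + 2 * 2 ^ Suc k * card (Z k))"
    proof (rule closed_tour_extend[OF S x IH _ Zk(1,2)])
      show "insert x (Z (Suc k)) \<subseteq> carrier G" using x Zk by auto
      fix z assume z: "z \<in> Z k"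
      then have zA: "z \<in> A" using Z(1) B by blast
      show "\<exists>y\<in>insert x (Z (Suc k)). word_dist G S y z \<le> 2 ^ Suc k"
      proof (cases "z \<in> B (Suc k)")
        case True
        then obtain y where "y \<in> Z (Suc k)" "real (word_dist G S y z) \<le> 2 ^ Suc k / 2" using near by blast
        note this(2)
        also have "2 ^ Suc k / 2 \<le> real (2 ^ Suc k)" by simp
        finally have "word_dist G S y z \<le> 2 ^ Suc k" by (simp only: of_nat_le_iff)
        then show ?thesis using \<open>y \<in> Z (Suc k)\<close> by blast
      next
        case False
        then have "real (word_dist G S x z) \<le> 5 * 2 ^ Suc k / 8" using zA by (auto simp: B_def)
        also have "\<dots> \<le> real (2 ^ Suc k)" by simp
        finally have "word_dist G S x z \<le> 2 ^ Suc k" by (simp only: of_nat_le_iff)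
        then show ?thesis by blast
      qed
    qed
    note tour_k = this
    have sum_k: "(\<Sum>k\<in>{k..<N}. 4 * 2 ^ k * card (Z k)) = 4 * 2 ^ k * card (Z k) + (\<Sum>k\<in>{Suc k..<N}. 4 * 2 ^ k * card (Z k))"
      using k by (simp add: sum.atLeast_Suc_lessThan)
    show ?case unfolding k_def[symmetric] by (rule closed_tour_mono[OF tour_k]) (auto simp: sum_k)
  qed
  have "A \<subseteq> insert x (Z 0)"
  proof
    fix a assume a: "a \<in> A"
    show "a \<in> insert x (Z 0)"
    proof (cases "a = x")
      case False
      then have "word_dist G S x a \<noteq> 0" using word_dist_eq_0[OF S x] a A by blast
      then have "a \<in> B 0" using a by (simp add: B_def)
      then obtain z where z: "z \<in> Z 0" "real (word_dist G S z a) \<le> 1 / 2" using near[of a 0] by auto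
      then have "word_dist G S z a = 0" by linarith
      moreover have "z \<in> carrier G" "a \<in> carrier G" using z(1) Z(1)[of 0] B(2)[of 0] a A(2) by auto
      ultimately have "z = a" using word_dist_eq_0[OF S] by simp
      then show ?thesis using z by simp
    qed simp
  qed
  moreover have "closed_tour G S x (insert x (Z 0)) (\<Sum>k<N. 4 * 2 ^ k * card (Z k))"
    using tour[OF order_refl] unfolding diff_self_eq_0 atLeast0LessThan .
  ultimately have "closed_tour G S x A (\<Sum>k<N. 4 * 2 ^ k * card (Z k))"
    using closed_tour_mono by blast
  then show ?thesis using Z(1,2) by (intro that[of Z N]) (auto simp: B_def)
qed

end

text \<open>
  A scale that occurs at all satisfies \<open>2 powr (\<theta> * k) \<le> D\<close>. The sum is a geometric series
  dominated by its largest term, which is at most \<open>D * 2 powr ((1 - \<theta>) * k)\<close> for the largest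
  such \<open>k\<close>.
\<close>

lemma sum_scales_le:
  fixes n :: "nat \<Rightarrow> nat" and D \<theta> :: real
  assumes \<theta>: "0 < \<theta>" "\<theta> < 1" and n: "\<And>k. real (n k) * 2 powr (\<theta> * real k) \<le> D"
  shows "(\<Sum>k<N. 2 ^ k * real (n k)) \<le> D powr (1 / \<theta>) / (1 - 2 powr (\<theta> - 1))"
proof (cases "\<exists>k<N. n k \<noteq> 0")
  case False
  have "2 powr (\<theta> - 1) < 1" using \<theta> powr_less_mono[of "\<theta> - 1" 0 2] by simp
  then show ?thesis using False by simp
next
  case True
  define q where "q = 2 powr (\<theta> - 1)"
  have q: "0 < q" "q < 1" using \<theta> powr_less_mono[of "\<theta> - 1" 0 2] by (auto simp: q_def)
  define K where "K = Max {k. k < N \<and> n k \<noteq> 0}"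
  have fin: "finite {k. k < N \<and> n k \<noteq> 0}" by simp
  have K: "K < N" "n K \<noteq> 0" using Max_in[OF fin] True by (auto simp: K_def)
  have Kmax: "k \<le> K" if "k < N" "n k \<noteq> 0" for k using Max_ge[OF fin] that by (simp add: K_def)
  have "1 * 2 powr (\<theta> * real K) \<le> real (n K) * 2 powr (\<theta> * real K)"
    using K by (intro mult_right_mono) auto
  then have DK: "2 powr (\<theta> * real K) \<le> D" using n[of K] by linarith
  have D: "D > 0" using DK by (rule less_le_trans[rotated]) simp
  have pk: "(2::real) ^ k = 2 powr (\<theta> * real k) * 2 powr ((1 - \<theta>) * real k)" for k
    by (simp add: powr_add[symmetric] algebra_simps powr_realpow)
  have "(\<Sum>k<N. 2 ^ k * real (n k)) = (\<Sum>k\<le>K. 2 ^ k * real (n k))"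
    using K Kmax by (intro sum.mono_neutral_right) auto
  also have "\<dots> \<le> (\<Sum>k\<le>K. D * (2 powr ((1 - \<theta>) * real K) * q ^ (K - k)))"
  proof (rule sum_mono)
    fix k assume "k \<in> {..K}"
    then have k: "k \<le> K" by simp
    have "q ^ (K - k) = 2 powr ((\<theta> - 1) * real (K - k))" by (simp add: q_def powr_realpow[symmetric] powr_powr)
    then have "2 powr ((1 - \<theta>) * real K) * q ^ (K - k) = 2 powr ((1 - \<theta>) * real k)"
      using k by (simp add: powr_add[symmetric] algebra_simps of_nat_diff)
    moreover have "2 ^ k * real (n k) = (real (n k) * 2 powr (\<theta> * real k)) * 2 powr ((1 - \<theta>) * real k)"
      by (simp add: pk)
    moreover have "\<dots> \<le> D * 2 powr ((1 - \<theta>) * real k)" by (intro mult_right_mono n) auto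
    ultimately show "2 ^ k * real (n k) \<le> D * (2 powr ((1 - \<theta>) * real K) * q ^ (K - k))" by (simp only:)
  qed
  also have "\<dots> = D * 2 powr ((1 - \<theta>) * real K) * (\<Sum>k\<le>K. q ^ (K - k))"
    by (simp add: sum_distrib_left mult.assoc)
  also have "(\<Sum>k\<le>K. q ^ (K - k)) = (\<Sum>k\<le>K. q ^ k)"
    by (rule sum.reindex_bij_witness[where i="\<lambda>k. K - k" and j="\<lambda>k. K - k"]) auto
  also have "D * 2 powr ((1 - \<theta>) * real K) * (\<Sum>k\<le>K. q ^ k) \<le> D powr (1 / \<theta>) * (1 / (1 - q))"
  proof (intro mult_mono)
    have "2 powr ((1 - \<theta>) * real K) = (2 powr (\<theta> * real K)) powr ((1 - \<theta>) / \<theta>)"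
      using \<theta> by (simp add: powr_powr mult.commute)
    also have "\<dots> \<le> D powr ((1 - \<theta>) / \<theta>)" using DK \<theta> by (intro powr_mono2) auto
    finally have "D * 2 powr ((1 - \<theta>) * real K) \<le> D powr 1 * D powr ((1 - \<theta>) / \<theta>)"
      using D by simp
    also have "\<dots> = D powr (1 + (1 - \<theta>) / \<theta>)" by (rule powr_add[symmetric])
    also have "1 + (1 - \<theta>) / \<theta> = 1 / \<theta>" using \<theta> by (simp add: field_simps)
    finally show "D * 2 powr ((1 - \<theta>) * real K) \<le> D powr (1 / \<theta>)" .
    have "(\<Sum>k\<le>K. q ^ k) \<le> suminf (\<lambda>k. q ^ k)"
      using q by (intro sum_le_suminf summable_geometric) auto
    then show "(\<Sum>k\<le>K. q ^ k) \<le> 1 / (1 - q)" using q by (simp add: suminf_geometric)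
  qed (use q in \<open>auto intro: sum_nonneg\<close>)
  finally show ?thesis by (simp add: q_def)
qed

context wreath
begin

text \<open>
  Let \<open>D\<close> be the \<open>p\<close>-th power of the distance of the images. The tour has length
  \<open>O(D powr (1 / \<theta>))\<close>, and the sum over the lamps is controlled term by term because the power
  \<open>\<gamma> < 1\<close> is subadditive. Both give \<open>word_dist powr \<gamma> = O(D)\<close> with \<open>\<gamma> = \<beta> * p\<close>.
\<close>

lemma wreath_compression_bound:
  assumes p: "1 \<le> p" and poly: "polynomial_growth H"
    and \<alpha>: "Lp_compression_bound p G SG \<alpha>" and \<beta>: "0 \<le> \<beta>" "\<beta> \<le> \<alpha>" "\<beta> < 1 / p"
  shows "Lp_compression_bound p W T \<beta>"
proof -
  have p0: "p > 0" using p by simp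
  obtain \<phi> L c where \<phi>: "\<phi> \<in> carrier G \<rightarrow> Lp_space p"
    and L: "\<And>a b. a \<in> carrier G \<Longrightarrow> b \<in> carrier G \<Longrightarrow> Lp_dist p (\<phi> a) (\<phi> b) \<le> L * real (word_dist G SG a b)"
    and c: "c > 0" "\<And>a b. a \<in> carrier G \<Longrightarrow> b \<in> carrier G \<Longrightarrow> c * real (word_dist G SG a b) powr \<alpha> \<le> Lp_dist p (\<phi> a) (\<phi> b)"
    using \<alpha> unfolding Lp_compression_bound_def by blast
  define \<gamma> where "\<gamma> = \<beta> * p"
  \<comment> \<open>Any \<open>\<theta>\<close> strictly between zero and one with \<open>\<gamma> \<le> \<theta>\<close> would do; the maximum covers \<open>\<gamma> = 0\<close>.\<close>
  define \<theta> where "\<theta> = max \<gamma> (1 / 2)"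
  have \<gamma>: "0 \<le> \<gamma>" "\<gamma> < 1" "\<gamma> \<le> \<alpha> * p" using \<beta> p0 by (auto simp: \<gamma>_def field_simps)
  have \<theta>: "0 < \<theta>" "\<theta> < 1" "\<gamma> \<le> \<theta>" using \<gamma> by (auto simp: \<theta>_def)
  obtain F K where F: "F \<in> carrier W \<rightarrow> Lp_space p"
    "\<And>w v. w \<in> carrier W \<Longrightarrow> v \<in> carrier W \<Longrightarrow> Lp_dist p (F w) (F v) \<le> K * real (word_dist W T w v)"
    and detects: "detects_travel p \<theta> \<phi> F"
    using wreath_embedding[OF p \<theta>(1,2) poly \<phi> L] by blast
  define Q where "Q = 4 / (1 - 2 powr (\<theta> - 1)) + 2"
  have Q: "Q > 0" using \<theta> powr_less_mono[of "\<theta> - 1" 0 2] by (simp add: Q_def add_pos_pos)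
  define C where "C = Q powr \<theta> * 8 + 1 / c powr p"
  have C: "C > 0" using c Q by (simp add: C_def add_pos_pos)
  have main: "real (word_dist W T (f, x) (g, y)) powr \<gamma> \<le> C * Lp_dist p (F (f, x)) (F (g, y)) powr p"
    if f: "f \<in> configs" and g: "g \<in> configs" and x: "x \<in> carrier H" and y: "y \<in> carrier H" for f g x y
  proof -
    define D where "D = Lp_dist p (F (f, x)) (F (g, y)) powr p"
    note bounds = bspec[OF bspec[OF bspec[OF bspec[OF detects[unfolded detects_travel_def] f] g] x] y, folded D_def]
    have lamp_D: "(\<Sum>z\<in>diff_set f g. Lp_dist p (\<phi> (f z)) (\<phi> (g z)) powr p) \<le> D"
      by (rule bounds[THEN conjunct1])
    have walker_D: "2 powr (\<theta> * real k) / 8 \<le> D" if "5 * 2 ^ k / 8 < real (word_dist H SH x y)" for k :: nat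
      by (rule bounds[THEN conjunct2, THEN conjunct1, rule_format, OF that])
    have separated_D: "real (card Z) * 2 powr (\<theta> * real k) / 8 \<le> D"
      if "Z \<subseteq> diff_set f g" "\<forall>z\<in>Z. 5 * 2 ^ k / 8 < real (word_dist H SH x z)"
        "\<forall>z\<in>Z. \<forall>z'\<in>Z. z \<noteq> z' \<longrightarrow> 2 ^ k / 2 < real (word_dist H SH z z')" for k :: nat and Z
      using bounds[THEN conjunct2, THEN conjunct2] that by blast
    have D0: "D \<ge> 0" by (simp add: D_def)
    define A where "A = diff_set f g"
    obtain N Z where Z: "\<And>k. Z k \<subseteq> A" "\<And>k z. z \<in> Z k \<Longrightarrow> 5 * 2 ^ k / 8 < real (word_dist H SH x z)"
      "\<And>k z z'. z \<in> Z k \<Longrightarrow> z' \<in> Z k \<Longrightarrow> z \<noteq> z' \<Longrightarrow> 2 ^ k / 2 < real (word_dist H SH z z')"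
      "closed_tour H SH x A (\<Sum>k<N. 4 * 2 ^ k * card (Z k))"
    proof -
      show thesis
        by (rule H.multiscale_closed_tour[OF SH x finite_diff_set[OF f g] diff_set_carrier, folded A_def])
          (assumption | rule that)+
    qed
    define n where "n = (\<Sum>k<N. 4 * 2 ^ k * card (Z k))"
    define d where "d = word_dist H SH x y"
    have nZ: "real (card (Z k)) * 2 powr (\<theta> * real k) \<le> 8 * D" for k
      using separated_D[of "Z k" k] Z(1-3) unfolding A_def by simp
    have "real n = 4 * (\<Sum>k<N. 2 ^ k * real (card (Z k)))"
      by (simp add: n_def sum_distrib_left mult.assoc)
    also have "\<dots> \<le> 4 * ((8 * D) powr (1 / \<theta>) / (1 - 2 powr (\<theta> - 1)))"
      using sum_scales_le[OF \<theta>(1,2) nZ] by (intro mult_left_mono) auto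
    finally have n_le: "real n \<le> 4 / (1 - 2 powr (\<theta> - 1)) * (8 * D) powr (1 / \<theta>)" by simp
    have d_le: "real d \<le> 2 * (8 * D) powr (1 / \<theta>)"
    proof (cases "d = 0")
      case False
      \<comment> \<open>The largest scale at which the distance of the walkers is detected.\<close>
      define P where "P k \<longleftrightarrow> 5 * 2 ^ k / 8 < real d" for k :: nat
      have "P 0" using False by (simp add: P_def)
      moreover have "\<forall>k. P k \<longrightarrow> k \<le> 2 * d"
      proof (intro allI impI)
        fix k assume "P k"
        then have "(2::real) ^ k < 2 * real d" by (simp add: P_def)
        moreover have "real k < 2 ^ k" using of_nat_less_two_power[of k] by simp
        ultimately show "k \<le> 2 * d" by linarith
      qed
      ultimately obtain k where k: "P k" "\<forall>j. P j \<longrightarrow> j \<le> k" using ex_has_greatest_nat[of P 0 id] 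
        by (metis (no_types, lifting) id_apply le_imp_less_Suc)
      then have "\<not> P (Suc k)" by fastforce
      then have "real d \<le> 2 * 2 ^ k" by (simp add: P_def)
      moreover have "(2::real) ^ k = (2 powr (\<theta> * real k)) powr (1 / \<theta>)"
        using \<theta> by (simp add: powr_powr powr_realpow)
      moreover have "2 powr (\<theta> * real k) \<le> 8 * D"
        using walker_D[of k] k(1) unfolding P_def d_def by simp
      then have "(2 powr (\<theta> * real k)) powr (1 / \<theta>) \<le> (8 * D) powr (1 / \<theta>)"
        using \<theta> by (intro powr_mono2) auto
      ultimately show ?thesis by linarith
    qed simp
    have "real (n + d) \<le> Q * (8 * D) powr (1 / \<theta>)"
      using n_le d_le by (simp add: Q_def algebra_simps)
    then have "real (n + d) powr \<theta> \<le> (Q * (8 * D) powr (1 / \<theta>)) powr \<theta>"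
      using \<theta> by (intro powr_mono2) auto
    also have "\<dots> = Q powr \<theta> * 8 * D"
      using \<theta> Q D0 by (simp add: powr_mult powr_powr)
    finally have "real (n + d) powr \<theta> \<le> Q powr \<theta> * 8 * D" .
    moreover have "real (n + d) powr \<gamma> \<le> real (n + d) powr \<theta>"
      using \<theta> \<gamma> by (cases "n + d = 0") (auto intro!: powr_mono)
    ultimately have travel: "real (n + d) powr \<gamma> \<le> Q powr \<theta> * 8 * D" by linarith
    \<comment> \<open>Distances are natural numbers, so a larger exponent only increases their powers.\<close>
    have lamps: "real (\<Sum>z\<in>A. word_dist G SG (f z) (g z)) powr \<gamma> \<le> D / c powr p"
    proof -
      have "real (\<Sum>z\<in>A. word_dist G SG (f z) (g z)) powr \<gamma>
          \<le> (\<Sum>z\<in>A. real (word_dist G SG (f z) (g z)) powr \<gamma>)"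
        using \<gamma> finite_diff_set[OF f g] unfolding A_def of_nat_sum by (intro powr_sum_subadditive) auto
      also have "\<dots> \<le> (\<Sum>z\<in>A. Lp_dist p (\<phi> (f z)) (\<phi> (g z)) powr p / c powr p)"
      proof (rule sum_mono)
        fix z assume "z \<in> A"
        then have z: "z \<in> carrier H" by (simp add: A_def diff_set_def)
        let ?d = "real (word_dist G SG (f z) (g z))"
        have "?d powr \<gamma> \<le> ?d powr (\<alpha> * p)"
          using \<gamma> by (cases "word_dist G SG (f z) (g z) = 0") (auto intro!: powr_mono)
        moreover have "(c * ?d powr \<alpha>) powr p \<le> Lp_dist p (\<phi> (f z)) (\<phi> (g z)) powr p"
          using c f g z p0 by (intro powr_mono2) auto
        then have "c powr p * ?d powr (\<alpha> * p) \<le> Lp_dist p (\<phi> (f z)) (\<phi> (g z)) powr p"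
          using c by (simp add: powr_mult powr_powr)
        then have "?d powr (\<alpha> * p) \<le> Lp_dist p (\<phi> (f z)) (\<phi> (g z)) powr p / c powr p"
          using c by (simp add: field_simps)
        ultimately show "?d powr \<gamma> \<le> Lp_dist p (\<phi> (f z)) (\<phi> (g z)) powr p / c powr p" by linarith
      qed
      also have "\<dots> \<le> D / c powr p"
        using lamp_D unfolding A_def by (simp add: sum_divide_distrib[symmetric] divide_right_mono)
      finally show ?thesis .
    qed
    have "word_dist W T (f, x) (g, y) \<le> n + d + (\<Sum>z\<in>A. word_dist G SG (f z) (g z))"
      using word_dist_wreath_le[OF f g x y Z(4)[unfolded A_def]] unfolding n_def d_def A_def by simp
    then have "real (word_dist W T (f, x) (g, y)) \<le> real (n + d) + real (\<Sum>z\<in>A. word_dist G SG (f z) (g z))"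
      by (simp only: of_nat_add[symmetric] of_nat_le_iff)
    then have "real (word_dist W T (f, x) (g, y)) powr \<gamma>
        \<le> (real (n + d) + real (\<Sum>z\<in>A. word_dist G SG (f z) (g z))) powr \<gamma>"
      using \<gamma> by (intro powr_mono2) (assumption | rule of_nat_0_le_iff)+
    also have "\<dots> \<le> real (n + d) powr \<gamma> + real (\<Sum>z\<in>A. word_dist G SG (f z) (g z)) powr \<gamma>"
      using \<gamma> by (intro powr_subadditive of_nat_0_le_iff) simp_all
    also have "\<dots> \<le> Q powr \<theta> * 8 * D + D / c powr p" using travel lamps by linarith
    also have "\<dots> = C * D" by (simp add: C_def algebra_simps)
    finally show ?thesis by (simp add: D_def)
  qed
  have lower: "1 / C powr (1 / p) * real (word_dist W T w v) powr \<beta> \<le> Lp_dist p (F w) (F v)"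
    if w: "w \<in> carrier W" and v: "v \<in> carrier W" for w v
  proof -
    have "real (word_dist W T w v) powr \<gamma> \<le> C * Lp_dist p (F w) (F v) powr p"
      using main w v carrier_W by auto
    then have "(real (word_dist W T w v) powr \<gamma>) powr (1 / p) \<le> (C * Lp_dist p (F w) (F v) powr p) powr (1 / p)"
      using p0 by (intro powr_mono2) auto
    then have "real (word_dist W T w v) powr \<beta> \<le> C powr (1 / p) * Lp_dist p (F w) (F v)"
      using p0 C by (simp add: powr_powr powr_mult \<gamma>_def)
    then show ?thesis using C by (simp add: field_simps)
  qed
  have "1 / C powr (1 / p) > 0" using C by simp
  then show ?thesis using F(1,2) lower unfolding Lp_compression_bound_def by blast
qed

end

section \<open>A multiscale random walk\<close>

context group
begin

text \<open>
  Proportional to \<open>4 ^ (- j)\<close>: the moments of order \<open>p \<le> 2\<close> of the walk then grow only linearly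
  in \<open>J\<close>, while steps of length \<open>2 ^ j\<close> still occur about once in \<open>4 ^ j\<close> steps, which is
  frequent enough for the return probabilities to decay like \<open>1 / m\<close> in a group of quadratic
  growth.
\<close>

definition multiscale_weight :: "nat \<Rightarrow> nat \<Rightarrow> real" where
  "multiscale_weight J j = (1 / 4) ^ j / (\<Sum>i\<le>J. (1 / 4) ^ i)"

definition multiscale_step :: "'a set \<Rightarrow> nat \<Rightarrow> 'a \<Rightarrow> real" where
  "multiscale_step S J y = (\<Sum>j\<le>J. if y \<in> word_ball G S (2 ^ j)
     then multiscale_weight J j / real (card (word_ball G S (2 ^ j))) else 0)"

primrec walk_distribution :: "'a set \<Rightarrow> nat \<Rightarrow> nat \<Rightarrow> 'a \<Rightarrow> real" where
  "walk_distribution S J 0 y = (if y = \<one> then 1 else 0)"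
| "walk_distribution S J (Suc m) y =
     (\<Sum>s\<in>word_ball G S (2 ^ J). multiscale_step S J s * walk_distribution S J m (inv s \<otimes> y))"

text \<open>
  The probability that the walk started at \<open>x\<close> does not meet \<open>z\<close> at any of the times \<open>0, \<dots>, m\<close>;
  for \<open>m = 0\<close> it is one by convention, also at \<open>z\<close>.
\<close>

primrec avoidance :: "'a set \<Rightarrow> nat \<Rightarrow> 'a \<Rightarrow> nat \<Rightarrow> 'a \<Rightarrow> real" where
  "avoidance S J z 0 x = 1"
| "avoidance S J z (Suc m) x = (if x = z then 0 else
     (\<Sum>s\<in>word_ball G S (2 ^ J). multiscale_step S J s * (if x \<otimes> s = z then 0 else avoidance S J z m (x \<otimes> s))))"

lemma word_ball_mono: "r \<le> s \<Longrightarrow> word_ball G S r \<subseteq> word_ball G S s"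
  unfolding word_ball_def by (auto intro: order_trans)

lemma multiscale_weight_nonneg: "0 \<le> multiscale_weight J j"
  by (simp add: multiscale_weight_def sum_nonneg)

lemma sum_quarter_powers: "1 \<le> (\<Sum>i\<le>J. (1 / 4 :: real) ^ i)" "(\<Sum>i\<le>J. (1 / 4 :: real) ^ i) \<le> 4 / 3"
proof -
  have "(\<Sum>i\<in>{0}. (1 / 4 :: real) ^ i) \<le> (\<Sum>i\<le>J. (1 / 4) ^ i)" by (intro sum_mono2) auto
  then show "1 \<le> (\<Sum>i\<le>J. (1 / 4 :: real) ^ i)" by simp
  have "(\<Sum>i\<le>J. (1 / 4 :: real) ^ i) \<le> suminf (\<lambda>i. (1 / 4) ^ i)"
    by (intro sum_le_suminf summable_geometric) auto
  then show "(\<Sum>i\<le>J. (1 / 4 :: real) ^ i) \<le> 4 / 3" by (simp add: suminf_geometric)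
qed

lemma multiscale_weight_bounds: "3 / 4 * (1 / 4) ^ j \<le> multiscale_weight J j" "multiscale_weight J j \<le> (1 / 4) ^ j"
proof -
  define Q where "Q = (\<Sum>i\<le>J. (1 / 4 :: real) ^ i)"
  have Q: "1 \<le> Q" "Q \<le> 4 / 3" using sum_quarter_powers by (auto simp: Q_def)
  have "(1 / 4 :: real) ^ j * (3 / 4) \<le> (1 / 4) ^ j * (1 / Q)"
    using Q by (intro mult_left_mono) (auto simp: field_simps)
  then show "3 / 4 * (1 / 4) ^ j \<le> multiscale_weight J j" by (simp add: multiscale_weight_def Q_def)
  have "(1 / 4 :: real) ^ j * (1 / Q) \<le> (1 / 4) ^ j * 1"
    using Q by (intro mult_left_mono) (auto simp: field_simps)
  then show "multiscale_weight J j \<le> (1 / 4) ^ j" by (simp add: multiscale_weight_def Q_def)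
qed

lemma sum_multiscale_weight: "(\<Sum>j\<le>J. multiscale_weight J j) = 1"
  using sum_quarter_powers(1)[of J] by (simp add: multiscale_weight_def sum_divide_distrib[symmetric])

lemma multiscale_step_nonneg: "0 \<le> multiscale_step S J y"
  unfolding multiscale_step_def by (intro sum_nonneg) (simp add: multiscale_weight_nonneg)

lemma sum_multiscale_step:
  assumes S: "sym_gen_set G S"
  shows "(\<Sum>s\<in>word_ball G S (2 ^ J). multiscale_step S J s * \<phi> s)
     = (\<Sum>j\<le>J. multiscale_weight J j * ((\<Sum>s\<in>word_ball G S (2 ^ j). \<phi> s) / real (card (word_ball G S (2 ^ j)))))"
proof -
  note fin = finite_word_ball[OF S]
  have "(\<Sum>s\<in>word_ball G S (2 ^ J). multiscale_step S J s * \<phi> s)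
      = (\<Sum>s\<in>word_ball G S (2 ^ J). \<Sum>j\<le>J. if s \<in> word_ball G S (2 ^ j)
           then multiscale_weight J j / real (card (word_ball G S (2 ^ j))) * \<phi> s else 0)"
    unfolding multiscale_step_def sum_distrib_right by (intro sum.cong refl) auto
  also have "\<dots> = (\<Sum>j\<le>J. \<Sum>s\<in>word_ball G S (2 ^ J). if s \<in> word_ball G S (2 ^ j)
           then multiscale_weight J j / real (card (word_ball G S (2 ^ j))) * \<phi> s else 0)"
    by (rule sum.swap)
  also have "\<dots> = (\<Sum>j\<le>J. multiscale_weight J j * ((\<Sum>s\<in>word_ball G S (2 ^ j). \<phi> s) / real (card (word_ball G S (2 ^ j)))))"
  proof (rule sum.cong[OF refl])
    fix j assume "j \<in> {..J}"
    then have "(2::real) ^ j \<le> 2 ^ J" by (intro power_increasing) auto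
    then have "word_ball G S (2 ^ j) \<subseteq> word_ball G S (2 ^ J)" by (rule word_ball_mono)
    then have "(\<Sum>s\<in>word_ball G S (2 ^ J). if s \<in> word_ball G S (2 ^ j)
           then multiscale_weight J j / real (card (word_ball G S (2 ^ j))) * \<phi> s else 0)
        = (\<Sum>s\<in>word_ball G S (2 ^ j). multiscale_weight J j / real (card (word_ball G S (2 ^ j))) * \<phi> s)"
      using fin[of "2 ^ J"] by (subst sum.inter_filter[symmetric]) (auto intro!: sum.cong)
    then show "(\<Sum>s\<in>word_ball G S (2 ^ J). if s \<in> word_ball G S (2 ^ j)
           then multiscale_weight J j / real (card (word_ball G S (2 ^ j))) * \<phi> s else 0)
       = multiscale_weight J j * ((\<Sum>s\<in>word_ball G S (2 ^ j). \<phi> s) / real (card (word_ball G S (2 ^ j))))"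
      by (simp add: sum_distrib_left sum_divide_distrib)
  qed
  finally show ?thesis .
qed

lemma sum_multiscale_step_1:
  assumes S: "sym_gen_set G S"
  shows "(\<Sum>s\<in>word_ball G S (2 ^ J). multiscale_step S J s) = 1"
proof -
  have pos: "card (word_ball G S (2 ^ j)) \<noteq> 0" for j using card_word_ball_pos[OF S, of "2 ^ j"] by simp
  show ?thesis
    using sum_multiscale_step[OF S, of J "\<lambda>_. 1"] pos by (simp add: sum_multiscale_weight)
qed

lemma multiscale_step_outside:
  assumes "y \<notin> word_ball G S (2 ^ J)"
  shows "multiscale_step S J y = 0"
proof -
  have "y \<notin> word_ball G S (2 ^ j)" if "j \<le> J" for j
  proof -
    have "(2::real) ^ j \<le> 2 ^ J" using that by (intro power_increasing) auto
    then show ?thesis using assms word_ball_mono by blast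
  qed
  then show ?thesis by (auto simp: multiscale_step_def)
qed

lemma multiscale_step_inv:
  assumes S: "sym_gen_set G S" and y: "y \<in> carrier G"
  shows "multiscale_step S J (inv y) = multiscale_step S J y"
proof -
  have "word_length G S (inv y) = word_length G S y"
    using word_length_inv_le[OF S y] word_length_inv_le[OF S, of "inv y"] y by simp
  then show ?thesis using y by (simp add: multiscale_step_def word_ball_eq)
qed

lemma walk_distribution_nonneg: "0 \<le> walk_distribution S J m y"
  by (induction m arbitrary: y) (auto intro!: sum_nonneg mult_nonneg_nonneg multiscale_step_nonneg)

lemma word_ball_carrier: "word_ball G S r \<subseteq> carrier G"
  by (auto simp: word_ball_def)

lemma inj_on_mult_left: "a \<in> carrier G \<Longrightarrow> Y \<subseteq> carrier G \<Longrightarrow> inj_on (\<lambda>y. a \<otimes> y) Y"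
  by (intro inj_onI) (auto simp: subset_iff)

lemma sum_walk_distribution_le_1:
  assumes S: "sym_gen_set G S" and Y: "finite Y" "Y \<subseteq> carrier G"
  shows "(\<Sum>y\<in>Y. walk_distribution S J m y) \<le> 1"
  using Y
proof (induction m arbitrary: Y)
  case 0
  then show ?case by (simp add: sum.delta)
next
  case (Suc m)
  have "(\<Sum>y\<in>Y. walk_distribution S J (Suc m) y)
      = (\<Sum>s\<in>word_ball G S (2 ^ J). multiscale_step S J s * (\<Sum>y\<in>Y. walk_distribution S J m (inv s \<otimes> y)))"
    by (simp add: sum_distrib_left sum.swap[of _ Y])
  also have "\<dots> \<le> (\<Sum>s\<in>word_ball G S (2 ^ J). multiscale_step S J s * 1)"
  proof (intro sum_mono mult_left_mono multiscale_step_nonneg)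
    fix s assume "s \<in> word_ball G S (2 ^ J)"
    then have s: "inv s \<in> carrier G" using word_ball_carrier by auto
    have "(\<Sum>y\<in>Y. walk_distribution S J m (inv s \<otimes> y)) = (\<Sum>y\<in>(\<lambda>y. inv s \<otimes> y) ` Y. walk_distribution S J m y)"
      using inj_on_mult_left[OF s Suc.prems(2)] by (simp add: sum.reindex)
    also have "\<dots> \<le> 1" using Suc.prems s by (intro Suc.IH) auto
    finally show "(\<Sum>y\<in>Y. walk_distribution S J m (inv s \<otimes> y)) \<le> 1" .
  qed
  also have "\<dots> = 1" using sum_multiscale_step_1[OF S] by simp
  finally show ?case .
qed

lemma sum_walk_distribution_eq_1:
  assumes S: "sym_gen_set G S" and Y: "finite Y" "Y \<subseteq> carrier G" and ball: "word_ball G S (real m * 2 ^ J) \<subseteq> Y"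
  shows "(\<Sum>y\<in>Y. walk_distribution S J m y) = 1"
  using Y ball
proof (induction m arbitrary: Y)
  case 0
  have "\<one> \<in> word_ball G S (real 0 * 2 ^ J)" by (simp add: word_ball_def)
  then have "\<one> \<in> Y" using 0(3) by blast
  then show ?case using 0 by (simp add: sum.delta)
next
  case (Suc m)
  have "(\<Sum>y\<in>Y. walk_distribution S J (Suc m) y)
      = (\<Sum>s\<in>word_ball G S (2 ^ J). multiscale_step S J s * (\<Sum>y\<in>Y. walk_distribution S J m (inv s \<otimes> y)))"
    by (simp add: sum_distrib_left sum.swap[of _ Y])
  also have "\<dots> = (\<Sum>s\<in>word_ball G S (2 ^ J). multiscale_step S J s * 1)"
  proof (rule sum.cong[OF refl])
    fix s assume sb: "s \<in> word_ball G S (2 ^ J)"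
    then have s: "s \<in> carrier G" "inv s \<in> carrier G" using word_ball_carrier by auto
    have "(\<Sum>y\<in>Y. walk_distribution S J m (inv s \<otimes> y)) = (\<Sum>y\<in>(\<lambda>y. inv s \<otimes> y) ` Y. walk_distribution S J m y)"
      using inj_on_mult_left[OF s(2) Suc.prems(2)] by (simp add: sum.reindex)
    also have "\<dots> = 1"
    proof (rule Suc.IH)
      show "word_ball G S (real m * 2 ^ J) \<subseteq> (\<lambda>y. inv s \<otimes> y) ` Y"
      proof
        fix y assume y: "y \<in> word_ball G S (real m * 2 ^ J)"
        then have yc: "y \<in> carrier G" using word_ball_carrier by auto
        have "word_length G S (s \<otimes> y) \<le> word_length G S s + word_length G S y"
          by (rule word_length_mult[OF S s(1) yc])
        then have "real (word_length G S (s \<otimes> y)) \<le> 2 ^ J + real m * 2 ^ J"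
          using sb y unfolding word_ball_eq mem_Collect_eq by linarith
        then have "s \<otimes> y \<in> Y" using Suc.prems(3) s yc by (auto simp: word_ball_eq algebra_simps)
        then show "y \<in> (\<lambda>y. inv s \<otimes> y) ` Y"
          using s yc by (intro image_eqI[of _ _ "s \<otimes> y"]) (auto simp flip: m_assoc)
      qed
    qed (use Suc.prems s in auto)
    finally show "multiscale_step S J s * (\<Sum>y\<in>Y. walk_distribution S J m (inv s \<otimes> y)) = multiscale_step S J s * 1" by simp
  qed
  also have "\<dots> = 1" using sum_multiscale_step_1[OF S] by simp
  finally show ?case .
qed

text \<open>
  With the probability of a step on scale \<open>j\<close> the new position is uniform on a ball of that
  scale, whatever happened before; otherwise the maximal probability does not increase.
\<close>

lemma walk_distribution_step_le:
  assumes S: "sym_gen_set G S" and j: "j \<le> J" and y: "y \<in> carrier G"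
    and a: "\<And>u. u \<in> carrier G \<Longrightarrow> walk_distribution S J m u \<le> a"
  shows "walk_distribution S J (Suc m) y
    \<le> multiscale_weight J j / real (card (word_ball G S (2 ^ j))) + (1 - multiscale_weight J j) * a"
proof -
  let ?w = "multiscale_weight J" and ?N = "\<lambda>i. real (card (word_ball G S (2 ^ i)))"
  let ?m = "\<lambda>i. (\<Sum>s\<in>word_ball G S (2 ^ i). walk_distribution S J m (inv s \<otimes> y))"
  have N: "?N i > 0" for i using card_word_ball_pos[OF S, of "2 ^ i"] by simp
  have carr: "inv s \<otimes> y \<in> carrier G" if "s \<in> word_ball G S r" for s r
    using that y by (simp add: word_ball_def)
  have "?m j = (\<Sum>u\<in>(\<lambda>s. inv s \<otimes> y) ` word_ball G S (2 ^ j). walk_distribution S J m u)"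
  proof -
    have "inj_on (\<lambda>s. inv s \<otimes> y) (word_ball G S (2 ^ j))"
      using y by (intro inj_onI) (auto simp: word_ball_def)
    then show ?thesis by (simp add: sum.reindex)
  qed
  also have "\<dots> \<le> 1" using carr finite_word_ball[OF S] by (intro sum_walk_distribution_le_1[OF S]) auto
  finally have mj: "?m j \<le> 1" .
  have mi: "?m i / ?N i \<le> a" for i
  proof -
    have "?m i \<le> (\<Sum>s\<in>word_ball G S (2 ^ i). a)" using carr by (intro sum_mono a) auto
    then show ?thesis using N[of i] by (simp add: field_simps)
  qed
  have "walk_distribution S J (Suc m) y = (\<Sum>i\<le>J. ?w i * (?m i / ?N i))"
    using sum_multiscale_step[OF S, of J "\<lambda>s. walk_distribution S J m (inv s \<otimes> y)"] by simp
  also have "\<dots> = ?w j * (?m j / ?N j) + (\<Sum>i\<in>{..J} - {j}. ?w i * (?m i / ?N i))"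
    using j by (subst sum.remove[of _ j]) auto
  also have "\<dots> \<le> ?w j * (1 / ?N j) + (\<Sum>i\<in>{..J} - {j}. ?w i * a)"
    using mj mi N by (intro add_mono mult_left_mono sum_mono divide_right_mono multiscale_weight_nonneg) auto
  also have "(\<Sum>i\<in>{..J} - {j}. ?w i * a) = (1 - ?w j) * a"
    using j sum_multiscale_weight[of J] by (simp add: sum_diff1 sum_distrib_right[symmetric])
  finally show ?thesis by simp
qed

text \<open>
  Decay of order \<open>1 / m\<close> by induction: on the scale with \<open>4 ^ j\<close> about \<open>m\<close> the previous estimate
  loses a fraction of order \<open>1 / m\<close> of the bound in one step, which is more than needed to pass
  from \<open>1 / (m + 1)\<close> to \<open>1 / (m + 2)\<close>.
\<close>

lemma walk_distribution_decay:
  assumes S: "sym_gen_set G S" and c: "c > 0"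
    and quad: "\<And>j. c * 4 ^ j \<le> real (card (word_ball G S (2 ^ j)))"
    and K: "K \<ge> 3" "K \<ge> 32 / c" and m: "m \<le> 2 ^ J" and y: "y \<in> carrier G"
  shows "walk_distribution S J m y \<le> K / real (m + 1)"
  using m y
proof (induction m arbitrary: y)
  case 0
  then show ?case using K by simp
next
  case (Suc m)
  show ?case
  proof (cases "m < 2")
    case True
    have "walk_distribution S J (Suc m) y \<le> 1"
      using sum_walk_distribution_le_1[OF S, of "{y}" J "Suc m"] Suc.prems by simp
    also have "1 \<le> K / real (Suc m + 1)" using True K by (simp add: divide_simps)
    finally show ?thesis .
  next
    case False
    \<comment> \<open>The largest such \<open>j\<close> is the scale at which the walk typically is after \<open>m\<close> steps.\<close>
    define P where "P j \<longleftrightarrow> 4 ^ Suc j \<le> m + 2" for j :: nat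
    have "P 0" using False by (simp add: P_def)
    moreover have bd: "j \<le> J" if "P j" for j
    proof -
      have "4 ^ Suc j \<le> (2::nat) ^ J + 2" using that Suc.prems by (simp add: P_def)
      also have "\<dots> < 4 ^ Suc J"
      proof -
        have "(2::nat) ^ J \<le> 4 ^ J" by (intro power_mono) auto
        moreover have "1 \<le> (4::nat) ^ J" by simp
        ultimately show ?thesis unfolding power_Suc by linarith
      qed
      finally show "j \<le> J" by (simp add: power_strict_increasing_iff)
    qed
    ultimately obtain j where j: "P j" "\<not> P (Suc j)"
    proof -
      assume *: "\<And>j. P j \<Longrightarrow> \<not> P (Suc j) \<Longrightarrow> thesis"
      show thesis
      proof (rule ccontr)
        assume "\<not> thesis"
        then have "P j" for j using * \<open>P 0\<close> by (induction j) auto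
        then have "Suc J \<le> J" using bd by blast
        then show False by simp
      qed
    qed
    define t where "t = real m + 2"
    have t: "t \<ge> 4" using False by (simp add: t_def)
    define e where "e = (1 / 4 :: real) ^ j"
    have e4: "e = 1 / 4 ^ j" by (simp add: e_def power_one_over)
    have "real (4 ^ Suc j) \<le> real (m + 2)" using j(1) unfolding P_def of_nat_le_iff .
    then have e1: "4 / t \<le> e" using t by (simp add: e4 t_def field_simps)
    have "real (m + 2) < real (4 ^ Suc (Suc j))" using j(2) unfolding P_def of_nat_less_iff not_le .
    then have e2: "e \<le> 16 / t" using t by (simp add: e4 t_def field_simps)
    let ?w = "multiscale_weight J j" and ?N = "real (card (word_ball G S (2 ^ j)))"
    have w: "3 / t \<le> ?w" "0 \<le> ?w" "?w \<le> 1"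
    proof -
      show "3 / t \<le> ?w" using multiscale_weight_bounds(1)[of j J] e1 by (simp add: e_def[symmetric])
      have "?w \<le> (1 / 4) ^ j" by (rule multiscale_weight_bounds(2))
      also have "\<dots> \<le> 1" by (simp add: power_le_one)
      finally show "?w \<le> 1" .
    qed (rule multiscale_weight_nonneg)
    have N: "1 / ?N \<le> K / (2 * t)"
    proof -
      have "0 < c * 4 ^ j" using c by simp
      then have "1 / ?N \<le> 1 / (c * 4 ^ j)"
        using quad[of j] by (intro frac_le) auto
      also have "\<dots> = e / c" by (simp add: e4)
      also have "\<dots> \<le> (16 / t) / c" using e2 c by (intro divide_right_mono) auto
      also have "\<dots> = (32 / c) / (2 * t)" by simp
      also have "\<dots> \<le> K / (2 * t)" using K t by (intro divide_right_mono) auto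
      finally show ?thesis .
    qed
    have "walk_distribution S J (Suc m) y \<le> ?w / ?N + (1 - ?w) * (K / real (m + 1))"
      using Suc.prems Suc.IH bd[OF j(1)] by (intro walk_distribution_step_le[OF S]) auto
    also have "\<dots> \<le> ?w * (K / (2 * t)) + (1 - ?w) * (K / (t - 1))"
      using mult_left_mono[OF N w(2)] by (simp add: t_def)
    also have "\<dots> = K / (t - 1) - ?w * (K / (t - 1) - K / (2 * t))"
    proof -
      have "w * v + (1 - w) * u = u - w * (u - v)" for u v w :: real by (simp add: algebra_simps)
      then show ?thesis .
    qed
    also have "\<dots> \<le> K / (t - 1) - (3 / t) * (K / (2 * (t - 1)))"
    proof -
      define u where "u = K / (2 * (t - 1))"
      have "K / (2 * t) \<le> u" unfolding u_def using K t by (intro divide_left_mono) auto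
      moreover have "K / (t - 1) = 2 * u" using t by (simp add: u_def divide_simps)
      ultimately have "u \<le> K / (t - 1) - K / (2 * t)" by linarith
      moreover have "0 \<le> u" using K t by (simp add: u_def)
      ultimately have "(3 / t) * u \<le> ?w * (K / (t - 1) - K / (2 * t))"
        using w by (intro mult_mono) auto
      then show ?thesis by (simp add: u_def)
    qed
    also have "\<dots> \<le> K / t"
      using K t by (simp add: divide_simps) (simp add: algebra_simps)
    finally show ?thesis by (simp add: t_def add.commute)
  qed
qed

text \<open>
  The expected number of visits to \<open>z\<close> is the probability of reaching \<open>z\<close> times the expected
  number of visits from then on, and the latter is at most \<open>\<Gamma>\<close>. The case distinction at \<open>x = z\<close>
  repairs the convention for the time zero.
\<close>

lemma expected_visits_le_hitting:
  assumes S: "sym_gen_set G S" and z: "z \<in> carrier G" and x: "x \<in> carrier G" and m: "m \<le> n"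
    and \<Gamma>: "\<And>y. y \<in> carrier G \<Longrightarrow> (\<Sum>i\<le>n. walk_distribution S J i y) \<le> \<Gamma>"
  shows "(\<Sum>i\<le>m. walk_distribution S J i (inv x \<otimes> z)) \<le> \<Gamma> * (if x = z then 1 else 1 - avoidance S J z m x)"
  using x m
proof (induction m arbitrary: x)
  case 0
  have "walk_distribution S J 0 \<one> \<le> (\<Sum>i\<le>n. walk_distribution S J i \<one>)"
    by (rule member_le_sum) (auto simp: walk_distribution_nonneg)
  then have "1 \<le> \<Gamma>" using \<Gamma>[of \<one>] by simp
  moreover have "inv x \<otimes> z = \<one> \<longleftrightarrow> x = z"
    using 0 z by (metis inv_closed inv_equality inv_inv l_inv)
  ultimately show ?case using 0 by simp
next
  case (Suc m)
  show ?case
  proof (cases "x = z")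
    case True
    have "(\<Sum>i\<le>Suc m. walk_distribution S J i (inv x \<otimes> z)) \<le> (\<Sum>i\<le>n. walk_distribution S J i (inv x \<otimes> z))"
      using Suc.prems by (intro sum_mono2) (auto simp: walk_distribution_nonneg)
    also have "\<dots> \<le> \<Gamma>" using Suc.prems z by (intro \<Gamma>) simp
    finally show ?thesis using True by simp
  next
    case False
    let ?\<mu> = "multiscale_step S J" and ?U = "word_ball G S (2 ^ J)"
    have ne: "inv x \<otimes> z \<noteq> \<one>"
      using False Suc.prems z by (metis inv_closed inv_equality inv_inv)
    have "(\<Sum>i\<le>Suc m. walk_distribution S J i (inv x \<otimes> z)) = (\<Sum>i\<le>m. walk_distribution S J (Suc i) (inv x \<otimes> z))"
      using ne by (simp add: sum.atMost_Suc_shift del: sum.atMost_Suc walk_distribution.simps(2))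
    also have "\<dots> = (\<Sum>s\<in>?U. ?\<mu> s * (\<Sum>i\<le>m. walk_distribution S J i (inv s \<otimes> (inv x \<otimes> z))))"
      by (simp add: sum_distrib_left sum.swap[of _ "{..m}"])
    also have "\<dots> \<le> (\<Sum>s\<in>?U. ?\<mu> s * (\<Gamma> * (1 - (if x \<otimes> s = z then 0 else avoidance S J z m (x \<otimes> s)))))"
    proof (intro sum_mono mult_left_mono multiscale_step_nonneg)
      fix s assume "s \<in> ?U"
      then have s: "s \<in> carrier G" using word_ball_carrier by auto
      have "inv s \<otimes> (inv x \<otimes> z) = inv (x \<otimes> s) \<otimes> z" using s Suc.prems z by (simp add: inv_mult_group m_assoc)
      moreover have "(\<Sum>i\<le>m. walk_distribution S J i (inv (x \<otimes> s) \<otimes> z)) \<le> \<Gamma> * (if x \<otimes> s = z then 1 else 1 - avoidance S J z m (x \<otimes> s))"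
        using s Suc.prems by (intro Suc.IH) auto
      ultimately show "(\<Sum>i\<le>m. walk_distribution S J i (inv s \<otimes> (inv x \<otimes> z))) \<le> \<Gamma> * (1 - (if x \<otimes> s = z then 0 else avoidance S J z m (x \<otimes> s)))"
        by (auto split: if_splits)
    qed
    also have "\<dots> = \<Gamma> * ((\<Sum>s\<in>?U. ?\<mu> s) - (\<Sum>s\<in>?U. ?\<mu> s * (if x \<otimes> s = z then 0 else avoidance S J z m (x \<otimes> s))))"
      unfolding sum_subtractf[symmetric] sum_distrib_left by (intro sum.cong refl) (simp add: algebra_simps)
    also have "\<dots> = \<Gamma> * (1 - avoidance S J z (Suc m) x)"
      using False by (simp add: sum_multiscale_step_1[OF S])
    finally show ?thesis using False by simp
  qed
qed

text \<open>
  Summing the previous estimate over \<open>z\<close>: the visits at the times \<open>0, \<dots>, n\<close> number \<open>n + 1\<close>, and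
  each visited point accounts for at most \<open>\<Gamma>\<close> of them on average.
\<close>

lemma expected_range_ge:
  assumes S: "sym_gen_set G S" and x: "x \<in> carrier G" and n: "n \<ge> 1"
    and Y: "finite Y" "Y \<subseteq> carrier G" and near: "\<And>y. y \<in> carrier G \<Longrightarrow> real (word_dist G S x y) \<le> real n * 2 ^ J \<Longrightarrow> y \<in> Y"
    and \<Gamma>: "\<And>y. y \<in> carrier G \<Longrightarrow> (\<Sum>i\<le>n. walk_distribution S J i y) \<le> \<Gamma>"
  shows "real n \<le> \<Gamma> * (\<Sum>z\<in>Y. 1 - avoidance S J z n x)"
proof -
  have "real n \<le> (\<Sum>i\<le>n. 1)" by simp
  also have "\<dots> = (\<Sum>i\<le>n. \<Sum>z\<in>Y. walk_distribution S J i (inv x \<otimes> z))"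
  proof (rule sum.cong[OF refl])
    fix i assume i: "i \<in> {..n}"
    have xi: "inv x \<in> carrier G" using x by simp
    have "(\<Sum>z\<in>Y. walk_distribution S J i (inv x \<otimes> z)) = (\<Sum>y\<in>(\<lambda>z. inv x \<otimes> z) ` Y. walk_distribution S J i y)"
      using inj_on_mult_left[OF xi Y(2)] by (simp add: sum.reindex)
    also have "\<dots> = 1"
    proof (rule sum_walk_distribution_eq_1[OF S])
      show "word_ball G S (real i * 2 ^ J) \<subseteq> (\<lambda>z. inv x \<otimes> z) ` Y"
      proof
        fix y assume y: "y \<in> word_ball G S (real i * 2 ^ J)"
        then have yc: "y \<in> carrier G" using word_ball_carrier by auto
        have xy: "inv x \<otimes> (x \<otimes> y) = y" using x yc by (simp flip: m_assoc)
        have "real (word_length G S y) \<le> real i * 2 ^ J" using y by (simp add: word_ball_eq)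
        also have "\<dots> \<le> real n * 2 ^ J" using i by (intro mult_right_mono) auto
        finally have "x \<otimes> y \<in> Y" using near[of "x \<otimes> y"] x yc xy by (simp add: word_dist_def)
        then show "y \<in> (\<lambda>z. inv x \<otimes> z) ` Y" using xy by (metis image_eqI)
      qed
    qed (use Y xi in auto)
    finally show "1 = (\<Sum>z\<in>Y. walk_distribution S J i (inv x \<otimes> z))" by simp
  qed
  also have "\<dots> = (\<Sum>z\<in>Y. \<Sum>i\<le>n. walk_distribution S J i (inv x \<otimes> z))" by (rule sum.swap)
  also have "\<dots> \<le> (\<Sum>z\<in>Y. \<Gamma> * (1 - avoidance S J z n x))"
  proof (rule sum_mono)
    fix z assume z: "z \<in> Y"
    then have "(\<Sum>i\<le>n. walk_distribution S J i (inv x \<otimes> z)) \<le> \<Gamma> * (if x = z then 1 else 1 - avoidance S J z n x)"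
      using Y x by (intro expected_visits_le_hitting[OF S _ _ order_refl \<Gamma>]) auto
    then show "(\<Sum>i\<le>n. walk_distribution S J i (inv x \<otimes> z)) \<le> \<Gamma> * (1 - avoidance S J z n x)"
      using n by (cases n) (auto split: if_splits)
  qed
  finally show ?thesis by (simp add: sum_distrib_left)
qed

text \<open>The decay is summable up to a logarithm, that is, linearly in \<open>J\<close> for \<open>2 ^ J\<close> steps.\<close>

lemma expected_visits_bound:
  assumes S: "sym_gen_set G S" and c: "c > 0"
    and quad: "\<And>j. c * 4 ^ j \<le> real (card (word_ball G S (2 ^ j)))"
    and K: "K \<ge> 3" "K \<ge> 32 / c" and y: "y \<in> carrier G"
  shows "(\<Sum>i\<le>2 ^ J. walk_distribution S J i y) \<le> K * real (J + 2)"
proof -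
  have harm: "(\<Sum>i<2 ^ k. 1 / real (i + 1)) \<le> real (k + 1)" for k :: nat
  proof (induction k)
    case (Suc k)
    have "(\<Sum>i<2 ^ Suc k. 1 / real (i + 1)) = (\<Sum>i<2 ^ k. 1 / real (i + 1)) + (\<Sum>i\<in>{2 ^ k..<2 ^ Suc k}. 1 / real (i + 1))"
      by (subst sum.union_disjoint[symmetric]) (auto intro!: sum.cong)
    also have "(\<Sum>i\<in>{2 ^ k..<2 ^ Suc k}. 1 / real (i + 1)) \<le> (\<Sum>i\<in>{2 ^ k..<(2::nat) ^ Suc k}. 1 / 2 ^ k)"
    proof (rule sum_mono)
      fix i assume "i \<in> {2 ^ k..<(2::nat) ^ Suc k}"
      then have "real (2 ^ k) \<le> real (i + 1)" unfolding of_nat_le_iff by simp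
      then show "1 / real (i + 1) \<le> 1 / 2 ^ k" by (intro divide_left_mono) auto
    qed
    also have "\<dots> = 1" by simp
    finally show ?case using Suc.IH by simp
  qed simp
  have "(\<Sum>i\<le>2 ^ J. walk_distribution S J i y) \<le> (\<Sum>i\<le>2 ^ J. K * (1 / real (i + 1)))"
    using walk_distribution_decay[OF S c quad K _ y] by (intro sum_mono) auto
  also have "\<dots> = K * (\<Sum>i\<le>2 ^ J. 1 / real (i + 1))" by (simp only: sum_distrib_left)
  also have "(\<Sum>i\<le>2 ^ J. 1 / real (i + 1)) = (\<Sum>i<2 ^ J. 1 / real (i + 1)) + 1 / real (2 ^ J + 1)"
    by (simp add: lessThan_Suc_atMost[symmetric])
  also have "K * \<dots> \<le> K * (real (J + 1) + 1)"
    using harm[of J] K by (intro mult_left_mono add_mono) (auto simp: divide_le_eq_1_pos add_pos_pos)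
  finally show ?thesis by (simp add: algebra_simps)
qed

end

section \<open>Energies of the lamplighter walk\<close>

definition kernel_square :: "'x set \<Rightarrow> ('x \<Rightarrow> 'x \<Rightarrow> real) \<Rightarrow> 'x \<Rightarrow> 'x \<Rightarrow> real" where
  "kernel_square A \<kappa> a b = (\<Sum>c\<in>A. \<kappa> a c * \<kappa> c b)"

definition apply_kernel :: "'x set \<Rightarrow> ('x \<Rightarrow> 'x \<Rightarrow> real) \<Rightarrow> ('x \<Rightarrow> real) \<Rightarrow> 'x \<Rightarrow> real" where
  "apply_kernel A \<kappa> \<phi> a = (\<Sum>b\<in>A. \<kappa> a b * \<phi> b)"

text \<open>A symmetric kernel that may lose mass.\<close>

definition sub_markov :: "'x set \<Rightarrow> ('x \<Rightarrow> 'x \<Rightarrow> real) \<Rightarrow> bool" where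
  "sub_markov A \<kappa> \<longleftrightarrow> (\<forall>a\<in>A. \<forall>b\<in>A. 0 \<le> \<kappa> a b \<and> \<kappa> a b = \<kappa> b a) \<and> (\<forall>a\<in>A. (\<Sum>b\<in>A. \<kappa> a b) \<le> 1)"

definition energy :: "real \<Rightarrow> 'x set \<Rightarrow> ('x \<Rightarrow> 'x \<Rightarrow> real) \<Rightarrow> ('x \<Rightarrow> real \<Rightarrow> real) \<Rightarrow> real" where
  "energy p A \<kappa> f = (\<Sum>a\<in>A. \<Sum>b\<in>A. \<kappa> a b * Lp_dist p (f a) (f b) powr p)"

lemma apply_kernel_square: "apply_kernel A (kernel_square A \<kappa>) \<phi> = apply_kernel A \<kappa> (apply_kernel A \<kappa> \<phi>)"
  unfolding apply_kernel_def kernel_square_def sum_distrib_left sum_distrib_right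
  by (subst sum.swap) (simp add: mult.assoc)

lemma apply_kernel_iterated_square:
  "apply_kernel A ((kernel_square A ^^ j) \<kappa>) = apply_kernel A \<kappa> ^^ (2 ^ j)"
proof (induction j)
  case (Suc j)
  show ?case
  proof
    fix \<phi>
    have "apply_kernel A ((kernel_square A ^^ Suc j) \<kappa>) \<phi>
        = (apply_kernel A \<kappa> ^^ (2 ^ j)) ((apply_kernel A \<kappa> ^^ (2 ^ j)) \<phi>)"
      by (simp add: apply_kernel_square Suc.IH)
    also have "\<dots> = (apply_kernel A \<kappa> ^^ (2 ^ j + 2 ^ j)) \<phi>" by (simp only: funpow_add o_apply)
    also have "2 ^ j + 2 ^ j = (2::nat) ^ Suc j" by simp
    finally show "apply_kernel A ((kernel_square A ^^ Suc j) \<kappa>) \<phi> = (apply_kernel A \<kappa> ^^ (2 ^ Suc j)) \<phi>" .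
  qed
qed simp

lemma sub_markov_square:
  assumes A: "finite A" and \<kappa>: "sub_markov A \<kappa>"
  shows "sub_markov A (kernel_square A \<kappa>)"
proof -
  have nn: "0 \<le> \<kappa> a b" and sym: "\<kappa> a b = \<kappa> b a" if "a \<in> A" "b \<in> A" for a b
    using \<kappa> that by (auto simp: sub_markov_def)
  have row: "(\<Sum>b\<in>A. \<kappa> a b) \<le> 1" if "a \<in> A" for a using \<kappa> that by (auto simp: sub_markov_def)
  have "(\<Sum>b\<in>A. kernel_square A \<kappa> a b) \<le> 1" if a: "a \<in> A" for a
  proof -
    have "(\<Sum>b\<in>A. kernel_square A \<kappa> a b) = (\<Sum>c\<in>A. \<kappa> a c * (\<Sum>b\<in>A. \<kappa> c b))"
      unfolding kernel_square_def sum_distrib_left by (rule sum.swap)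
    also have "\<dots> \<le> (\<Sum>c\<in>A. \<kappa> a c * 1)"
      using nn row a by (intro sum_mono mult_left_mono) auto
    finally show ?thesis using row[OF a] by simp
  qed
  moreover have "kernel_square A \<kappa> a b = kernel_square A \<kappa> b a" if "a \<in> A" "b \<in> A" for a b
    unfolding kernel_square_def using sym that by (intro sum.cong refl) (metis mult.commute)
  moreover have "0 \<le> kernel_square A \<kappa> a b" if "a \<in> A" "b \<in> A" for a b
    unfolding kernel_square_def using nn that by (intro sum_nonneg mult_nonneg_nonneg) auto
  ultimately show ?thesis by (auto simp: sub_markov_def)
qed

text \<open>
  Two independent steps from a common point \<open>c\<close>: by symmetry the energy of the squared kernel is
  a sum over the middle point, and negative type compares the two ends with it.
\<close>

lemma energy_square_le:
  assumes p: "1 \<le> p" "p \<le> 2" and A: "finite A" and \<kappa>: "sub_markov A \<kappa>"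
    and f: "\<And>a. a \<in> A \<Longrightarrow> f a \<in> Lp_space p"
  shows "energy p A (kernel_square A \<kappa>) f \<le> 2 * energy p A \<kappa> f"
proof -
  let ?D = "\<lambda>a b. Lp_dist p (f a) (f b) powr p"
  have nn: "0 \<le> \<kappa> a b" and sym: "\<kappa> a b = \<kappa> b a" if "a \<in> A" "b \<in> A" for a b
    using \<kappa> that by (auto simp: sub_markov_def)
  have row: "(\<Sum>b\<in>A. \<kappa> a b) \<le> 1" if "a \<in> A" for a using \<kappa> that by (auto simp: sub_markov_def)
  have "energy p A (kernel_square A \<kappa>) f = (\<Sum>a\<in>A. \<Sum>b\<in>A. \<Sum>c\<in>A. \<kappa> a c * \<kappa> c b * ?D a b)"
    by (simp add: energy_def kernel_square_def sum_distrib_right)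
  also have "\<dots> = (\<Sum>a\<in>A. \<Sum>c\<in>A. \<Sum>b\<in>A. \<kappa> a c * \<kappa> c b * ?D a b)"
    by (intro sum.cong refl sum.swap)
  also have "\<dots> = (\<Sum>c\<in>A. \<Sum>a\<in>A. \<Sum>b\<in>A. \<kappa> a c * \<kappa> c b * ?D a b)"
    by (rule sum.swap)
  also have "\<dots> = (\<Sum>c\<in>A. \<Sum>a\<in>A. \<Sum>b\<in>A. \<kappa> c a * \<kappa> c b * ?D a b)"
    by (intro sum.cong refl) (simp add: sym)
  also have "\<dots> \<le> (\<Sum>c\<in>A. 2 * (\<Sum>a\<in>A. \<kappa> c a * Lp_dist p (f a) (f c) powr p))"
    using nn row f by (intro sum_mono Lp_negative_type p A) auto
  also have "\<dots> = 2 * energy p A \<kappa> f"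
    unfolding energy_def sum_distrib_left[symmetric] by (simp add: Lp_dist_commute)
  finally show ?thesis .
qed

text \<open>Markov type: after \<open>2 ^ j\<close> steps the energy has grown at most by the factor \<open>2 ^ j\<close>.\<close>

lemma energy_iterated_square_le:
  assumes p: "1 \<le> p" "p \<le> 2" and A: "finite A" and \<kappa>: "sub_markov A \<kappa>"
    and f: "\<And>a. a \<in> A \<Longrightarrow> f a \<in> Lp_space p"
  shows "sub_markov A ((kernel_square A ^^ j) \<kappa>) \<and> energy p A ((kernel_square A ^^ j) \<kappa>) f \<le> 2 ^ j * energy p A \<kappa> f"
proof (induction j)
  case (Suc j)
  then have "energy p A (kernel_square A ((kernel_square A ^^ j) \<kappa>)) f \<le> 2 * energy p A ((kernel_square A ^^ j) \<kappa>) f"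
    by (intro energy_square_le p A f) auto
  then show ?case using Suc sub_markov_square[OF A] by simp
qed (use \<kappa> in simp)

text \<open>
  A constant of its own rather than the abbreviation \<open>sym_diff\<close>, so that the simplifier does not
  decompose it.
\<close>

definition symdiff :: "'x set \<Rightarrow> 'x set \<Rightarrow> 'x set" where
  "symdiff A B = (A - B) \<union> (B - A)"

lemma symdiff_left_cancel [simp]: "symdiff A (symdiff A B) = B"
  by (auto simp: symdiff_def)

lemma symdiff_right_cancel [simp]: "symdiff (symdiff A B) B = A"
  by (auto simp: symdiff_def)

lemma symdiff_commute: "symdiff A B = symdiff B A"
  by (auto simp: symdiff_def)

lemma in_symdiff: "z \<in> symdiff A B \<longleftrightarrow> (z \<in> A) \<noteq> (z \<in> B)"
  by (auto simp: symdiff_def)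

lemma sum_flips:
  assumes B: "finite B" "A \<subseteq> B" "P \<subseteq> B"
  shows "(\<Sum>A'\<in>Pow B. if symdiff A A' \<subseteq> P then \<phi> A' else 0) = (\<Sum>E\<in>Pow P. \<phi> (symdiff A E) :: real)"
proof -
  have "(\<Sum>A'\<in>Pow B. if symdiff A A' \<subseteq> P then \<phi> A' else 0) = (\<Sum>A'\<in>{A' \<in> Pow B. symdiff A A' \<subseteq> P}. \<phi> A')"
    using B by (subst sum.inter_filter) auto
  also have "\<dots> = (\<Sum>E\<in>Pow P. \<phi> (symdiff A E))"
  proof (rule sum.reindex_bij_witness[where i="symdiff A" and j="symdiff A"])
    show "symdiff A E \<in> {A' \<in> Pow B. symdiff A A' \<subseteq> P}" if "E \<in> Pow P" for E
    proof -
      have "symdiff A E \<subseteq> A \<union> E" by (auto simp: symdiff_def)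
      then have "symdiff A E \<subseteq> B" using that B by blast
      then show ?thesis using that by simp
    qed
  qed auto
  finally show ?thesis .
qed

text \<open>
  The indicator of \<open>z \<in> A\<close>, centred so that randomizing the lamp at \<open>z\<close> annihilates it.
\<close>

definition bit_sign :: "'x \<Rightarrow> 'x set \<Rightarrow> real" where
  "bit_sign z A = (if z \<in> A then 1 / 2 else - 1 / 2)"

text \<open>
  If \<open>z\<close> is among the randomized lamps, flipping it pairs the summands with opposite signs.
\<close>

lemma sum_bit_sign_flips:
  assumes P: "finite P"
  shows "(\<Sum>E\<in>Pow P. bit_sign z (symdiff (symdiff A E) A0)) = (if z \<in> P then 0 else 2 ^ card P * bit_sign z (symdiff A A0))"
proof (cases "z \<in> P")
  case True
  have "(\<Sum>E\<in>Pow P. bit_sign z (symdiff (symdiff A E) A0)) = (\<Sum>E\<in>Pow P. bit_sign z (symdiff (symdiff A (symdiff E {z})) A0))"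
    using True by (intro sum.reindex_bij_witness[where i="\<lambda>E. symdiff E {z}" and j="\<lambda>E. symdiff E {z}"]) (auto simp: in_symdiff)
  also have "\<dots> = (\<Sum>E\<in>Pow P. - bit_sign z (symdiff (symdiff A E) A0))"
    by (intro sum.cong refl) (auto simp: bit_sign_def in_symdiff)
  finally show ?thesis using True by (simp add: sum_negf)
next
  case False
  have "(\<Sum>E\<in>Pow P. bit_sign z (symdiff (symdiff A E) A0)) = (\<Sum>E\<in>Pow P. bit_sign z (symdiff A A0))"
    using False by (intro sum.cong refl) (auto simp: bit_sign_def in_symdiff)
  then show ?thesis using False P by (simp add: card_Pow)
qed

context group
begin

text \<open>
  One step of the lamplighter: randomize the lamp at the current position, move by a step of the
  walk, randomize the lamp at the new position. Randomizing on both sides makes the kernel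
  symmetric.
\<close>

definition lamp_kernel :: "'a set \<Rightarrow> nat \<Rightarrow> 'a set \<times> 'a \<Rightarrow> 'a set \<times> 'a \<Rightarrow> real" where
  "lamp_kernel S J = (\<lambda>(A, x) (A', x').
     if symdiff A A' \<subseteq> {x, x'} then multiscale_step S J (inv x \<otimes> x') / 2 ^ card {x, x'} else 0)"

lemma sum_lamp_kernel:
  assumes B: "finite B" and A: "A \<subseteq> B" and x: "x \<in> B"
  shows "(\<Sum>b\<in>Pow B \<times> B. lamp_kernel S J (A, x) b * \<phi> b)
    = (\<Sum>x'\<in>B. multiscale_step S J (inv x \<otimes> x') / 2 ^ card {x, x'} * (\<Sum>E\<in>Pow {x, x'}. \<phi> (symdiff A E, x')))"
proof -
  have "(\<Sum>b\<in>Pow B \<times> B. lamp_kernel S J (A, x) b * \<phi> b)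
      = (\<Sum>x'\<in>B. \<Sum>A'\<in>Pow B. lamp_kernel S J (A, x) (A', x') * \<phi> (A', x'))"
    unfolding sum.cartesian_product' by (subst sum.swap) simp
  also have "\<dots> = (\<Sum>x'\<in>B. multiscale_step S J (inv x \<otimes> x') / 2 ^ card {x, x'} * (\<Sum>E\<in>Pow {x, x'}. \<phi> (symdiff A E, x')))"
  proof (rule sum.cong[OF refl])
    fix x' assume x': "x' \<in> B"
    have "(\<Sum>A'\<in>Pow B. lamp_kernel S J (A, x) (A', x') * \<phi> (A', x'))
        = multiscale_step S J (inv x \<otimes> x') / 2 ^ card {x, x'} * (\<Sum>A'\<in>Pow B. if symdiff A A' \<subseteq> {x, x'} then \<phi> (A', x') else 0)"
      unfolding sum_distrib_left lamp_kernel_def by (intro sum.cong refl) simp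
    also have "(\<Sum>A'\<in>Pow B. if symdiff A A' \<subseteq> {x, x'} then \<phi> (A', x') else 0) = (\<Sum>E\<in>Pow {x, x'}. \<phi> (symdiff A E, x'))"
      using x x' by (intro sum_flips B A) auto
    finally show "(\<Sum>A'\<in>Pow B. lamp_kernel S J (A, x) (A', x') * \<phi> (A', x'))
        = multiscale_step S J (inv x \<otimes> x') / 2 ^ card {x, x'} * (\<Sum>E\<in>Pow {x, x'}. \<phi> (symdiff A E, x'))" .
  qed
  finally show ?thesis .
qed

lemma sum_lamp_kernel_position:
  assumes B: "finite B" and A: "A \<subseteq> B" and x: "x \<in> B"
  shows "(\<Sum>b\<in>Pow B \<times> B. lamp_kernel S J (A, x) b * \<psi> (snd b)) = (\<Sum>x'\<in>B. multiscale_step S J (inv x \<otimes> x') * \<psi> x')"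
  unfolding sum_lamp_kernel[OF assms] by (intro sum.cong refl) (simp add: card_Pow)

lemma sum_step_translate_le:
  assumes S: "sym_gen_set G S" and B: "finite B" "B \<subseteq> carrier G" and x: "x \<in> carrier G"
    and \<psi>: "\<And>s. 0 \<le> \<psi> s"
  shows "(\<Sum>x'\<in>B. multiscale_step S J (inv x \<otimes> x') * \<psi> (inv x \<otimes> x'))
    \<le> (\<Sum>s\<in>word_ball G S (2 ^ J). multiscale_step S J s * \<psi> s)"
proof -
  have xi: "inv x \<in> carrier G" using x by simp
  have "(\<Sum>x'\<in>B. multiscale_step S J (inv x \<otimes> x') * \<psi> (inv x \<otimes> x'))
      = (\<Sum>s\<in>(\<lambda>x'. inv x \<otimes> x') ` B. multiscale_step S J s * \<psi> s)"
    using inj_on_mult_left[OF xi B(2)] by (simp add: sum.reindex)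
  also have "\<dots> = (\<Sum>s\<in>(\<lambda>x'. inv x \<otimes> x') ` B \<inter> word_ball G S (2 ^ J). multiscale_step S J s * \<psi> s)"
    using B multiscale_step_outside by (intro sum.mono_neutral_right) auto
  also have "\<dots> \<le> (\<Sum>s\<in>word_ball G S (2 ^ J). multiscale_step S J s * \<psi> s)"
    using finite_word_ball[OF S] multiscale_step_nonneg \<psi> by (intro sum_mono2) auto
  finally show ?thesis .
qed

lemma sum_step_translate:
  assumes S: "sym_gen_set G S" and B: "finite B" "B \<subseteq> carrier G" and x: "x \<in> carrier G"
    and inside: "\<And>s. s \<in> word_ball G S (2 ^ J) \<Longrightarrow> x \<otimes> s \<in> B"
  shows "(\<Sum>x'\<in>B. multiscale_step S J (inv x \<otimes> x') * \<psi> x')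
    = (\<Sum>s\<in>word_ball G S (2 ^ J). multiscale_step S J s * \<psi> (x \<otimes> s))"
proof -
  let ?U = "word_ball G S (2 ^ J)"
  have "(\<Sum>x'\<in>B. multiscale_step S J (inv x \<otimes> x') * \<psi> x')
      = (\<Sum>x'\<in>(\<lambda>s. x \<otimes> s) ` ?U. multiscale_step S J (inv x \<otimes> x') * \<psi> x')"
  proof (rule sum.mono_neutral_right[OF B(1)])
    show "(\<lambda>s. x \<otimes> s) ` ?U \<subseteq> B" using inside by auto
    show "\<forall>x'\<in>B - (\<lambda>s. x \<otimes> s) ` ?U. multiscale_step S J (inv x \<otimes> x') * \<psi> x' = 0"
    proof
      fix x' assume x': "x' \<in> B - (\<lambda>s. x \<otimes> s) ` ?U"
      then have "x' = x \<otimes> (inv x \<otimes> x')" using x B by (auto simp flip: m_assoc)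
      then have "inv x \<otimes> x' \<notin> ?U" using x' by (metis DiffD2 image_eqI)
      then show "multiscale_step S J (inv x \<otimes> x') * \<psi> x' = 0" by (simp add: multiscale_step_outside)
    qed
  qed
  also have "\<dots> = (\<Sum>s\<in>?U. multiscale_step S J (inv x \<otimes> (x \<otimes> s)) * \<psi> (x \<otimes> s))"
    using inj_on_mult_left[OF x word_ball_carrier] by (simp add: sum.reindex)
  also have "\<dots> = (\<Sum>s\<in>?U. multiscale_step S J s * \<psi> (x \<otimes> s))"
  proof (rule sum.cong[OF refl])
    fix s assume "s \<in> ?U"
    then have "s \<in> carrier G" using word_ball_carrier by blast
    then have "inv x \<otimes> (x \<otimes> s) = s" using x by (simp flip: m_assoc)
    then show "multiscale_step S J (inv x \<otimes> (x \<otimes> s)) * \<psi> (x \<otimes> s) = multiscale_step S J s * \<psi> (x \<otimes> s)" by simp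
  qed
  finally show ?thesis .
qed

lemma sub_markov_lamp_kernel:
  assumes S: "sym_gen_set G S" and B: "finite B" "B \<subseteq> carrier G"
  shows "sub_markov (Pow B \<times> B) (lamp_kernel S J)"
proof -
  have nonneg: "0 \<le> lamp_kernel S J a b" for a b
    by (cases a; cases b) (simp add: lamp_kernel_def multiscale_step_nonneg)
  have sym: "lamp_kernel S J a b = lamp_kernel S J b a" if ab: "a \<in> Pow B \<times> B" "b \<in> Pow B \<times> B" for a b
  proof -
    obtain A x A' x' where eq: "a = (A, x)" "b = (A', x')" by (metis surj_pair)
    have xx: "x \<in> carrier G" "x' \<in> carrier G" using ab B by (auto simp: eq)
    have "multiscale_step S J (inv x' \<otimes> x) = multiscale_step S J (inv (inv x \<otimes> x'))"
      using xx by (simp add: inv_mult_group)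
    also have "\<dots> = multiscale_step S J (inv x \<otimes> x')" using xx by (intro multiscale_step_inv[OF S]) simp
    finally show ?thesis by (simp add: eq lamp_kernel_def symdiff_commute insert_commute)
  qed
  have row: "(\<Sum>b\<in>Pow B \<times> B. lamp_kernel S J a b) \<le> 1" if a: "a \<in> Pow B \<times> B" for a
  proof -
    obtain A x where eq: "a = (A, x)" by (metis surj_pair)
    have Ax: "A \<subseteq> B" "x \<in> B" using a by (auto simp: eq)
    have "(\<Sum>b\<in>Pow B \<times> B. lamp_kernel S J a b) = (\<Sum>x'\<in>B. multiscale_step S J (inv x \<otimes> x'))"
      using sum_lamp_kernel_position[OF B(1) Ax, of S J "\<lambda>_. 1"] by (simp add: eq)
    also have "\<dots> \<le> (\<Sum>s\<in>word_ball G S (2 ^ J). multiscale_step S J s)"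
      using sum_step_translate_le[OF S B, of x "\<lambda>_. 1" J] Ax B by auto
    also have "\<dots> = 1" by (rule sum_multiscale_step_1[OF S])
    finally show ?thesis .
  qed
  show ?thesis using nonneg sym row unfolding sub_markov_def by blast
qed

text \<open>
  The lamp at \<open>z\<close> is uniformly random if the walk has met \<open>z\<close> and unchanged otherwise. Starting
  points at distance at least \<open>m * 2 ^ J\<close> from the boundary of the box do not feel that the walk
  is killed there.
\<close>

lemma lamp_kernel_iterate:
  assumes S: "sym_gen_set G S" and A0: "A0 \<subseteq> word_ball G S r"
    and A: "A \<subseteq> word_ball G S r" and x: "x \<in> carrier G" and deep: "real (word_length G S x) + real m * 2 ^ J \<le> r"
  shows "(apply_kernel (Pow (word_ball G S r) \<times> word_ball G S r) (lamp_kernel S J) ^^ m)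
      (\<lambda>(A', x'). 1 / 2 + bit_sign z (symdiff A' A0)) (A, x)
    = 1 / 2 + bit_sign z (symdiff A A0) * avoidance S J z m x"
  using A x deep
proof (induction m arbitrary: A x)
  case 0
  then show ?case by simp
next
  case (Suc m)
  let ?B = "word_ball G S r"
  let ?P = "apply_kernel (Pow ?B \<times> ?B) (lamp_kernel S J)"
  let ?\<mu> = "multiscale_step S J" and ?U = "word_ball G S (2 ^ J)"
  have B: "finite ?B" "?B \<subseteq> carrier G" using finite_word_ball[OF S] word_ball_carrier by auto
  have "0 \<le> real (Suc m) * 2 ^ J" by simp
  then have xB: "x \<in> ?B" using Suc.prems unfolding word_ball_eq mem_Collect_eq by linarith
  have step: "real (word_length G S (x \<otimes> s)) + real m * 2 ^ J \<le> r" "x \<otimes> s \<in> carrier G" if "s \<in> ?U" for s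
  proof -
    have s: "s \<in> carrier G" "real (word_length G S s) \<le> 2 ^ J" using that by (auto simp: word_ball_eq)
    have "word_length G S (x \<otimes> s) \<le> word_length G S x + word_length G S s"
      using s Suc.prems by (intro word_length_mult[OF S]) auto
    moreover have "real (Suc m) * 2 ^ J = 2 ^ J + real m * 2 ^ J" by (simp add: algebra_simps)
    ultimately show "real (word_length G S (x \<otimes> s)) + real m * 2 ^ J \<le> r"
      using s(2) Suc.prems(3) by linarith
    show "x \<otimes> s \<in> carrier G" using s Suc.prems by simp
  qed
  have inside: "x \<otimes> s \<in> ?B" if "s \<in> ?U" for s
  proof -
    have "0 \<le> real m * 2 ^ J" by simp
    then show ?thesis using step[OF that] unfolding word_ball_eq mem_Collect_eq by linarith
  qed
  have "(?P ^^ Suc m) (\<lambda>(A', x'). 1 / 2 + bit_sign z (symdiff A' A0)) (A, x)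
      = (\<Sum>b\<in>Pow ?B \<times> ?B. lamp_kernel S J (A, x) b * (?P ^^ m) (\<lambda>(A', x'). 1 / 2 + bit_sign z (symdiff A' A0)) b)"
    by (simp add: apply_kernel_def)
  also have "\<dots> = (\<Sum>b\<in>Pow ?B \<times> ?B. lamp_kernel S J (A, x) b * (1 / 2 + bit_sign z (symdiff (fst b) A0) * avoidance S J z m (snd b)))"
  proof (rule sum.cong[OF refl])
    fix b assume b: "b \<in> Pow ?B \<times> ?B"
    obtain A' x' where eq: "b = (A', x')" by (metis surj_pair)
    have b': "A' \<subseteq> ?B" "x' \<in> carrier G" using b B by (auto simp: eq)
    show "lamp_kernel S J (A, x) b * (?P ^^ m) (\<lambda>(A', x'). 1 / 2 + bit_sign z (symdiff A' A0)) b
        = lamp_kernel S J (A, x) b * (1 / 2 + bit_sign z (symdiff (fst b) A0) * avoidance S J z m (snd b))"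
    proof (cases "inv x \<otimes> x' \<in> ?U")
      case True
      have "x' = x \<otimes> (inv x \<otimes> x')" using Suc.prems b' by (simp flip: m_assoc)
      then have "real (word_length G S x') + real m * 2 ^ J \<le> r" using step(1)[OF True] by simp
      then have "(?P ^^ m) (\<lambda>(A', x'). 1 / 2 + bit_sign z (symdiff A' A0)) (A', x') = 1 / 2 + bit_sign z (symdiff A' A0) * avoidance S J z m x'"
        by (intro Suc.IH b')
      then show ?thesis by (simp add: eq)
    next
      case False
      then show ?thesis by (simp add: eq lamp_kernel_def multiscale_step_outside)
    qed
  qed
  also have "\<dots> = (\<Sum>x'\<in>?B. ?\<mu> (inv x \<otimes> x') * (1 / 2 + (if z \<in> {x, x'} then 0 else bit_sign z (symdiff A A0) * avoidance S J z m x')))"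
    unfolding sum_lamp_kernel[OF B(1) Suc.prems(1) xB]
  proof (rule sum.cong[OF refl])
    fix x'
    have "(\<Sum>E\<in>Pow {x, x'}. 1 / 2 + bit_sign z (symdiff (symdiff A E) A0) * avoidance S J z m x')
        = 2 ^ card {x, x'} * (1 / 2) + (\<Sum>E\<in>Pow {x, x'}. bit_sign z (symdiff (symdiff A E) A0)) * avoidance S J z m x'"
      by (simp add: sum.distrib sum_distrib_right card_Pow)
    also have "\<dots> = 2 ^ card {x, x'} * (1 / 2 + (if z \<in> {x, x'} then 0 else bit_sign z (symdiff A A0) * avoidance S J z m x'))"
      by (subst sum_bit_sign_flips) (auto simp: algebra_simps)
    finally show "?\<mu> (inv x \<otimes> x') / 2 ^ card {x, x'} * (\<Sum>E\<in>Pow {x, x'}. 1 / 2 + bit_sign z (symdiff (fst (symdiff A E, x')) A0) * avoidance S J z m (snd (symdiff A E, x')))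
        = ?\<mu> (inv x \<otimes> x') * (1 / 2 + (if z \<in> {x, x'} then 0 else bit_sign z (symdiff A A0) * avoidance S J z m x'))"
      by simp
  qed
  also have "\<dots> = (\<Sum>s\<in>?U. ?\<mu> s * (1 / 2 + (if z \<in> {x, x \<otimes> s} then 0 else bit_sign z (symdiff A A0) * avoidance S J z m (x \<otimes> s))))"
    by (rule sum_step_translate[OF S B Suc.prems(2) inside])
  also have "\<dots> = (\<Sum>s\<in>?U. ?\<mu> s) * (1 / 2) + bit_sign z (symdiff A A0) * avoidance S J z (Suc m) x"
  proof (cases "x = z")
    case True
    then show ?thesis by (simp add: sum_distrib_right)
  next
    case False
    have "(\<Sum>s\<in>?U. ?\<mu> s * (1 / 2 + (if z \<in> {x, x \<otimes> s} then 0 else bit_sign z (symdiff A A0) * avoidance S J z m (x \<otimes> s))))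
        = (\<Sum>s\<in>?U. ?\<mu> s * (1 / 2) + bit_sign z (symdiff A A0) * (?\<mu> s * (if x \<otimes> s = z then 0 else avoidance S J z m (x \<otimes> s))))"
      using False by (intro sum.cong refl) (auto simp: algebra_simps)
    also have "\<dots> = (\<Sum>s\<in>?U. ?\<mu> s) * (1 / 2) + bit_sign z (symdiff A A0) * avoidance S J z (Suc m) x"
      using False by (simp add: sum.distrib sum_distrib_left sum_distrib_right)
    finally show ?thesis .
  qed
  finally show ?case by (simp add: sum_multiscale_step_1[OF S])
qed

end

section \<open>The compression exponents\<close>

text \<open>
  A linear lower bound for the power. Unlike the inequality of Jensen it can be integrated
  against a measure of mass less than one.
\<close>

lemma powr_ge_affine:
  fixes N \<eta> \<gamma> :: real
  assumes "1 \<le> \<gamma>" "0 < \<eta>" "0 \<le> N"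
  shows "\<eta> powr (\<gamma> - 1) * (N - \<eta>) \<le> N powr \<gamma>"
proof (cases "N \<le> \<eta>")
  case True
  have "\<eta> powr (\<gamma> - 1) * (N - \<eta>) \<le> 0" using True by (intro mult_nonneg_nonpos) auto
  then show ?thesis using powr_ge_zero[of N \<gamma>] by linarith
next
  case False
  have "\<eta> powr (\<gamma> - 1) * (N - \<eta>) \<le> N powr (\<gamma> - 1) * N"
    using False assms by (intro mult_mono powr_mono2) auto
  also have "\<dots> = N powr \<gamma>" using False assms by (simp add: powr_diff)
  finally show ?thesis .
qed

context group
begin

text \<open>
  Each scale contributes a bounded amount, because the weight \<open>4 ^ (- j)\<close> compensates the square
  of the step length.
\<close>

lemma step_moment_le:
  assumes S: "sym_gen_set G S" and p: "0 \<le> p" "p \<le> 2" and L: "0 \<le> L"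
  shows "(\<Sum>s\<in>word_ball G S (2 ^ J). multiscale_step S J s * (L * (3 * real (word_length G S s) + 2)) powr p)
    \<le> 25 * real (J + 1) * L powr p"
proof -
  have "(\<Sum>s\<in>word_ball G S (2 ^ J). multiscale_step S J s * (L * (3 * real (word_length G S s) + 2)) powr p)
      \<le> (\<Sum>j\<le>J. (1 / 4) ^ j * (25 * 4 ^ j * L powr p))"
    unfolding sum_multiscale_step[OF S]
  proof (intro sum_mono mult_mono multiscale_weight_bounds)
    fix j
    let ?N = "real (card (word_ball G S (2 ^ j)))"
    have N: "?N > 0" using card_word_ball_pos[OF S, of "2 ^ j"] by simp
    have "(\<Sum>s\<in>word_ball G S (2 ^ j). (L * (3 * real (word_length G S s) + 2)) powr p)
        \<le> (\<Sum>s\<in>word_ball G S (2 ^ j). 25 * 4 ^ j * L powr p)"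
    proof (rule sum_mono)
      fix s assume "s \<in> word_ball G S (2 ^ j)"
      then have s: "real (word_length G S s) \<le> 2 ^ j" by (simp add: word_ball_eq)
      have one: "1 \<le> (2::real) ^ j" by simp
      have "(3 * real (word_length G S s) + 2) powr p \<le> (5 * 2 ^ j) powr p"
        using s one p by (intro powr_mono2) linarith+
      also have "\<dots> \<le> (5 * 2 ^ j) powr 2" using one p by (intro powr_mono) linarith+
      also have "\<dots> = (5 * 2 ^ j)\<^sup>2" using one by (intro powr_numeral) linarith
      also have "\<dots> = 25 * 4 ^ j"
      proof -
        have "((2::real) ^ j)\<^sup>2 = 4 ^ j" by (simp add: power2_eq_square flip: power_mult_distrib)
        then show ?thesis by (simp add: power_mult_distrib)
      qed
      finally have "(3 * real (word_length G S s) + 2) powr p \<le> 25 * 4 ^ j" .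
      then have "L powr p * (3 * real (word_length G S s) + 2) powr p \<le> L powr p * (25 * 4 ^ j)"
        by (intro mult_left_mono) auto
      then show "(L * (3 * real (word_length G S s) + 2)) powr p \<le> 25 * 4 ^ j * L powr p"
        using L by (simp add: powr_mult mult_ac)
    qed
    then show "(\<Sum>s\<in>word_ball G S (2 ^ j). (L * (3 * real (word_length G S s) + 2)) powr p) / ?N \<le> 25 * 4 ^ j * L powr p"
      using N by (simp add: field_simps)
  qed (auto intro!: divide_nonneg_nonneg sum_nonneg)
  also have "\<dots> = (\<Sum>j\<le>J. 25 * L powr p)"
    by (intro sum.cong refl) (simp add: power_one_over)
  also have "\<dots> = 25 * real (J + 1) * L powr p" by simp
  finally show ?thesis .
qed

end

context wreath
begin

text \<open>Only two values of the lamps are used, the unit and one generator \<open>s\<close>.\<close>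

definition two_lamps :: "'a \<Rightarrow> 'b set \<Rightarrow> 'b \<Rightarrow> 'a" where
  "two_lamps s A = (\<lambda>z\<in>carrier H. if z \<in> A then s else \<one>\<^bsub>G\<^esub>)"

lemma two_lamps_configs:
  assumes "s \<in> carrier G" "finite A"
  shows "two_lamps s A \<in> configs"
proof -
  have "finite {z \<in> carrier H. two_lamps s A z \<noteq> \<one>\<^bsub>G\<^esub>}"
    by (rule finite_subset[OF _ assms(2)]) (auto simp: two_lamps_def split: if_splits)
  then show ?thesis using assms by (auto simp: configs_def two_lamps_def)
qed

lemma diff_set_two_lamps:
  assumes "s \<noteq> \<one>\<^bsub>G\<^esub>" "A \<subseteq> carrier H" "A' \<subseteq> carrier H"
  shows "diff_set (two_lamps s A) (two_lamps s A') = symdiff A A'"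
  using assms by (auto simp: diff_set_def two_lamps_def symdiff_def)

lemma word_dist_two_lamps_le:
  assumes s: "s \<in> SG" "s \<noteq> \<one>\<^bsub>G\<^esub>" and A: "finite A" "A \<subseteq> carrier H" "finite A'" "A' \<subseteq> carrier H"
    and x: "x \<in> carrier H" "x' \<in> carrier H" and flip: "symdiff A A' \<subseteq> {x, x'}"
  shows "word_dist W T (two_lamps s A, x) (two_lamps s A', x') \<le> 3 * word_dist H SH x x' + 2"
proof -
  have sc: "s \<in> carrier G" using s SG_carrier by auto
  have conf: "two_lamps s A \<in> configs" "two_lamps s A' \<in> configs" using sc A two_lamps_configs by auto
  have diff: "diff_set (two_lamps s A) (two_lamps s A') = symdiff A A'" using s A by (intro diff_set_two_lamps)
  have "closed_tour H SH x (insert x' {x}) (0 + 2 * word_dist H SH x x')"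
    by (rule H.closed_tour_insert[OF SH x(1) H.closed_tour_start[OF x(1)] _ x(1,2)]) auto
  then have tour: "closed_tour H SH x (diff_set (two_lamps s A) (two_lamps s A')) (2 * word_dist H SH x x')"
    using flip by (elim H.closed_tour_mono) (auto simp: diff)
  have one: "word_dist G SG \<one>\<^bsub>G\<^esub> s \<le> 1" "word_dist G SG s \<one>\<^bsub>G\<^esub> \<le> 1"
    using G.word_dist_generator_le[OF SG G.one_closed s(1)] G.word_dist_commute[OF SG, of s "\<one>\<^bsub>G\<^esub>"] sc by auto
  have "(\<Sum>z\<in>symdiff A A'. word_dist G SG (two_lamps s A z) (two_lamps s A' z)) \<le> (\<Sum>z\<in>symdiff A A'. 1)"
    using one sc A by (intro sum_mono) (auto simp: two_lamps_def symdiff_def)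
  also have "\<dots> \<le> card {x, x'}" using flip by (simp add: card_mono)
  also have "\<dots> \<le> 2" by (simp add: card_insert_if)
  finally show ?thesis
    using word_dist_wreath_le[OF conf x tour] by (simp add: diff)
qed

lemma nontrivial_generator:
  assumes "carrier G \<noteq> {\<one>\<^bsub>G\<^esub>}"
  obtains s where "s \<in> SG" "s \<noteq> \<one>\<^bsub>G\<^esub>"
proof -
  have "word_prod G ws = \<one>\<^bsub>G\<^esub>" if "SG \<subseteq> {\<one>\<^bsub>G\<^esub>}" "set ws \<subseteq> SG" for ws
    using that(2) by (induction ws) (use that(1) in auto)
  moreover obtain g where "g \<in> carrier G" "g \<noteq> \<one>\<^bsub>G\<^esub>" using assms G.one_closed by blast
  ultimately have "\<not> SG \<subseteq> {\<one>\<^bsub>G\<^esub>}" using G.word_exists[OF SG] by metis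
  then show ?thesis using that by blast
qed

text \<open>
  The energy of the lamplighter walk in the box \<open>B\<close> after \<open>2 ^ k\<close> steps, estimated in two ways.
  From above it is at most \<open>2 ^ k\<close> times the energy of a single step, which is \<open>O(k)\<close> per state
  since \<open>F\<close> is Lipschitz. From below, a walk that starts in the core of radius \<open>r\<close> changes on
  average at least \<open>2 ^ k / (2 * \<Gamma>)\<close> lamps, and \<open>F\<close> moves the end points apart accordingly. The
  core is a fixed fraction of the box.
\<close>

lemma lamp_walk_energy_bounds:
  assumes p: "1 \<le> p" "p \<le> 2" and s: "s \<in> SG" "s \<noteq> \<one>\<^bsub>G\<^esub>" and F: "F \<in> carrier W \<rightarrow> Lp_space p"
    and L: "\<And>w v. w \<in> carrier W \<Longrightarrow> v \<in> carrier W \<Longrightarrow> Lp_dist p (F w) (F v) \<le> L * real (word_dist W T w v)"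
    and c: "c > 0" "\<And>w v. w \<in> carrier W \<Longrightarrow> v \<in> carrier W \<Longrightarrow> c * real (word_dist W T w v) powr \<alpha> \<le> Lp_dist p (F w) (F v)"
    and \<alpha>: "0 \<le> \<alpha>" "1 \<le> \<alpha> * p"
    and c0: "c0 > 0" "\<And>j. c0 * 4 ^ j \<le> real (card (word_ball H SH (2 ^ j)))"
    and K: "K \<ge> 3" "K \<ge> 32 / c0"
    and r: "0 \<le> r" "2 ^ k * 2 ^ k \<le> \<rho>" "real (card (word_ball H SH (r + \<rho>))) \<le> M * real (card (word_ball H SH r))"
  shows "c powr p * (2 ^ k / (4 * K * real (k + 2))) powr (\<alpha> * p) \<le> 2 ^ k * (M * (25 * real (k + 1) * \<bar>L\<bar> powr p))"
proof -
  define B where "B = word_ball H SH (r + \<rho>)"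
  define B' where "B' = word_ball H SH r"
  define f where "f = (\<lambda>(A, x). F (two_lamps s A, x))"
  define \<pi> where "\<pi> = H.lamp_kernel SH k"
  \<comment> \<open>The kernel of \<open>2 ^ k\<close> steps.\<close>
  define \<kappa> where "\<kappa> = (kernel_square (Pow B \<times> B) ^^ k) \<pi>"
  define \<gamma> where "\<gamma> = \<alpha> * p"
  define \<Gamma> where "\<Gamma> = K * real (k + 2)"
  define \<eta> where "\<eta> = 2 ^ k / (4 * \<Gamma>)"
  define D where "D a b = Lp_dist p (f a) (f b) powr p" for a b
  have p0: "0 < p" using p by simp
  have sc: "s \<in> carrier G" using s SG_carrier by auto
  have B: "finite B" "B \<subseteq> carrier H" using H.finite_word_ball[OF SH] H.word_ball_carrier by (auto simp: B_def)
  have finA: "finite A" "A \<subseteq> carrier H" if "A \<subseteq> B" for A using that B finite_subset by auto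
  have \<rho>: "0 \<le> \<rho>" using r(2) by (rule order_trans[rotated]) simp
  have B'B: "B' \<subseteq> B" unfolding B_def B'_def using \<rho> by (intro H.word_ball_mono) simp
  have B'1: "1 \<le> card B'" using H.card_word_ball_pos[OF SH r(1)] by (simp add: B'_def)
  have state: "(two_lamps s A, x) \<in> carrier W" if "A \<subseteq> B" "x \<in> B" for A x
    using that B finA sc two_lamps_configs carrier_W by auto
  have f_Lp: "f a \<in> Lp_space p" if "a \<in> Pow B \<times> B" for a
    using that state F by (auto simp: f_def)
  have \<Gamma>0: "\<Gamma> > 0" using K by (simp add: \<Gamma>_def)
  have \<eta>0: "\<eta> > 0" using \<Gamma>0 by (simp add: \<eta>_def)
  have fin: "finite (Pow B \<times> B)" using B by simp
  have sub: "sub_markov (Pow B \<times> B) \<pi>" unfolding \<pi>_def by (rule H.sub_markov_lamp_kernel[OF SH B])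
  have "sub_markov (Pow B \<times> B) \<kappa> \<and> energy p (Pow B \<times> B) \<kappa> f \<le> 2 ^ k * energy p (Pow B \<times> B) \<pi> f"
    unfolding \<kappa>_def by (rule energy_iterated_square_le[OF p fin sub]) (rule f_Lp)
  then have iter: "sub_markov (Pow B \<times> B) \<kappa>" "energy p (Pow B \<times> B) \<kappa> f \<le> 2 ^ k * energy p (Pow B \<times> B) \<pi> f"
    by simp_all
  have D0: "0 \<le> D a b" for a b by (simp add: D_def)
  have \<kappa>0: "0 \<le> \<kappa> a b" if "a \<in> Pow B \<times> B" "b \<in> Pow B \<times> B" for a b using iter(1) that unfolding sub_markov_def by blast
  have upper: "energy p (Pow B \<times> B) \<pi> f \<le> 2 ^ card B * real (card B) * (25 * real (k + 1) * \<bar>L\<bar> powr p)"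
  proof -
    define \<psi> where "\<psi> u = (\<bar>L\<bar> * (3 * real (word_length H SH u) + 2)) powr p" for u
    have "(\<Sum>b\<in>Pow B \<times> B. \<pi> a b * D a b) \<le> 25 * real (k + 1) * \<bar>L\<bar> powr p" if a: "a \<in> Pow B \<times> B" for a
    proof -
      obtain A x where eq: "a = (A, x)" by (metis surj_pair)
      have A: "A \<subseteq> B" and x: "x \<in> B" using a by (auto simp: eq)
      have xc: "x \<in> carrier H" using x B by auto
      have "(\<Sum>b\<in>Pow B \<times> B. \<pi> a b * D a b) \<le> (\<Sum>b\<in>Pow B \<times> B. \<pi> (A, x) b * \<psi> (inv\<^bsub>H\<^esub> x \<otimes>\<^bsub>H\<^esub> snd b))"
      proof (rule sum_mono)
        fix b assume b: "b \<in> Pow B \<times> B"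
        obtain A' x' where eqb: "b = (A', x')" by (metis surj_pair)
        have A': "A' \<subseteq> B" and x': "x' \<in> B" using b by (auto simp: eqb)
        show "\<pi> a b * D a b \<le> \<pi> (A, x) b * \<psi> (inv\<^bsub>H\<^esub> x \<otimes>\<^bsub>H\<^esub> snd b)"
        proof (cases "symdiff A A' \<subseteq> {x, x'}")
          case True
          have "word_dist W T (two_lamps s A, x) (two_lamps s A', x') \<le> 3 * word_dist H SH x x' + 2"
            using finA[OF A] finA[OF A'] x x' B True by (intro word_dist_two_lamps_le s) auto
          then have d: "real (word_dist W T (two_lamps s A, x) (two_lamps s A', x')) \<le> 3 * real (word_dist H SH x x') + 2"
            by linarith
          have "Lp_dist p (f a) (f b) \<le> L * real (word_dist W T (two_lamps s A, x) (two_lamps s A', x'))"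
            using L[OF state[OF A x] state[OF A' x']] by (simp add: f_def eq eqb)
          also have "\<dots> \<le> \<bar>L\<bar> * (3 * real (word_dist H SH x x') + 2)"
            using d by (intro mult_mono) auto
          finally have "D a b \<le> \<psi> (inv\<^bsub>H\<^esub> x \<otimes>\<^bsub>H\<^esub> x')"
            unfolding D_def \<psi>_def word_dist_def[of H] using p0 by (intro powr_mono2) auto
          then show ?thesis
            using sub a b by (auto simp: eq eqb sub_markov_def intro!: mult_left_mono)
        next
          case False
          then show ?thesis by (simp add: eq eqb \<pi>_def H.lamp_kernel_def)
        qed
      qed
      also have "\<dots> = (\<Sum>x'\<in>B. H.multiscale_step SH k (inv\<^bsub>H\<^esub> x \<otimes>\<^bsub>H\<^esub> x') * \<psi> (inv\<^bsub>H\<^esub> x \<otimes>\<^bsub>H\<^esub> x'))"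
        unfolding \<pi>_def by (rule H.sum_lamp_kernel_position[OF B(1) A x])
      also have "\<dots> \<le> (\<Sum>u\<in>word_ball H SH (2 ^ k). H.multiscale_step SH k u * \<psi> u)"
        by (rule H.sum_step_translate_le[OF SH B xc]) (simp add: \<psi>_def)
      also have "\<dots> \<le> 25 * real (k + 1) * \<bar>L\<bar> powr p"
        unfolding \<psi>_def using p by (intro H.step_moment_le[OF SH]) auto
      finally show ?thesis .
    qed
    then have "energy p (Pow B \<times> B) \<pi> f \<le> (\<Sum>a\<in>Pow B \<times> B. 25 * real (k + 1) * \<bar>L\<bar> powr p)"
      unfolding energy_def D_def by (intro sum_mono) auto
    then show ?thesis using B by (simp add: card_cartesian_product card_Pow)
  qed
  have lower: "2 ^ card B * real (card B') * (c powr p * \<eta> powr \<gamma>) \<le> energy p (Pow B \<times> B) \<kappa> f"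
  proof -
    have row: "c powr p * \<eta> powr \<gamma> \<le> (\<Sum>b\<in>Pow B \<times> B. \<kappa> a b * D a b)" if a: "a \<in> Pow B \<times> B'" for a
    proof -
      obtain A x where eq: "a = (A, x)" by (metis surj_pair)
      have A: "A \<subseteq> B" and x: "x \<in> B'" "x \<in> B" using a B'B by (auto simp: eq)
      have xc: "x \<in> carrier H" using x B by auto
      have aX: "a \<in> Pow B \<times> B" using A x by (simp add: eq)
      have xl: "real (word_length H SH x) \<le> r" using x by (simp add: B'_def H.word_ball_eq)
      define N where "N b = real (card (symdiff A (fst b)))" for b :: "'b set \<times> 'b"
      have D_ge: "c powr p * (\<eta> powr (\<gamma> - 1) * (N b - \<eta>)) \<le> D a b" if b: "b \<in> Pow B \<times> B" for b
      proof -
        obtain A' x' where eqb: "b = (A', x')" by (metis surj_pair)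
        have A': "A' \<subseteq> B" and x': "x' \<in> B" using b by (auto simp: eqb)
        have conf: "two_lamps s A \<in> configs" "two_lamps s A' \<in> configs"
          using sc finA A A' two_lamps_configs by auto
        have "card (symdiff A A') \<le> word_dist W T (two_lamps s A, x) (two_lamps s A', x')"
        proof -
          have x'c: "x' \<in> carrier H" using x' B(2) by blast
          show ?thesis
            using card_diff_set_le_word_dist[OF conf xc x'c]
            unfolding diff_set_two_lamps[OF s(2) finA(2)[OF A] finA(2)[OF A']] .
        qed
        then have "c * N b powr \<alpha> \<le> c * real (word_dist W T (two_lamps s A, x) (two_lamps s A', x')) powr \<alpha>"
          using c \<alpha> by (intro mult_left_mono powr_mono2) (auto simp: N_def eqb)
        also have "\<dots> \<le> Lp_dist p (f a) (f b)"
          using c(2)[OF state[OF A x(2)] state[OF A' x']] by (simp add: f_def eq eqb)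
        finally have "(c * N b powr \<alpha>) powr p \<le> D a b"
          unfolding D_def using c p0 by (intro powr_mono2) auto
        then have "c powr p * N b powr \<gamma> \<le> D a b" using c by (simp add: powr_mult powr_powr \<gamma>_def)
        moreover have "\<eta> powr (\<gamma> - 1) * (N b - \<eta>) \<le> N b powr \<gamma>"
          using \<alpha> \<eta>0 by (intro powr_ge_affine) (auto simp: \<gamma>_def N_def)
        then have "c powr p * (\<eta> powr (\<gamma> - 1) * (N b - \<eta>)) \<le> c powr p * N b powr \<gamma>"
          by (intro mult_left_mono) auto
        ultimately show ?thesis by linarith
      qed
      have mean: "2 * \<eta> \<le> (\<Sum>b\<in>Pow B \<times> B. \<kappa> a b * N b)"
      proof -
        \<comment> \<open>Half of the lamps that have been met are changed.\<close>
        have hit: "(\<Sum>b\<in>Pow B \<times> B. \<kappa> a b * (if z \<in> symdiff A (fst b) then 1 else 0)) = 1 / 2 * (1 - H.avoidance SH k z (2 ^ k) x)" for z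
        proof -
          have "(\<Sum>b\<in>Pow B \<times> B. \<kappa> a b * (if z \<in> symdiff A (fst b) then 1 else 0))
              = apply_kernel (Pow B \<times> B) \<kappa> (\<lambda>(A', x'). 1 / 2 + bit_sign z (symdiff A' A)) a"
            unfolding apply_kernel_def by (intro sum.cong refl) (auto simp: bit_sign_def in_symdiff split: prod.splits)
          also have "\<dots> = (apply_kernel (Pow B \<times> B) \<pi> ^^ (2 ^ k)) (\<lambda>(A', x'). 1 / 2 + bit_sign z (symdiff A' A)) (A, x)"
            by (simp add: \<kappa>_def apply_kernel_iterated_square eq)
          also have "\<dots> = 1 / 2 + bit_sign z (symdiff A A) * H.avoidance SH k z (2 ^ k) x"
            unfolding B_def \<pi>_def
          proof (rule H.lamp_kernel_iterate[OF SH _ _ xc])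
            show "real (word_length H SH x) + real (2 ^ k) * 2 ^ k \<le> r + \<rho>" using xl r(2) by simp
          qed (use A B_def in auto)
          also have "\<dots> = 1 / 2 * (1 - H.avoidance SH k z (2 ^ k) x)" by (simp add: bit_sign_def symdiff_def algebra_simps)
          finally show ?thesis .
        qed
        have "real (2 ^ k) \<le> \<Gamma> * (\<Sum>z\<in>B. 1 - H.avoidance SH k z (2 ^ k) x)"
        proof (rule H.expected_range_ge[OF SH xc _ B])
          show "1 \<le> (2::nat) ^ k" by simp
          show "(\<Sum>i\<le>2 ^ k. H.walk_distribution SH k i y) \<le> \<Gamma>" if "y \<in> carrier H" for y
            unfolding \<Gamma>_def by (rule H.expected_visits_bound[OF SH c0 K that])
          fix y assume y: "y \<in> carrier H" "real (word_dist H SH x y) \<le> real (2 ^ k) * 2 ^ k"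
          have "word_dist H SH \<one>\<^bsub>H\<^esub> y \<le> word_dist H SH \<one>\<^bsub>H\<^esub> x + word_dist H SH x y"
            by (intro H.word_dist_triangle[OF SH] H.one_closed xc y)
          then have "word_length H SH y \<le> word_length H SH x + word_dist H SH x y"
            using xc y by (simp add: word_dist_def)
          moreover have "real (2 ^ k) * 2 ^ k \<le> \<rho>" using r(2) by simp
          ultimately show "y \<in> B" using y xl unfolding B_def H.word_ball_eq mem_Collect_eq by linarith
        qed
        then have "2 * \<eta> \<le> 1 / 2 * (\<Sum>z\<in>B. 1 - H.avoidance SH k z (2 ^ k) x)"
          using \<Gamma>0 by (simp add: \<eta>_def field_simps)
        also have "\<dots> = (\<Sum>z\<in>B. 1 / 2 * (1 - H.avoidance SH k z (2 ^ k) x))"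
          by (rule sum_distrib_left)
        also have "\<dots> = (\<Sum>z\<in>B. \<Sum>b\<in>Pow B \<times> B. \<kappa> a b * (if z \<in> symdiff A (fst b) then 1 else 0))"
          by (simp only: hit)
        also have "\<dots> = (\<Sum>b\<in>Pow B \<times> B. \<Sum>z\<in>B. \<kappa> a b * (if z \<in> symdiff A (fst b) then 1 else 0))"
          by (rule sum.swap)
        also have "\<dots> = (\<Sum>b\<in>Pow B \<times> B. \<kappa> a b * N b)"
        proof (rule sum.cong[OF refl])
          fix b assume b: "b \<in> Pow B \<times> B"
          have "symdiff A (fst b) \<subseteq> A \<union> fst b" by (auto simp: symdiff_def)
          moreover have "fst b \<subseteq> B" using b by (cases b) simp
          ultimately have "symdiff A (fst b) \<subseteq> B" using A by blast
          have "(\<Sum>z\<in>B. if z \<in> symdiff A (fst b) then 1 else 0) = N b"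
          proof -
            have "(\<Sum>z\<in>B. if z \<in> symdiff A (fst b) then 1 else 0) = (\<Sum>z\<in>{z \<in> B. z \<in> symdiff A (fst b)}. 1 :: real)"
              by (rule sum.inter_filter[OF B(1), symmetric])
            also have "{z \<in> B. z \<in> symdiff A (fst b)} = symdiff A (fst b)" using \<open>symdiff A (fst b) \<subseteq> B\<close> by blast
            finally show ?thesis by (simp add: N_def)
          qed
          then show "(\<Sum>z\<in>B. \<kappa> a b * (if z \<in> symdiff A (fst b) then 1 else 0)) = \<kappa> a b * N b"
            by (simp add: sum_distrib_left[symmetric])
        qed
        finally show ?thesis .
      qed
      have mass: "(\<Sum>b\<in>Pow B \<times> B. \<kappa> a b) \<le> 1" using iter(1) aX unfolding sub_markov_def by blast
      have "\<eta> powr \<gamma> = \<eta> powr (\<gamma> - 1) * \<eta>" using \<eta>0 by (simp add: powr_diff)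
      also have "\<dots> \<le> \<eta> powr (\<gamma> - 1) * ((\<Sum>b\<in>Pow B \<times> B. \<kappa> a b * N b) - (\<Sum>b\<in>Pow B \<times> B. \<kappa> a b) * \<eta>)"
      proof (rule mult_left_mono)
        have "(\<Sum>b\<in>Pow B \<times> B. \<kappa> a b) * \<eta> \<le> 1 * \<eta>" using mass \<eta>0 by (intro mult_right_mono) auto
        then show "\<eta> \<le> (\<Sum>b\<in>Pow B \<times> B. \<kappa> a b * N b) - (\<Sum>b\<in>Pow B \<times> B. \<kappa> a b) * \<eta>" using mean by linarith
      qed simp
      also have "\<dots> = (\<Sum>b\<in>Pow B \<times> B. \<kappa> a b * (\<eta> powr (\<gamma> - 1) * (N b - \<eta>)))"
        unfolding sum_distrib_right sum_subtractf[symmetric] sum_distrib_left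
        by (intro sum.cong refl) (simp add: algebra_simps)
      finally have "c powr p * \<eta> powr \<gamma> \<le> c powr p * (\<Sum>b\<in>Pow B \<times> B. \<kappa> a b * (\<eta> powr (\<gamma> - 1) * (N b - \<eta>)))"
        by (intro mult_left_mono) auto
      also have "\<dots> = (\<Sum>b\<in>Pow B \<times> B. \<kappa> a b * (c powr p * (\<eta> powr (\<gamma> - 1) * (N b - \<eta>))))"
        unfolding sum_distrib_left by (intro sum.cong refl) (simp add: mult_ac)
      also have "\<dots> \<le> (\<Sum>b\<in>Pow B \<times> B. \<kappa> a b * D a b)"
        using D_ge \<kappa>0[OF aX] by (intro sum_mono mult_left_mono) auto
      finally show ?thesis .
    qed
    have "2 ^ card B * real (card B') * (c powr p * \<eta> powr \<gamma>) = (\<Sum>a\<in>Pow B \<times> B'. c powr p * \<eta> powr \<gamma>)"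
      using B by (simp add: card_cartesian_product card_Pow)
    also have "\<dots> \<le> (\<Sum>a\<in>Pow B \<times> B'. \<Sum>b\<in>Pow B \<times> B. \<kappa> a b * D a b)" by (intro sum_mono row)
    also have "\<dots> \<le> (\<Sum>a\<in>Pow B \<times> B. \<Sum>b\<in>Pow B \<times> B. \<kappa> a b * D a b)"
      using fin B'B \<kappa>0 D0 by (intro sum_mono2 sum_nonneg mult_nonneg_nonneg) auto
    finally show ?thesis by (simp add: energy_def D_def)
  qed
  define Q where "Q = 25 * real (k + 1) * \<bar>L\<bar> powr p"
  have Q: "0 \<le> Q" by (simp add: Q_def)
  note lower
  also note iter(2)
  also have "2 ^ k * energy p (Pow B \<times> B) \<pi> f \<le> 2 ^ k * (2 ^ card B * real (card B) * Q)"
    using upper unfolding Q_def by (intro mult_left_mono) auto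
  also have "\<dots> \<le> 2 ^ k * (2 ^ card B * (M * real (card B')) * Q)"
    using r(3) Q unfolding B_def B'_def by (intro mult_left_mono mult_right_mono) auto
  also have "\<dots> = 2 ^ card B * real (card B') * (2 ^ k * (M * Q))" by (simp add: mult_ac)
  finally have "c powr p * \<eta> powr \<gamma> \<le> 2 ^ k * (M * Q)"
    using B'1 by (simp add: mult_le_cancel_left_pos)
  then show ?thesis by (simp add: \<eta>_def \<Gamma>_def \<gamma>_def Q_def mult.assoc)
qed

text \<open>
  The two estimates of the energy give \<open>(2 ^ k / k) powr (\<alpha> * p) = O(k * 2 ^ k)\<close>, which is
  impossible for all \<open>k\<close> if \<open>\<alpha> * p > 1\<close>.
\<close>

lemma compression_bound_le:
  assumes p: "1 \<le> p" "p \<le> 2" and nontriv: "carrier G \<noteq> {\<one>\<^bsub>G\<^esub>}"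
    and poly: "polynomial_growth H" and quad: "at_least_quadratic_growth H"
    and bound: "Lp_compression_bound p W T \<alpha>" and \<alpha>0: "0 \<le> \<alpha>"
  shows "\<alpha> \<le> 1 / p"
proof (rule ccontr)
  assume "\<not> \<alpha> \<le> 1 / p"
  then have \<alpha>: "1 < \<alpha> * p" using p by (simp add: field_simps)
  obtain s where s: "s \<in> SG" "s \<noteq> \<one>\<^bsub>G\<^esub>" using nontrivial_generator[OF nontriv] .
  obtain F L c where F: "F \<in> carrier W \<rightarrow> Lp_space p"
    and L: "\<And>w v. w \<in> carrier W \<Longrightarrow> v \<in> carrier W \<Longrightarrow> Lp_dist p (F w) (F v) \<le> L * real (word_dist W T w v)"
    and c: "c > 0" "\<And>w v. w \<in> carrier W \<Longrightarrow> v \<in> carrier W \<Longrightarrow> c * real (word_dist W T w v) powr \<alpha> \<le> Lp_dist p (F w) (F v)"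
    using bound unfolding Lp_compression_bound_def by blast
  obtain c0 where c0: "c0 > 0" "\<And>r. r \<ge> 1 \<Longrightarrow> c0 * r\<^sup>2 \<le> real (card (word_ball H SH r))"
    using quad H.quadratic_growth_iff[OF SH] by auto
  have c0': "c0 * 4 ^ j \<le> real (card (word_ball H SH (2 ^ j)))" for j
  proof -
    have "((2::real) ^ j)\<^sup>2 = 4 ^ j" by (simp add: power2_eq_square flip: power_mult_distrib)
    then show ?thesis using c0(2)[of "2 ^ j"] by simp
  qed
  define K where "K = max 3 (32 / c0)"
  have K: "K \<ge> 3" "K \<ge> 32 / c0" by (auto simp: K_def)
  \<comment> \<open>A radius whose gap \<open>2 ^ i / 8 / (i + 1)\<close> exceeds the range \<open>2 ^ k * 2 ^ k\<close> of the walk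
    gives a box in which the starting points far from the boundary have density at least
    \<open>1 / M\<close>.\<close>
  obtain M r where M: "M > 0" and r: "\<And>i. 2 ^ i / 8 \<le> r i"
    "\<And>i. real (card (word_ball H SH (r i + 2 ^ i / 8 / real (i + 1)))) \<le> M * real (card (word_ball H SH (r i)))"
    using H.polynomial_growth_radii[OF SH poly] by metis
  define b where "b = M * 25 * \<bar>L\<bar> powr p / c powr p"
  have key: "(2 ^ k / (4 * K * real (k + 2))) powr (\<alpha> * p) / (2 ^ k * real (k + 1)) \<le> b" for k :: nat
  proof -
    have "filterlim (\<lambda>i::nat. 2 ^ i / 8 / real (i + 1)) at_top at_top" by real_asymp
    then have "eventually (\<lambda>i::nat. 2 ^ k * 2 ^ k \<le> (2::real) ^ i / 8 / real (i + 1)) at_top"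
      by (auto simp: filterlim_at_top)
    then obtain i :: nat where i: "2 ^ k * 2 ^ k \<le> (2::real) ^ i / 8 / real (i + 1)"
      using eventually_happens' sequentially_bot by blast
    have "0 \<le> r i" using r(1)[of i] by (rule order_trans[rotated]) simp
    then have "c powr p * (2 ^ k / (4 * K * real (k + 2))) powr (\<alpha> * p) \<le> 2 ^ k * (M * (25 * real (k + 1) * \<bar>L\<bar> powr p))"
      using lamp_walk_energy_bounds[OF p s F L c \<alpha>0 less_imp_le[OF \<alpha>] c0(1) c0' K _ i r(2)] by blast
    also have "\<dots> = (2 ^ k * real (k + 1)) * (M * 25 * \<bar>L\<bar> powr p)" by (simp only: mult_ac)
    finally have bd: "c powr p * (2 ^ k / (4 * K * real (k + 2))) powr (\<alpha> * p) \<le> (2 ^ k * real (k + 1)) * (M * 25 * \<bar>L\<bar> powr p)" .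
    have "u / m \<le> q / d" if "d * u \<le> m * q" "d > 0" "m > 0" for u m q d :: real
      using that by (simp add: field_simps)
    from this[OF bd] show ?thesis using c(1) by (simp add: b_def)
  qed
  have "filterlim (\<lambda>k::nat. (2 ^ k / (4 * K * real (k + 2))) powr (\<alpha> * p) / (2 ^ k * real (k + 1))) at_top at_top"
    using \<alpha> K by real_asymp
  then have "eventually (\<lambda>k::nat. b + 1 \<le> (2 ^ k / (4 * K * real (k + 2))) powr (\<alpha> * p) / (2 ^ k * real (k + 1))) at_top"
    by (auto simp: filterlim_at_top)
  then obtain k :: nat where "b + 1 \<le> (2 ^ k / (4 * K * real (k + 2))) powr (\<alpha> * p) / (2 ^ k * real (k + 1))"
    using eventually_happens' sequentially_bot by blast
  then show False using key[of k] by linarith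
qed

text \<open>
  Exponents strictly below \<open>1 / p\<close> and not above a valid exponent of \<open>G\<close> are valid for the
  wreath product. Zero is among them, which matters when the supremum for \<open>G\<close> is zero.
\<close>

lemma compression_wreath_ge:
  assumes p: "1 \<le> p" and poly: "polynomial_growth H"
  shows "min (ereal (1 / p)) (Lp_compression p G) \<le> Lp_compression p W"
proof (rule dense_le)
  let ?C = "{ereal \<alpha> | \<alpha>. 0 \<le> \<alpha> \<and> Lp_compression_bound p W T \<alpha>}"
  fix y assume y: "y < min (ereal (1 / p)) (Lp_compression p G)"
  then have "y < Sup {ereal \<alpha> | \<alpha>. 0 \<le> \<alpha> \<and> Lp_compression_bound p G SG \<alpha>}"
    by (simp add: G.Lp_compression_eq[OF SG])
  then obtain \<alpha> where \<alpha>: "0 \<le> \<alpha>" "Lp_compression_bound p G SG \<alpha>" "y < ereal \<alpha>"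
    by (auto simp: less_Sup_iff)
  have "\<exists>\<beta>. 0 \<le> \<beta> \<and> y \<le> ereal \<beta> \<and> \<beta> \<le> \<alpha> \<and> \<beta> < 1 / p"
  proof (cases "y < 0")
    case True
    then show ?thesis using \<alpha> p by (intro exI[of _ 0]) (auto simp: zero_ereal_def[symmetric])
  next
    case False
    then obtain \<beta> where "y = ereal \<beta>" using \<alpha> by (cases y) auto
    then show ?thesis using False \<alpha> y by (intro exI[of _ \<beta>]) auto
  qed
  then obtain \<beta> where \<beta>: "0 \<le> \<beta>" "y \<le> ereal \<beta>" "\<beta> \<le> \<alpha>" "\<beta> < 1 / p" by blast
  have "Lp_compression_bound p W T \<beta>" by (rule wreath_compression_bound[OF p poly \<alpha>(2) \<beta>(1,3,4)])
  then have "ereal \<beta> \<le> Sup ?C" using \<beta> by (intro Sup_upper) auto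
  then show "y \<le> Lp_compression p W" using \<beta>(2) by (simp add: W.Lp_compression_eq[OF sym_gen_set_T])
qed

lemma compression_wreath_le:
  assumes p: "1 \<le> p" "p \<le> 2" and nontriv: "carrier G \<noteq> {\<one>\<^bsub>G\<^esub>}"
    and poly: "polynomial_growth H" and quad: "at_least_quadratic_growth H"
  shows "Lp_compression p W \<le> ereal (1 / p)"
  unfolding W.Lp_compression_eq[OF sym_gen_set_T]
  using compression_bound_le[OF assms] by (intro Sup_least) auto

end

text \<open>
  The inclusion into the constant functions is an isometry for the generators \<open>1\<close> and \<open>- 1\<close>.
\<close>

lemma compression_integer_group:
  assumes p: "1 \<le> p"
  shows "finitely_generated_group integer_group" "1 \<le> Lp_compression p integer_group"
proof -
  interpret Z: group integer_group by (rule group_integer_group)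
  define S where "S = {1, -1 :: int}"
  have inv: "inv\<^bsub>integer_group\<^esub> n = - n" for n :: int by (simp add: inv_integer_group)
  have rep: "word_prod integer_group (replicate k a) = int k * a" for k a
    by (induction k) (auto simp: algebra_simps)
  have len: "\<bar>word_prod integer_group ws\<bar> \<le> int (length ws)" if "set ws \<subseteq> S" for ws
    using that by (induction ws) (auto simp: S_def)
  have word: "\<exists>ws. set ws \<subseteq> S \<and> int (length ws) = \<bar>n\<bar> \<and> word_prod integer_group ws = n" for n :: int
  proof (cases "0 \<le> n")
    case True
    then show ?thesis using rep[of "nat n" 1]
      by (intro exI[of _ "replicate (nat n) 1"]) (auto simp: S_def set_replicate_conv_if)
  next
    case False
    then show ?thesis using rep[of "nat (- n)" "-1"]
      by (intro exI[of _ "replicate (nat (- n)) (- 1)"]) (auto simp: S_def set_replicate_conv_if)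
  qed
  have gen: "word_prod integer_group ws \<in> generate integer_group S" if "set ws \<subseteq> S" for ws
    using that by (induction ws) (auto intro: generate.intros simp del: mult_integer_group one_integer_group)
  have "generate integer_group S = carrier integer_group"
    using word gen by (metis UNIV_eq_I carrier_integer_group)
  then have S: "sym_gen_set integer_group S" by (auto simp: sym_gen_set_def S_def inv)
  then show "finitely_generated_group integer_group"
    using Z.group_axioms by (auto simp: finitely_generated_group_def sym_gen_set_def)
  have dist: "real (word_dist integer_group S m n) = \<bar>real_of_int m - real_of_int n\<bar>" for m n
  proof -
    obtain ws where ws: "set ws \<subseteq> S" "int (length ws) = \<bar>- m + n\<bar>" "word_prod integer_group ws = - m + n"
      using word by blast
    have "word_length integer_group S (- m + n) \<le> length ws" by (rule Z.word_length_le[OF ws(1,3)])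
    moreover obtain vs where "set vs \<subseteq> S" "length vs = word_length integer_group S (- m + n)" "word_prod integer_group vs = - m + n"
      using Z.word_length_witness[OF S, of "- m + n"] by auto
    then have "\<bar>- m + n\<bar> \<le> int (word_length integer_group S (- m + n))" using len by metis
    ultimately have "int (word_dist integer_group S m n) = \<bar>m - n\<bar>"
      using ws(2) by (simp add: word_dist_def inv)
    then show ?thesis by (metis of_int_abs of_int_diff of_int_of_nat_eq)
  qed
  have "Lp_compression_bound p integer_group S 1"
    unfolding Lp_compression_bound_def using p
    by (intro exI[of _ "\<lambda>n _. real_of_int n"] conjI exI[of _ 1]) (auto simp: dist Lp_dist_const)
  then have "ereal 1 \<le> Lp_compression p integer_group"
    unfolding Z.Lp_compression_eq[OF S] by (intro Sup_upper) auto
  then show "1 \<le> Lp_compression p integer_group" by (simp add: one_ereal_def)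
qed

text \<open>
  With both elements as generators the inclusion into the constant functions is an isometry.
\<close>

lemma compression_cyclic_group_2:
  assumes p: "1 \<le> p"
  shows "finitely_generated_group (integer_mod_group 2)" "1 \<le> Lp_compression p (integer_mod_group 2)"
proof -
  let ?C = "integer_mod_group 2"
  interpret C: group ?C by (rule group_integer_mod_group)
  have carr: "carrier ?C = {0, 1}" by (auto simp: carrier_integer_mod_group)
  have S: "sym_gen_set ?C (carrier ?C)"
    using C.generate_incl[of "carrier ?C"] by (auto simp: sym_gen_set_def carr intro: generate.incl)
  then show "finitely_generated_group ?C"
    using C.group_axioms by (auto simp: finitely_generated_group_def sym_gen_set_def)
  have dist: "real (word_dist ?C (carrier ?C) x y) = \<bar>real_of_int x - real_of_int y\<bar>"
    if xy: "x \<in> carrier ?C" "y \<in> carrier ?C" for x y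
  proof (cases "x = y")
    case False
    have "word_dist ?C (carrier ?C) x y \<noteq> 0" using C.word_dist_eq_0[OF S xy] False by blast
    moreover have "word_dist ?C (carrier ?C) x y \<le> 1"
    proof -
      define u where "u = inv\<^bsub>?C\<^esub> x \<otimes>\<^bsub>?C\<^esub> y"
      have u: "u \<in> carrier ?C" unfolding u_def using xy by (intro C.m_closed C.inv_closed)
      have "word_length ?C (carrier ?C) u \<le> length [u]"
      proof (rule C.word_length_le)
        show "word_prod ?C [u] = u" unfolding C.word_prod_Cons C.word_prod_Nil by (rule C.r_one[OF u])
      qed (use u in simp)
      then show ?thesis by (simp add: word_dist_def u_def)
    qed
    ultimately have "word_dist ?C (carrier ?C) x y = 1" by linarith
    then show ?thesis using False xy by (auto simp: carr)
  qed (use xy in simp)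
  have "Lp_compression_bound p ?C (carrier ?C) 1"
    unfolding Lp_compression_bound_def using p
    by (intro exI[of _ "\<lambda>n _. real_of_int n"] conjI exI[of _ 1]) (auto simp: dist Lp_dist_const)
  then have "ereal 1 \<le> Lp_compression p ?C"
    unfolding C.Lp_compression_eq[OF S] by (intro Sup_upper) auto
  then show "1 \<le> Lp_compression p ?C" by (simp add: one_ereal_def)
qed

lemma wreath_exists:
  assumes "finitely_generated_group G" "finitely_generated_group H"
  shows "\<exists>SG SH. wreath G H SG SH"
proof -
  have "group G" "group H" using assms by (auto simp: finitely_generated_group_def)
  then obtain SG SH where "sym_gen_set G SG" "sym_gen_set H SH"
    using assms group.sym_gen_set_exists by metis
  then show ?thesis using \<open>group G\<close> \<open>group H\<close> unfolding wreath_def wreath_axioms_def by blast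
qed

theorem theorem3p1:
  fixes G :: "('a, 'm) monoid_scheme" and H :: "('b, 'n) monoid_scheme"
  assumes "finitely_generated_group H" and "carrier H \<noteq> {\<one>\<^bsub>H\<^esub>}"
    and "polynomial_growth H"
  shows "(finitely_generated_group G \<and> carrier G \<noteq> {\<one>\<^bsub>G\<^esub>} \<longrightarrow>
            (\<forall>p\<in>{1..2}. Lp_compression p (wreath_product G H)
                          \<ge> min (ereal (1 / p)) (Lp_compression p G))) \<and>
         (at_least_quadratic_growth H \<longrightarrow>
            (\<forall>p\<in>{1..2}.
               Lp_compression p (wreath_product integer_group H) = ereal (1 / p) \<and>
               Lp_compression p (wreath_product (integer_mod_group 2) H) = ereal (1 / p)))"
proof (intro conjI impI ballI)
  fix p :: real
  assume G: "finitely_generated_group G \<and> carrier G \<noteq> {\<one>\<^bsub>G\<^esub>}" and p: "p \<in> {1..2}"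
  obtain SG SH where "wreath G H SG SH" using wreath_exists G assms(1) by blast
  then show "Lp_compression p (wreath_product G H) \<ge> min (ereal (1 / p)) (Lp_compression p G)"
    using wreath.compression_wreath_ge p assms(3) by fastforce
next
  fix p :: real
  assume quad: "at_least_quadratic_growth H" and p: "p \<in> {1..2}"
  have p1: "1 \<le> p" "p \<le> 2" using p by auto
  have inv_p: "ereal (1 / p) \<le> 1" using p1 by (simp add: one_ereal_def)
  have sharp: "Lp_compression p (wreath_product C H) = ereal (1 / p)"
    if C: "finitely_generated_group C" "1 \<le> Lp_compression p C" "carrier C \<noteq> {\<one>\<^bsub>C\<^esub>}" for C :: "int monoid"
  proof -
    obtain SG SH where w: "wreath C H SG SH" using wreath_exists C(1) assms(1) by blast
    have "min (ereal (1 / p)) (Lp_compression p C) = ereal (1 / p)"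
      using inv_p C(2) by (meson min_absorb1 order_trans)
    then show ?thesis
      using wreath.compression_wreath_ge[OF w p1(1) assms(3)]
        wreath.compression_wreath_le[OF w p1 C(3) assms(3) quad] by simp
  qed
  have "carrier integer_group \<noteq> {\<one>\<^bsub>integer_group\<^esub>}"
    by (metis UNIV_I carrier_integer_group one_neq_zero singletonD singleton_iff)
  then show "Lp_compression p (wreath_product integer_group H) = ereal (1 / p)"
    using compression_integer_group[OF p1(1)] by (intro sharp)
  have "1 \<in> carrier (integer_mod_group 2)" by (simp add: carrier_integer_mod_group)
  then have "carrier (integer_mod_group 2) \<noteq> {\<one>\<^bsub>integer_mod_group 2\<^esub>}"
    by (metis one_integer_mod_group one_neq_zero singletonD)
  then show "Lp_compression p (wreath_product (integer_mod_group 2) H) = ereal (1 / p)"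
    using compression_cyclic_group_2[OF p1(1)] by (intro sharp)
qed

end
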